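(* For every $t \in \mathbb{N}$ there exists $c \in \mathbb{N}$ such that every graph $G \in \mathcal{X}_t$ that contains neither a pair of false twins nor a clique cutset of size at most $2$ is either a complete graph or satisfies $\mathrm{tw}(G) \le c$.
   Context: All graphs are finite and simple. For graphs $G_1=(V_1,E_1)$, $G_2=(V_2,E_2)$, $G_1\cap G_2=(V_1\cap V_2, E_1\cap E_2)$. For a graph $G=(V,E)$ and an injective map $\alpha$ on $V$, $G^{\alpha}$ has vertex set $\alpha(V)$ and edge set $\{\{\alpha(v),\alpha(w)\}: \{v,w\}\in E\}$. We write $G\xrightarrow{\cap} H$ if $H$ is (isomorphic to) $G^{\alpha_1}\cap\cdots\cap G^{\alpha_k}$ for some $k\ge1$ and injective maps $\alpha_1,\dots,\alpha_k$ on $V(G)$. For a set $M$ of graphs, $\mathrm{SiFree}(M)$ is the class of graphs $G$ such that $G\xrightarrow{\cap}F$ holds for no $F\in M$. For integers $a,b,c\ge1$, $S_{a,b,c}$ is the tree consisting of a vertex of degree $3$ together with three pendant paths (legs) having $a$, $b$, $c$ edges respectively; $tS_{t,t,t}$ is the disjoint union of $t$ copies of $S_{t,t,t}$, and $\mathcal{X}_t=\mathrm{SiFree}(\{tS_{t,t,t}\})$. Two distinct vertices $x,y$ are false twins if they are non-adjacent and $N(x)=N(y)$. A clique cutset is a (possibly empty) clique $U\subseteq V(G)$ such that $G-U$ is disconnected. $\mathrm{tw}$ denotes treewidth. *)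

theory Defs
  imports Main
begin

type_synonym 'a graph = "'a set \<times> 'a set set"

definition verts :: "'a graph \<Rightarrow> 'a set" where "verts G = fst G"
definition edges :: "'a graph \<Rightarrow> 'a set set" where "edges G = snd G"

definition wf_graph :: "'a graph \<Rightarrow> bool" where
  "wf_graph G \<longleftrightarrow> finite (verts G) \<and>
     (\<forall>e\<in>edges G. \<exists>u v. e = {u, v} \<and> u \<noteq> v \<and> u \<in> verts G \<and> v \<in> verts G)"

definition adj :: "'a graph \<Rightarrow> 'a \<Rightarrow> 'a \<Rightarrow> bool" where
  "adj G u v \<longleftrightarrow> {u, v} \<in> edges G"

definition nbhd :: "'a graph \<Rightarrow> 'a \<Rightarrow> 'a set" where
  "nbhd G x = {w \<in> verts G. adj G x w}"

definition graph_map :: "('a \<Rightarrow> 'b) \<Rightarrow> 'a graph \<Rightarrow> 'b graph" where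
  "graph_map \<alpha> G = (\<alpha> ` verts G, (\<lambda>e. \<alpha> ` e) ` edges G)"

definition inter_maps :: "'a graph \<Rightarrow> ('a \<Rightarrow> 'b) list \<Rightarrow> 'b graph" where
  "inter_maps G \<alpha>s = ((\<Inter>\<alpha>\<in>set \<alpha>s. verts (graph_map \<alpha> G)),
                       (\<Inter>\<alpha>\<in>set \<alpha>s. edges (graph_map \<alpha> G)))"

definition graph_iso :: "'a graph \<Rightarrow> 'b graph \<Rightarrow> bool" where
  "graph_iso G H \<longleftrightarrow> (\<exists>f. bij_betw f (verts G) (verts H) \<and>
     (\<forall>u\<in>verts G. \<forall>v\<in>verts G. {u, v} \<in> edges G \<longleftrightarrow> {f u, f v} \<in> edges H))"

text \<open>G -cap-> H; the injective maps take values in the countably infinite universe nat\<close>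
definition si_arrow :: "'a graph \<Rightarrow> 'b graph \<Rightarrow> bool" where
  "si_arrow G H \<longleftrightarrow> (\<exists>\<alpha>s :: ('a \<Rightarrow> nat) list. \<alpha>s \<noteq> [] \<and>
      (\<forall>\<alpha>\<in>set \<alpha>s. inj_on \<alpha> (verts G)) \<and> graph_iso (inter_maps G \<alpha>s) H)"

definition SiFree :: "'b graph set \<Rightarrow> 'a graph set" where
  "SiFree M = {G. wf_graph G \<and> (\<forall>F\<in>M. \<not> si_arrow G F)}"

text \<open>S_{a,b,c}: centre 0, legs 1..a, a+1..a+b, a+b+1..a+b+c, shifted by offset off\<close>
definition spider_edges :: "nat \<Rightarrow> nat \<Rightarrow> nat \<Rightarrow> nat \<Rightarrow> nat set set" where
  "spider_edges a b c off =
     {{off, off + 1}, {off, off + a + 1}, {off, off + a + b + 1}} \<union>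
     {{off + i, off + i + 1} | i. 1 \<le> i \<and> i < a} \<union>
     {{off + i, off + i + 1} | i. a + 1 \<le> i \<and> i < a + b} \<union>
     {{off + i, off + i + 1} | i. a + b + 1 \<le> i \<and> i < a + b + c}"

definition S_graph :: "nat \<Rightarrow> nat \<Rightarrow> nat \<Rightarrow> nat graph" where
  "S_graph a b c = ({0 .. a + b + c}, spider_edges a b c 0)"

definition tS :: "nat \<Rightarrow> nat graph" where
  "tS t = ((\<Union>j<t. {j * (3 * t + 1) .. j * (3 * t + 1) + 3 * t}),
           (\<Union>j<t. spider_edges t t t (j * (3 * t + 1))))"

definition X :: "nat \<Rightarrow> 'a graph set" where
  "X t = SiFree {tS t}"

definition false_twins :: "'a graph \<Rightarrow> 'a \<Rightarrow> 'a \<Rightarrow> bool" where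
  "false_twins G x y \<longleftrightarrow> x \<in> verts G \<and> y \<in> verts G \<and> x \<noteq> y \<and>
     \<not> adj G x y \<and> nbhd G x = nbhd G y"

definition is_clique :: "'a graph \<Rightarrow> 'a set \<Rightarrow> bool" where
  "is_clique G U \<longleftrightarrow> U \<subseteq> verts G \<and> (\<forall>u\<in>U. \<forall>v\<in>U. u \<noteq> v \<longrightarrow> adj G u v)"

definition complete_graph :: "'a graph \<Rightarrow> bool" where
  "complete_graph G \<longleftrightarrow> is_clique G (verts G)"

definition del_verts :: "'a graph \<Rightarrow> 'a set \<Rightarrow> 'a graph" where
  "del_verts G U = (verts G - U, {e \<in> edges G. e \<inter> U = {}})"

definition induced :: "'a graph \<Rightarrow> 'a set \<Rightarrow> 'a graph" where
  "induced G S = (S, {e \<in> edges G. e \<subseteq> S})"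

text \<open>every two vertices joined by a walk (the empty graph counts as connected)\<close>
definition connected_graph :: "'a graph \<Rightarrow> bool" where
  "connected_graph G \<longleftrightarrow> (\<forall>u\<in>verts G. \<forall>v\<in>verts G. (adj G)\<^sup>*\<^sup>* u v)"

definition clique_cutset :: "'a graph \<Rightarrow> 'a set \<Rightarrow> bool" where
  "clique_cutset G U \<longleftrightarrow> is_clique G U \<and> \<not> connected_graph (del_verts G U)"

definition is_cycle :: "'a graph \<Rightarrow> 'a list \<Rightarrow> bool" where
  "is_cycle G xs \<longleftrightarrow> length xs \<ge> 3 \<and> distinct xs \<and> set xs \<subseteq> verts G \<and>
     (\<forall>i < length xs. adj G (xs ! i) (xs ! ((i + 1) mod length xs)))"

definition is_tree :: "'a graph \<Rightarrow> bool" where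
  "is_tree T \<longleftrightarrow> wf_graph T \<and> verts T \<noteq> {} \<and> connected_graph T \<and> \<not> (\<exists>xs. is_cycle T xs)"

definition tree_decomposition :: "'a graph \<Rightarrow> nat graph \<Rightarrow> (nat \<Rightarrow> 'a set) \<Rightarrow> bool" where
  "tree_decomposition G T B \<longleftrightarrow> is_tree T \<and>
     (\<forall>i\<in>verts T. B i \<subseteq> verts G) \<and>
     (\<forall>v\<in>verts G. \<exists>i\<in>verts T. v \<in> B i) \<and>
     (\<forall>e\<in>edges G. \<exists>i\<in>verts T. e \<subseteq> B i) \<and>
     (\<forall>v\<in>verts G. connected_graph (induced T {i \<in> verts T. v \<in> B i}))"

definition td_width :: "nat graph \<Rightarrow> (nat \<Rightarrow> 'a set) \<Rightarrow> nat" where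
  "td_width T B = Max ((\<lambda>i. card (B i)) ` verts T) - 1"

definition treewidth :: "'a graph \<Rightarrow> nat" where
  "treewidth G = (LEAST k. \<exists>T B. tree_decomposition G T B \<and> td_width T B = k)"

end

theory Submission
  imports Defs "HOL-Library.Ramsey"
begin

text \<open>
  Writing \<open>F\<close> for \<open>tS t\<close>: if \<open>G\<close> does not produce \<open>F\<close>, then some non-adjacent pair of vertices
  of \<open>F\<close> is bad, i.e. every injective homomorphism from \<open>F\<close> to \<open>G\<close> sends it to an edge.

  A graph without a spider with legs of length \<open>m\<close> has bounded treewidth: all chords and bridges of a
  longest path are short, except between its two ends. Hence, if the treewidth of \<open>G\<close> is
  large, spiders with long legs survive the deletion of any bounded vertex set. In particular badness
  can be tested on one or two spiders only, and each edge that it forces yields new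
  spiders, to which it applies again. This produces a large complete bipartite subgraph, and by
  Ramsey's theorem a large clique, or a large independent set completely joined to another large set.

  In either structure the bad pair can be embedded as a non-edge. The only obstruction is parity in
  the bipartite case and adjacency in the clique case. It is overcome by a vertex \<open>w\<close> outside that
  distinguishes two vertices inside (absence of false twins, or maximality of the clique), together
  with a path that leaves \<open>w\<close> and returns elsewhere (absence of cut vertices). Only a pair of two
  centres, inside a clique, needs three disjoint paths from \<open>w\<close> to the clique (absence of clique
  cutsets of size two).
\<close>

section \<open>Tree decompositions as lists of bags\<close>

text \<open>Copies of \<open>G\<close> are intersected, so each copy has to spoil only one non-edge
  of \<open>tS t\<close>; failure therefore yields a single pair that is an edge under every
  embedding. Badness is thus a universal statement about spiders with legs of any length at least
  \<open>t\<close>, and this makes it self-reinforcing: a forced edge reroutes a leg or moves the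
  centre, the result is again a spider, and a new edge is forced. On one spider the positions
  reached in this way run through arithmetic progressions; two positions that move independently
  give a biclique. Conversely one embedding with a non-edge refutes badness. With edges between the
  two sides only, levels alternate between the sides, so levels of different parity land on an edge;
  inside a clique every pair does. Hence an embedding has to step outside, through a vertex with
  both a neighbour and a non-neighbour inside. Ramsey is applied to one side of the biclique only,
  the other side stays arbitrary. The number \<open>6 * t + 6\<close> leaves room for two spiders,
  the most that a pair can meet.\<close>

text \<open>The running intersection property: every bag meets the union of the earlier bags inside one of
  them, which serves as its parent in a tree.\<close>

definition rip :: "'a set list \<Rightarrow> bool" where
  "rip Bs \<longleftrightarrow> Bs \<noteq> [] \<and>
     (\<forall>i. 0 < i \<and> i < length Bs \<longrightarrow> (\<exists>j<i. \<forall>l<i. Bs ! i \<inter> Bs ! l \<subseteq> Bs ! j))"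

lemma rip_single: "rip [B]"
  by (auto simp: rip_def)

text \<open>The first bag of \<open>Bs\<close> gets \<open>As ! j0\<close> as parent, later bags
  keep theirs. What a later bag shares with \<open>As\<close> lies in \<open>S\<close>, hence in
  \<open>Bs ! 0\<close>, and the property of \<open>Bs\<close> against index 0 moves it into the
  parent.\<close>

lemma rip_append:
  assumes As: "rip As" and Bs: "rip Bs"
    and j0: "j0 < length As" "S \<subseteq> As ! j0" and hd: "S \<subseteq> Bs ! 0"
    and int: "\<Union>(set As) \<inter> \<Union>(set Bs) \<subseteq> S"
  shows "rip (As @ Bs)"
  unfolding rip_def
proof (intro conjI allI impI)
  show "As @ Bs \<noteq> []" using As by (simp add: rip_def)
next
  fix i assume i: "0 < i \<and> i < length (As @ Bs)"
  have ne: "0 < length As" "0 < length Bs" using As Bs by (auto simp: rip_def)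
  have old: "As ! l \<inter> Bs ! m \<subseteq> S" if "l < length As" "m < length Bs" for l m
    using int that nth_mem[of l As] nth_mem[of m Bs] by blast
  consider "i < length As" | "i = length As" | "i > length As" by linarith
  then show "\<exists>j<i. \<forall>l<i. (As @ Bs) ! i \<inter> (As @ Bs) ! l \<subseteq> (As @ Bs) ! j"
  proof cases
    case 1
    then obtain j where "j < i" "\<forall>l<i. As ! i \<inter> As ! l \<subseteq> As ! j"
      using As i by (auto simp: rip_def)
    then show ?thesis using 1 by (auto simp: nth_append intro!: exI[of _ j])
  next
    case 2
    have "Bs ! 0 \<inter> As ! l \<subseteq> As ! j0" if "l < length As" for l
      using old[OF that ne(2)] j0 by blast
    then show ?thesis using 2 j0(1)
      by (auto simp: nth_append intro!: exI[of _ j0])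
  next
    case 3
    define m where "m = i - length As"
    have m: "0 < m" "m < length Bs" using 3 i by (auto simp: m_def)
    then obtain j where j: "j < m" "\<forall>l<m. Bs ! m \<inter> Bs ! l \<subseteq> Bs ! j"
      using Bs by (auto simp: rip_def)
    have 0: "Bs ! m \<inter> S \<subseteq> Bs ! j" using j m(1) hd by blast
    have "(As @ Bs) ! i \<inter> (As @ Bs) ! l \<subseteq> Bs ! j" if "l < i" for l
    proof (cases "l < length As")
      case True
      then show ?thesis using old[OF True m(2)] 0 3 by (auto simp: nth_append m_def)
    next
      case False
      then have "l - length As < m" using that 3 by (auto simp: m_def)
      then show ?thesis using j(2) False 3 by (auto simp: nth_append m_def)
    qed
    moreover have "(As @ Bs) ! (length As + j) = Bs ! j" "length As + j < i"
      using j(1) 3 by (simp_all add: m_def nth_append)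
    ultimately show ?thesis by (metis (no_types, lifting))
  qed
qed

lemma rip_map_Un:
  assumes "rip Bs"
  shows "rip (map (\<lambda>B. B \<union> Z) Bs)"
  unfolding rip_def
proof (intro conjI allI impI)
  show "map (\<lambda>B. B \<union> Z) Bs \<noteq> []" using assms by (simp add: rip_def)
next
  fix i assume i: "0 < i \<and> i < length (map (\<lambda>B. B \<union> Z) Bs)"
  then obtain j where j: "j < i" "\<forall>l<i. Bs ! i \<inter> Bs ! l \<subseteq> Bs ! j"
    using assms by (auto simp: rip_def)
  then have "\<forall>l<i. map (\<lambda>B. B \<union> Z) Bs ! i \<inter> map (\<lambda>B. B \<union> Z) Bs ! l \<subseteq> map (\<lambda>B. B \<union> Z) Bs ! j"
    using i by auto
  then show "\<exists>j<i. \<forall>l<i. map (\<lambda>B. B \<union> Z) Bs ! i \<inter> map (\<lambda>B. B \<union> Z) Bs ! l \<subseteq> map (\<lambda>B. B \<union> Z) Bs ! j"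
    using j(1) by blast
qed

text \<open>The parents chosen by \<open>rip\<close> give the edges of the tree. They have smaller
  indices, which yields connectedness by descent and acyclicity by looking at a largest
  index.\<close>

lemma treewidth_le_rip:
  fixes G :: "'a graph"
  assumes wf: "wf_graph G" and rip: "rip Bs" and V: "\<Union>(set Bs) = verts G"
    and edges: "\<And>e. e \<in> edges G \<Longrightarrow> \<exists>B\<in>set Bs. e \<subseteq> B"
    and card: "\<And>B. B \<in> set Bs \<Longrightarrow> card B \<le> Suc k"
  shows "treewidth G \<le> k"
proof -
  define n where "n = length Bs"
  have n: "0 < n" using rip by (simp add: rip_def n_def)
  have "\<forall>i. \<exists>j. 0 < i \<and> i < n \<longrightarrow> j < i \<and> (\<forall>l<i. Bs ! i \<inter> Bs ! l \<subseteq> Bs ! j)"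
    using rip by (auto simp: rip_def n_def)
  then obtain p where p: "\<And>i. 0 < i \<Longrightarrow> i < n \<Longrightarrow> p i < i"
      and pB: "\<And>i l. \<lbrakk>0 < i; i < n; l < i\<rbrakk> \<Longrightarrow> Bs ! i \<inter> Bs ! l \<subseteq> Bs ! p i"
    by metis
  define T :: "nat graph" where "T = ({..<n}, {{i, p i} | i. 0 < i \<and> i < n})"
  have vT: "verts T = {..<n}" by (simp add: T_def verts_def)
  have eT: "edges T = {{i, p i} | i. 0 < i \<and> i < n}" by (simp add: T_def edges_def)
  have adjT: "adj T i j \<longleftrightarrow> (0 < i \<and> i < n \<and> j = p i) \<or> (0 < j \<and> j < n \<and> i = p j)" for i j
    unfolding adj_def eT by (auto simp: doubleton_eq_iff)
  \<comment> \<open>A set of indices closed under parents except at one root \<open>i0\<close> is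
    connected. This serves for the whole tree, with root 0, and for the bags containing a fixed
    vertex.\<close>
  have conn: "connected_graph (induced T I)"
    if I: "I \<subseteq> {..<n}" "i0 \<in> I" and par: "\<And>i. i \<in> I \<Longrightarrow> i \<noteq> i0 \<Longrightarrow> 0 < i \<and> p i \<in> I" for I i0
  proof -
    let ?R = "adj (induced T I)"
    have R: "?R i j \<longleftrightarrow> adj T i j \<and> i \<in> I \<and> j \<in> I" for i j
      by (auto simp: adj_def induced_def edges_def)
    have "symp ?R" by (auto simp: symp_def R adjT)
    then have sym: "symp (?R\<^sup>*\<^sup>*)" by (rule symp_rtranclp)
    have "?R\<^sup>*\<^sup>* i i0" if "i \<in> I" for i
      using that
    proof (induction i rule: less_induct)
      case (less i)
      show ?case
      proof (cases "i = i0")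
        case False
        then have "0 < i" "p i \<in> I" "i < n" using par less.prems I by auto
        then have "?R i (p i)" using less.prems by (auto simp: R adjT)
        then show ?thesis using less.IH[OF p \<open>p i \<in> I\<close>] \<open>0 < i\<close> \<open>i < n\<close>
          by (meson converse_rtranclp_into_rtranclp)
      qed simp
    qed
    moreover have "?R\<^sup>*\<^sup>* i0 i" if "i \<in> I" for i
      using calculation[OF that] sym by (meson sympD)
    ultimately have "?R\<^sup>*\<^sup>* i j" if "i \<in> I" "j \<in> I" for i j
      using that by (meson rtranclp_trans)
    moreover have "verts (induced T I) = I" by (simp add: induced_def verts_def)
    ultimately show ?thesis unfolding connected_graph_def by blast
  qed
  have Tind: "induced T {..<n} = T"
  proof -
    have "e \<subseteq> {..<n}" if e: "e \<in> edges T" for e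
    proof -
      from e obtain i where "e = {i, p i}" "0 < i" "i < n" by (auto simp: eT)
      then show ?thesis using p[of i] by auto
    qed
    then have "{e \<in> edges T. e \<subseteq> {..<n}} = edges T" by blast
    then show ?thesis by (simp add: induced_def T_def edges_def)
  qed
  have tree: "is_tree T" unfolding is_tree_def
  proof (intro conjI)
    have "\<exists>u v. e = {u, v} \<and> u \<noteq> v \<and> u < n \<and> v < n" if "e \<in> edges T" for e
    proof -
      from that obtain i where "e = {i, p i}" "0 < i" "i < n" by (auto simp: eT)
      then show ?thesis using p[of i] by (intro exI[of _ i] exI[of _ "p i"]) auto
    qed
    then show "wf_graph T" by (auto simp: wf_graph_def vT)
    show "verts T \<noteq> {}" using n by (auto simp: vT)
    have "connected_graph (induced T {..<n})"
    proof (rule conn)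
      show "(0::nat) \<in> {..<n}" using n by simp
      show "0 < i \<and> p i \<in> {..<n}" if "i \<in> {..<n}" "i \<noteq> 0" for i
        using that p[of i] by auto
    qed simp
    then show "connected_graph T" by (simp only: Tind)
    show "\<not> (\<exists>xs. is_cycle T xs)"
    proof
      assume "\<exists>xs. is_cycle T xs"
      then obtain xs where xs: "length xs \<ge> 3" "distinct xs" "set xs \<subseteq> {..<n}"
         and cyc: "\<And>i. i < length xs \<Longrightarrow> adj T (xs ! i) (xs ! ((i + 1) mod length xs))"
        by (auto simp: is_cycle_def vT)
      let ?L = "length xs"
      have L: "0 < ?L" using xs(1) by linarith
      \<comment> \<open>Both cyclic neighbours of the largest index on a cycle are smaller, so each
        would be its parent; but they are distinct, as a cycle has at least three vertices.\<close>
      have "Max (set xs) \<in> set xs" using xs(1) by (intro Max_in) auto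
      then obtain i where i: "i < ?L" "xs ! i = Max (set xs)" by (metis in_set_conv_nth)
      define s where "s = (i + 1) mod ?L"
      define r where "r = (if i = 0 then ?L - 1 else i - 1)"
      have sr: "s < ?L" "r < ?L" "(r + 1) mod ?L = i"
        using L i(1) by (auto simp: s_def r_def)
      have s: "s = (if i + 1 = ?L then 0 else i + 1)" using i(1) by (auto simp: s_def)
      have ne: "s \<noteq> i" "r \<noteq> i" "s \<noteq> r" using xs(1) i(1) by (auto simp: s r_def)
      have lt: "xs ! m < xs ! i" if "m < ?L" "m \<noteq> i" for m
        using that i xs(2) Max_ge[of "set xs" "xs ! m"] nth_mem[of m xs]
        by (metis List.finite_set le_neq_implies_less nth_eq_iff_index_eq)
      have "p (xs ! i) = xs ! s"
        using cyc[OF i(1)] lt[OF sr(1) ne(1)] p[of "xs ! s"] by (auto simp: adjT s_def)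
      moreover have "p (xs ! i) = xs ! r"
        using cyc[OF sr(2)] lt[OF sr(2) ne(2)] p[of "xs ! r"] unfolding sr(3) adjT by auto
      ultimately show False using xs(2) sr ne(3) by (metis nth_eq_iff_index_eq)
    qed
  qed
  have vB: "\<exists>i\<in>verts T. v \<in> Bs ! i" if "v \<in> verts G" for v
  proof -
    from that V obtain B where "B \<in> set Bs" "v \<in> B" by blast
    then show ?thesis by (auto simp: vT n_def in_set_conv_nth)
  qed
  have Bconn: "connected_graph (induced T {i \<in> verts T. v \<in> Bs ! i})" if v: "v \<in> verts G" for v
  proof -
    define I where "I = {i \<in> verts T. v \<in> Bs ! i}"
    have "I \<noteq> {}" using vB[OF v] by (auto simp: I_def)
    then obtain k where "k \<in> I" by blast
    \<comment> \<open>The least bag containing \<open>v\<close> is the root: a later bag shares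
      \<open>v\<close> with it, so by \<open>rip\<close> the parent contains \<open>v\<close>
      too.\<close>
    then obtain i0 where i0: "i0 \<in> I" "\<And>i. i \<in> I \<Longrightarrow> i0 \<le> i"
      using ex_has_least_nat[of "\<lambda>i. i \<in> I" k "\<lambda>i. i"] by blast
    have "0 < i \<and> p i \<in> I" if "i \<in> I" "i \<noteq> i0" for i
    proof -
      have lt: "i0 < i" using i0(2)[OF that(1)] that(2) by linarith
      have i: "i < n" "v \<in> Bs ! i" using that by (auto simp: I_def vT)
      moreover have "v \<in> Bs ! i0" using i0 by (simp add: I_def)
      ultimately have "v \<in> Bs ! p i" using pB[of i i0] lt by blast
      moreover have "p i < n" using p[of i] lt i by linarith
      ultimately show ?thesis using lt by (simp add: I_def vT)
    qed
    moreover have "I \<subseteq> {..<n}" by (auto simp: I_def vT)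
    ultimately show ?thesis using conn[of I i0] i0(1) unfolding I_def by blast
  qed
  have has_td: "tree_decomposition G T (\<lambda>i. Bs ! i)"
    unfolding tree_decomposition_def
  proof (intro conjI ballI)
    show "is_tree T" by (rule tree)
    show "Bs ! i \<subseteq> verts G" if "i \<in> verts T" for i
      using that V nth_mem[of i Bs] by (auto simp: vT n_def)
    show "\<exists>i\<in>verts T. v \<in> Bs ! i" if "v \<in> verts G" for v
      using that by (rule vB)
    show "\<exists>i\<in>verts T. e \<subseteq> Bs ! i" if e: "e \<in> edges G" for e
    proof -
      obtain B where "B \<in> set Bs" "e \<subseteq> B" using edges[OF e] by blast
      then show ?thesis unfolding vT n_def by (metis in_set_conv_nth lessThan_iff)
    qed
  qed (rule Bconn)
  have "treewidth G \<le> td_width T (\<lambda>i. Bs ! i)"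
    unfolding treewidth_def using has_td by (intro Least_le) blast
  also have "\<dots> \<le> k"
  proof -
    have "Max ((\<lambda>i. card (Bs ! i)) ` verts T) \<le> Suc k"
      using n card by (intro Max.boundedI) (auto simp: vT n_def)
    then show ?thesis by (simp add: td_width_def)
  qed
  finally show ?thesis .
qed

section \<open>Counting\<close>

lemma inj_on_nth_lin:
  assumes "distinct l" "1 \<le> d" "\<And>x. x < n \<Longrightarrow> e + x * d < length l"
  shows "inj_on (\<lambda>x. l ! (e + x * d)) {..<n}"
proof (rule inj_onI)
  fix x y assume "x \<in> {..<n}" "y \<in> {..<n}" "l ! (e + x * d) = l ! (e + y * d)"
  then have "e + x * d = e + y * d" using assms by (simp add: nth_eq_iff_index_eq)
  then show "x = y" using assms(2) by simp
qed

lemma pigeonhole_fibre: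
  assumes "finite P" "f ` P \<subseteq> Q" "finite Q" "n * card Q < card P"
  shows "\<exists>y\<in>Q. n < card {x \<in> P. f x = y}"
proof (rule ccontr)
  assume "\<not> ?thesis"
  then have le: "card {x \<in> P. f x = y} \<le> n" if "y \<in> Q" for y using that by force
  have "P = (\<Union>y\<in>Q. {x \<in> P. f x = y})" using assms(2) by auto
  then have "card P \<le> (\<Sum>y\<in>Q. card {x \<in> P. f x = y})"
    using card_UN_le[OF assms(3), of "\<lambda>y. {x \<in> P. f x = y}"] by simp
  also have "\<dots> \<le> n * card Q" using sum_bounded_above[of Q "\<lambda>y. card {x \<in> P. f x = y}" n] le by (simp add: mult.commute)
  finally show False using assms(4) by simp
qed

lemma leg_cases: "i < (3::nat) \<Longrightarrow> i = 0 \<or> i = 1 \<or> i = 2"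
  by linarith

section \<open>Paths, components and bag decompositions\<close>

locale ugraph =
  fixes V :: "'a set" and E :: "'a \<Rightarrow> 'a \<Rightarrow> bool"
  assumes finV: "finite V"
    and E_sym: "E x y \<Longrightarrow> E y x"
    and E_irrefl: "\<not> E x x"
    and E_V: "E x y \<Longrightarrow> x \<in> V"
begin

definition is_path :: "'a list \<Rightarrow> bool" where
  "is_path xs \<longleftrightarrow> distinct xs \<and> successively E xs"

definition reach :: "'a set \<Rightarrow> 'a \<Rightarrow> 'a \<Rightarrow> bool" where
  "reach W = (\<lambda>x y. E x y \<and> x \<in> W \<and> y \<in> W)\<^sup>*\<^sup>*"

definition component :: "'a set \<Rightarrow> 'a \<Rightarrow> 'a set" where
  "component W x = {y \<in> W. reach W x y}"

definition covers :: "'a set list \<Rightarrow> 'a set \<Rightarrow> bool" where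
  "covers Bs W \<longleftrightarrow> rip Bs \<and> \<Union>(set Bs) = W \<and>
     (\<forall>x\<in>W. \<forall>y\<in>W. E x y \<longrightarrow> (\<exists>B\<in>set Bs. x \<in> B \<and> y \<in> B))"

text \<open>Bag sizes instead of widths, so that bounds simply add when decompositions are
  combined.\<close>

definition has_td :: "'a set \<Rightarrow> nat \<Rightarrow> bool" where
  "has_td W k \<longleftrightarrow> (\<exists>Bs. covers Bs W \<and> (\<forall>B\<in>set Bs. card B \<le> k))"

lemma is_path_rev: "is_path (rev xs) \<longleftrightarrow> is_path xs"
proof -
  have "(\<lambda>x y. E y x) = E" using E_sym by blast
  then have "successively (\<lambda>x y. E y x) xs = successively E xs" by (simp only:)
  then show ?thesis by (simp add: is_path_def)
qed

lemma is_path_appendD: "is_path (xs @ ys) \<Longrightarrow> is_path xs \<and> is_path ys"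
  by (auto simp: is_path_def successively_append_iff)

lemma is_path_append_iff:
  "is_path (xs @ ys) \<longleftrightarrow> is_path xs \<and> is_path ys \<and> set xs \<inter> set ys = {} \<and>
     (xs = [] \<or> ys = [] \<or> E (last xs) (hd ys))"
  by (auto simp: is_path_def successively_append_iff)

lemma is_path_Cons:
  "is_path (x # ys) \<longleftrightarrow> is_path ys \<and> x \<notin> set ys \<and> (ys = [] \<or> E x (hd ys))"
  by (auto simp: is_path_def successively_Cons)

lemma is_path_take: "is_path xs \<Longrightarrow> is_path (take n xs)"
  by (metis append_take_drop_id is_path_appendD)

lemma is_path_drop: "is_path xs \<Longrightarrow> is_path (drop n xs)"
  by (metis append_take_drop_id is_path_appendD)

lemma is_path_nth: "is_path xs \<Longrightarrow> Suc i < length xs \<Longrightarrow> E (xs ! i) (xs ! Suc i)"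
  by (simp add: is_path_def successively_conv_nth)

lemma reach_refl: "reach W x x"
  by (simp add: reach_def)

lemma reach_step: "reach W x y \<Longrightarrow> E y z \<Longrightarrow> y \<in> W \<Longrightarrow> z \<in> W \<Longrightarrow> reach W x z"
  unfolding reach_def by (rule rtranclp.rtrancl_into_rtrancl) auto

lemma reach_trans: "reach W x y \<Longrightarrow> reach W y z \<Longrightarrow> reach W x z"
  unfolding reach_def by (rule rtranclp_trans)

lemma reach_sym: "reach W x y \<Longrightarrow> reach W y x"
proof -
  have "symp (\<lambda>x y. E x y \<and> x \<in> W \<and> y \<in> W)" using E_sym by (auto simp: symp_def)
  then have "symp (reach W)" unfolding reach_def by (rule symp_rtranclp)
  then show "reach W x y \<Longrightarrow> reach W y x" by (rule sympD)
qed

lemma comp_sub: "component W x \<subseteq> W"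
  by (auto simp: component_def)

lemma comp_self: "x \<in> W \<Longrightarrow> x \<in> component W x"
  by (auto simp: component_def reach_refl)

lemma comp_eq: "y \<in> component W x \<Longrightarrow> component W y = component W x"
  unfolding component_def using reach_trans reach_sym by blast

lemma comp_adj: "y \<in> component W x \<Longrightarrow> E y z \<Longrightarrow> z \<in> W \<Longrightarrow> z \<in> component W x"
  unfolding component_def using reach_step by blast

lemma reach_comp: "x \<in> W \<Longrightarrow> y \<in> component W x \<Longrightarrow> reach (component W x) x y"
proof -
  assume x: "x \<in> W" and "y \<in> component W x"
  then have "reach W x y" by (simp add: component_def)
  then show ?thesis unfolding reach_def
  proof (induction rule: rtranclp_induct)
    case (step y z)
    then have "reach W x y" "reach W x z" unfolding reach_def
      by (auto intro: rtranclp.rtrancl_into_rtrancl)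
    then have "E y z \<and> y \<in> component W x \<and> z \<in> component W x"
      using step.hyps by (auto simp: component_def)
    then show ?case using step.IH by (rule rtranclp.rtrancl_into_rtrancl[rotated])
  qed simp
qed

lemma reach_path:
  assumes "reach W x y" "x \<in> W"
  shows "\<exists>xs. is_path xs \<and> xs \<noteq> [] \<and> hd xs = x \<and> last xs = y \<and> set xs \<subseteq> W"
  using assms(1) unfolding reach_def
proof (induction rule: rtranclp_induct)
  case base
  show ?case using assms(2) by (intro exI[of _ "[x]"]) (simp add: is_path_def)
next
  case (step y z)
  then obtain xs where xs: "is_path xs" "xs \<noteq> []" "hd xs = x" "last xs = y" "set xs \<subseteq> W"
    by blast
  show ?case
  proof (cases "z \<in> set xs")
    case True
    then obtain us vs where "xs = us @ z # vs" by (meson split_list)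
    then show ?thesis using xs is_path_appendD[of "us @ [z]" vs]
      by (intro exI[of _ "us @ [z]"]) (auto simp: hd_append)
  next
    case False
    then show ?thesis using xs step.hyps
      by (intro exI[of _ "xs @ [z]"]) (auto simp: is_path_def successively_append_iff)
  qed
qed

lemma path_to_set:
  assumes "reach W x y" "x \<in> W" "y \<in> S"
  shows "\<exists>xs s. is_path (xs @ [s]) \<and> hd (xs @ [s]) = x \<and> set (xs @ [s]) \<subseteq> W \<and> s \<in> S \<and> set xs \<inter> S = {}"
proof -
  obtain xs where xs: "is_path xs" "xs \<noteq> []" "hd xs = x" "last xs = y" "set xs \<subseteq> W"
    using reach_path[OF assms(1,2)] by blast
  then have "\<exists>s\<in>set xs. s \<in> S" using assms(3) last_in_set by blast
  then obtain us s vs where "xs = us @ s # vs" "s \<in> S" "\<forall>u\<in>set us. u \<notin> S"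
    using split_list_first_prop[of xs "\<lambda>u. u \<in> S"] by blast
  then show ?thesis using xs is_path_appendD[of "us @ [s]" vs]
    by (intro exI[of _ us] exI[of _ s]) (auto simp: hd_append)
qed

lemma path_set_to_set:
  assumes "reach W x y" "x \<in> W" "x \<in> S" "y \<in> T" "S \<inter> T = {}"
  shows "\<exists>s rs t. is_path (s # rs @ [t]) \<and> set (s # rs @ [t]) \<subseteq> W \<and> s \<in> S \<and> t \<in> T \<and>
           set rs \<inter> (S \<union> T) = {}"
proof -
  obtain xs t where xs: "is_path (xs @ [t])" "hd (xs @ [t]) = x" "set (xs @ [t]) \<subseteq> W" "t \<in> T" "set xs \<inter> T = {}"
    using path_to_set[OF assms(1,2,4)] by blast
  have "xs \<noteq> []" using xs assms(3,5) by auto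
  then have "x \<in> set xs" using xs(2) by (auto simp: hd_append)
  then have "\<exists>u\<in>set xs. u \<in> S" using assms(3) by blast
  then obtain us s vs where *: "xs = us @ s # vs" "s \<in> S" "\<forall>u\<in>set vs. u \<notin> S"
    using split_list_last_prop[of xs "\<lambda>u. u \<in> S"] by blast
  have "is_path (s # vs @ [t])" using xs(1) * is_path_appendD[of us "s # vs @ [t]"] by simp
  then show ?thesis using xs *
    by (intro exI[of _ s] exI[of _ vs] exI[of _ t]) auto
qed

text \<open>Isolates the step out of \<open>r\<close> after its last visit. It supplies a neighbour
  of \<open>r\<close> as the new root of each component that remains when \<open>r\<close> is
  deleted.\<close>

lemma reach_remove:
  assumes "reach W r x" "r \<in> W"
  shows "x = r \<or> (\<exists>r'\<in>W - {r}. E r r' \<and> reach (W - {r}) r' x)"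
  using assms(1) unfolding reach_def
proof (induction rule: rtranclp_induct)
  case (step y z)
  have IH: "y = r \<or> (\<exists>r'\<in>W - {r}. E r r' \<and> reach (W - {r}) r' y)"
    using step.IH unfolding reach_def .
  have "\<exists>r'\<in>W - {r}. E r r' \<and> reach (W - {r}) r' z" if "z \<noteq> r"
  proof (cases "y = r")
    case True
    then show ?thesis using step.hyps that reach_refl by (intro bexI[of _ z]) auto
  next
    case False
    then obtain r' where "r' \<in> W - {r}" "E r r'" "reach (W - {r}) r' y" using IH by blast
    moreover have "reach (W - {r}) r' z"
      using calculation(3) by (rule reach_step) (use step.hyps that False in auto)
    ultimately show ?thesis by blast
  qed
  then show ?case unfolding reach_def by blast
qed simp

section \<open>Gluing bag decompositions\<close>

text \<open>Each \<open>D\<close> is attached to \<open>W0\<close> only inside one bag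
  \<open>B\<close>, so \<open>B\<close> can be added to every bag of a decomposition of
  \<open>D\<close> and the result hung below \<open>B\<close>. Adding \<open>B\<close> everywhere
  covers all edges between \<open>D\<close> and \<open>W0\<close> at once.\<close>

lemma covers_hang:
  assumes Bs: "covers Bs W0" "\<And>B. B \<in> set Bs \<Longrightarrow> card B \<le> k0"
    and fin: "finite DD"
    and D: "\<And>D. D \<in> DD \<Longrightarrow> has_td D k \<and> D \<inter> W0 = {} \<and>
              (\<exists>B\<in>set Bs. \<forall>x\<in>D. \<forall>y\<in>W0. E x y \<longrightarrow> y \<in> B)"
    and sep: "\<And>D D' x y. \<lbrakk>D \<in> DD; D' \<in> DD; D \<noteq> D'; x \<in> D; y \<in> D'\<rbrakk> \<Longrightarrow> x \<noteq> y \<and> \<not> E x y"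
  shows "has_td (W0 \<union> \<Union>DD) (k0 + k)"
proof -
  \<comment> \<open>The original bags stay in the list (\<open>set Bs \<subseteq> set Cs\<close>),
    so each further piece still finds its attachment bag, and the bound does not grow with the
    number of pieces.\<close>
  have "\<exists>Cs. covers Cs (W0 \<union> \<Union>DD) \<and> set Bs \<subseteq> set Cs \<and> (\<forall>B\<in>set Cs. card B \<le> k0 + k)"
    using fin D sep
  proof (induction DD rule: finite_induct)
    case empty
    then show ?case using Bs by (intro exI[of _ Bs]) (auto intro: trans_le_add1)
  next
    case (insert D DD)
    obtain Cs where Cs: "covers Cs (W0 \<union> \<Union>DD)" "set Bs \<subseteq> set Cs" "\<forall>B\<in>set Cs. card B \<le> k0 + k"
    proof -
      have "\<exists>Cs. covers Cs (W0 \<union> \<Union>DD) \<and> set Bs \<subseteq> set Cs \<and> (\<forall>B\<in>set Cs. card B \<le> k0 + k)"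
      proof (rule insert.IH)
        show "has_td D k \<and> D \<inter> W0 = {} \<and> (\<exists>B\<in>set Bs. \<forall>x\<in>D. \<forall>y\<in>W0. E x y \<longrightarrow> y \<in> B)" if "D \<in> DD" for D
          using insert.prems(1)[of D] that by blast
        show "x \<noteq> y \<and> \<not> E x y" if "D \<in> DD" "D' \<in> DD" "D \<noteq> D'" "x \<in> D" "y \<in> D'" for D D' x y
          using insert.prems(2)[of D D' x y] that by blast
      qed
      then show ?thesis using that by blast
    qed
    have D: "has_td D k" "D \<inter> W0 = {}" using insert.prems(1) by blast+
    obtain B where B: "B \<in> set Bs" "\<forall>x\<in>D. \<forall>y\<in>W0. E x y \<longrightarrow> y \<in> B"
      using insert.prems(1) by blast
    obtain Ds where Ds: "covers Ds D" "\<forall>A\<in>set Ds. card A \<le> k" using D(1) by (auto simp: has_td_def)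
    have sepD: "x \<noteq> y \<and> \<not> E x y" if "x \<in> D" "y \<in> \<Union>DD" for x y
      using that insert.prems(2)[of D] insert.hyps(2) by blast
    have BW: "B \<subseteq> W0" using B(1) Bs(1) by (auto simp: covers_def)
    define Ns where "Ns = map (\<lambda>A. A \<union> B) Ds"
    have ne: "Ds \<noteq> []" using Ds(1) by (simp add: covers_def rip_def)
    have UN: "\<Union>(set Ns) = D \<union> B" using Ds(1) ne by (auto simp: Ns_def covers_def)
    obtain j where j: "j < length Cs" "Cs ! j = B" using B(1) Cs(2) by (metis in_set_conv_nth subsetD)
    have "rip (Cs @ Ns)"
    proof (rule rip_append)
      show "rip Cs" using Cs(1) by (simp add: covers_def)
      show "rip Ns" unfolding Ns_def using Ds(1) by (intro rip_map_Un) (simp add: covers_def)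
      show "j < length Cs" "B \<subseteq> Cs ! j" using j by auto
      show "B \<subseteq> Ns ! 0" using ne by (simp add: Ns_def)
      show "\<Union>(set Cs) \<inter> \<Union>(set Ns) \<subseteq> B"
        using Cs(1) sepD D(2) unfolding UN covers_def by blast
    qed
    moreover have "\<Union>(set (Cs @ Ns)) = W0 \<union> \<Union>(insert D DD)"
    proof -
      have "\<Union>(set (Cs @ Ns)) = (W0 \<union> \<Union>DD) \<union> (D \<union> B)"
        using UN Cs(1) by (simp add: covers_def)
      then show ?thesis using BW by blast
    qed
    moreover have "\<exists>C\<in>set (Cs @ Ns). x \<in> C \<and> y \<in> C"
      if xy: "x \<in> W0 \<union> \<Union>(insert D DD)" "y \<in> W0 \<union> \<Union>(insert D DD)" "E x y" for x y
    proof -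
      have inD: "\<exists>C\<in>set Ns. u \<in> C \<and> v \<in> C" if uv: "u \<in> D" "v \<in> W0 \<union> \<Union>(insert D DD)" "E u v" for u v
      proof (cases "v \<in> D")
        case True
        then show ?thesis using uv Ds(1) by (auto simp: covers_def Ns_def)
      next
        case False
        then have "v \<in> W0" using uv sepD by blast
        then have "v \<in> B" using B uv by blast
        moreover obtain A where "A \<in> set Ds" "u \<in> A" using uv(1) Ds(1) by (auto simp: covers_def)
        ultimately show ?thesis by (auto simp: Ns_def)
      qed
      show ?thesis
      proof (cases "x \<in> D \<or> y \<in> D")
        case True
        then show ?thesis using inD[of x y] inD[of y x] xy E_sym by auto
      next
        case False
        then have "x \<in> W0 \<union> \<Union>DD" "y \<in> W0 \<union> \<Union>DD" using xy by auto
        then have "\<exists>C\<in>set Cs. x \<in> C \<and> y \<in> C" using Cs(1) xy(3) by (simp add: covers_def)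
        then show ?thesis by auto
      qed
    qed
    ultimately have "covers (Cs @ Ns) (W0 \<union> \<Union>(insert D DD))" unfolding covers_def by blast
    moreover have "card C \<le> k0 + k" if "C \<in> set (Cs @ Ns)" for C
    proof (cases "C \<in> set Cs")
      case False
      with that have "C \<in> set Ns" by simp
      then obtain A where A: "A \<in> set Ds" "C = A \<union> B" by (auto simp: Ns_def)
      have "card C \<le> card A + card B" unfolding A(2) by (rule card_Un_le)
      then show ?thesis using A(1) Ds(2) Bs(2)[OF B(1)] by force
    qed (use Cs(3) in auto)
    ultimately show ?case using Cs(2) by (intro exI[of _ "Cs @ Ns"]) auto
  qed
  then show ?thesis unfolding has_td_def by blast
qed

lemma covers_hang_comps:
  assumes Bs: "covers Bs W0" "\<And>B. B \<in> set Bs \<Longrightarrow> card B \<le> k0"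
    and W: "W0 \<subseteq> W" "finite W"
    and D: "\<And>x. x \<in> W - W0 \<Longrightarrow> has_td (component (W - W0) x) k"
    and att: "\<And>x. x \<in> W - W0 \<Longrightarrow> \<exists>B\<in>set Bs. \<forall>u\<in>component (W - W0) x. \<forall>y\<in>W0. E u y \<longrightarrow> y \<in> B"
  shows "has_td W (k0 + k)"
proof -
  let ?DD = "component (W - W0) ` (W - W0)"
  have "W = W0 \<union> \<Union>?DD"
  proof
    show "W \<subseteq> W0 \<union> \<Union>?DD" using comp_self[of _ "W - W0"] by blast
    show "W0 \<union> \<Union>?DD \<subseteq> W" using comp_sub[of "W - W0"] W(1) by blast
  qed
  moreover have "has_td (W0 \<union> \<Union>?DD) (k0 + k)"
  proof (rule covers_hang[OF Bs])
    show "finite ?DD" using W(2) by simp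
    show "has_td D k \<and> D \<inter> W0 = {} \<and> (\<exists>B\<in>set Bs. \<forall>x\<in>D. \<forall>y\<in>W0. E x y \<longrightarrow> y \<in> B)" if "D \<in> ?DD" for D
    proof -
      from that obtain x where x: "x \<in> W - W0" "D = component (W - W0) x" by auto
      then have "D \<inter> W0 = {}" using comp_sub by blast
      then show ?thesis using D[OF x(1)] att[OF x(1)] x(2) by simp
    qed
    show "x \<noteq> y \<and> \<not> E x y" if DD: "D \<in> ?DD" "D' \<in> ?DD" and that: "D \<noteq> D'" "x \<in> D" "y \<in> D'" for D D' x y
    proof -
      from DD obtain u v where uv: "D = component (W - W0) u" "D' = component (W - W0) v" by auto
      have xy: "x \<in> component (W - W0) u" "y \<in> component (W - W0) v" using that(2,3) uv by auto
      have x: "component (W - W0) x = D" using comp_eq[OF xy(1)] uv by simp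
      have y: "component (W - W0) y = D'" using comp_eq[OF xy(2)] uv by simp
      have W: "x \<in> W - W0" "y \<in> W - W0" using xy comp_sub by blast+
      show ?thesis
      proof
        show "x \<noteq> y" using x y that(1) by auto
        show "\<not> E x y"
        proof
          assume "E x y"
          then have "y \<in> component (W - W0) x" using comp_adj[OF comp_self] W by blast
          then show False using comp_eq x y that(1) by blast
        qed
      qed
    qed
  qed
  ultimately show ?thesis by simp
qed

lemma covers_single: "covers [B] B"
  by (auto simp: covers_def rip_single)

lemma has_td_mono: "has_td W k \<Longrightarrow> k \<le> k' \<Longrightarrow> has_td W k'"
  unfolding has_td_def by (meson le_trans)

text \<open>Elimination of the root: each component of \<open>W - {r}\<close> contains a neighbour
  \<open>r'\<close> of \<open>r\<close>, and its paths from \<open>r'\<close> can be prolonged by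
  \<open>r\<close>. So the length bound drops by one while each bag gains only
  \<open>r\<close>.\<close>

lemma td_short_paths:
  assumes "finite W" "r \<in> W" "\<And>x. x \<in> W \<Longrightarrow> reach W r x"
    and "\<And>xs. \<lbrakk>is_path xs; xs \<noteq> []; hd xs = r; set xs \<subseteq> W\<rbrakk> \<Longrightarrow> length xs \<le> m"
  shows "has_td W m"
  using assms
proof (induction m arbitrary: W r)
  case 0
  have "is_path [r]" by (simp add: is_path_def)
  then show ?case using 0(2) 0(4)[of "[r]"] by simp
next
  case (Suc m)
  have "has_td W (1 + m)"
  proof (rule covers_hang_comps[OF covers_single[of "{r}"]])
    show "card B \<le> 1" if "B \<in> set [{r}]" for B using that by simp
    show "{r} \<subseteq> W" "finite W" using Suc.prems by auto
    show "\<exists>B\<in>set [{r}]. \<forall>u\<in>component (W - {r}) x. \<forall>y\<in>{r}. E u y \<longrightarrow> y \<in> B" if "x \<in> W - {r}" for x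
      by simp
    fix x assume x: "x \<in> W - {r}"
    obtain r' where r': "r' \<in> W - {r}" "E r r'" "reach (W - {r}) r' x"
      using reach_remove[of W r x] Suc.prems(2,3) x by auto
    have "x \<in> component (W - {r}) r'" using r'(3) x by (simp add: component_def)
    then have eq: "component (W - {r}) x = component (W - {r}) r'" by (rule comp_eq)
    have "has_td (component (W - {r}) r') m"
    proof (rule Suc.IH)
      show "finite (component (W - {r}) r')" using Suc.prems(1) comp_sub by (meson finite_Diff finite_subset)
      show "r' \<in> component (W - {r}) r'" using r'(1) by (rule comp_self)
      show "reach (component (W - {r}) r') r' x" if "x \<in> component (W - {r}) r'" for x
        using r'(1) that by (rule reach_comp)
      fix xs assume xs: "is_path xs" "xs \<noteq> []" "hd xs = r'" "set xs \<subseteq> component (W - {r}) r'"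
      then have sub: "set xs \<subseteq> W - {r}" using comp_sub by blast
      then have "is_path (r # xs)" using xs r'(2) by (auto simp: is_path_Cons)
      then show "length xs \<le> m" using Suc.prems(4)[of "r # xs"] sub Suc.prems(2) by auto
    qed
    then show "has_td (component (W - {r}) x) m" by (simp only: eq)
  qed
  then show ?case by simp
qed

section \<open>Graphs without long spiders\<close>

text \<open>The lists are the legs without the centre: level \<open>k\<close> is entry
  \<open>k\<close> of \<open>c # l\<close>, and entry \<open>k - 1\<close> of \<open>l\<close> if
  \<open>k\<close> is positive. Leg lengths are left free because rerouting changes them.\<close>

definition spider :: "'a \<Rightarrow> 'a list \<Rightarrow> 'a list \<Rightarrow> 'a list \<Rightarrow> bool" where
  "spider c l0 l1 l2 \<longleftrightarrow> is_path (c # l0) \<and> is_path (c # l1) \<and> is_path (c # l2) \<and>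
     set l0 \<inter> set l1 = {} \<and> set l0 \<inter> set l2 = {} \<and> set l1 \<inter> set l2 = {}"

definition sverts :: "'a \<Rightarrow> 'a list \<Rightarrow> 'a list \<Rightarrow> 'a list \<Rightarrow> 'a set" where
  "sverts c l0 l1 l2 = insert c (set l0 \<union> set l1 \<union> set l2)"

definition spider_in :: "'a set \<Rightarrow> nat \<Rightarrow> bool" where
  "spider_in W m \<longleftrightarrow> (\<exists>c l0 l1 l2. spider c l0 l1 l2 \<and> sverts c l0 l1 l2 \<subseteq> W \<and>
     length l0 = m \<and> length l1 = m \<and> length l2 = m)"

lemma is_path_Cons_take: "is_path (c # l) \<Longrightarrow> is_path (c # take m l)"
  using is_path_take[of "c # l" "Suc m"] by simp

lemma spider_take:
  assumes "spider c l0 l1 l2"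
  shows "spider c (take i l0) (take j l1) (take k l2)"
  using assms set_take_subset[of i l0] set_take_subset[of j l1] set_take_subset[of k l2]
  unfolding spider_def by (intro conjI is_path_Cons_take) blast+

lemma sverts_take: "sverts c (take i l0) (take j l1) (take k l2) \<subseteq> sverts c l0 l1 l2"
  using set_take_subset[of i l0] set_take_subset[of j l1] set_take_subset[of k l2]
  unfolding sverts_def by blast

lemma spider_inI:
  assumes "spider c l0 l1 l2" "sverts c l0 l1 l2 \<subseteq> W" "m \<le> length l0" "m \<le> length l1" "m \<le> length l2"
  shows "spider_in W m"
  unfolding spider_in_def
  using spider_take[OF assms(1), of m m m] sverts_take[of c m l0 m l1 m l2] assms(2-)
  by (intro exI[of _ c] exI[of _ "take m l0"] exI[of _ "take m l1"] exI[of _ "take m l2"]) auto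

lemma spider_in_mono: "spider_in W m \<Longrightarrow> W \<subseteq> W' \<Longrightarrow> spider_in W' m"
  unfolding spider_in_def by blast

lemma spider_swap01: "spider c l0 l1 l2 \<Longrightarrow> spider c l1 l0 l2"
  by (auto simp: spider_def)

lemma spider_swap12: "spider c l0 l1 l2 \<Longrightarrow> spider c l0 l2 l1"
  by (auto simp: spider_def)

lemma path_reach:
  assumes "is_path xs" "set xs \<subseteq> W" "xs \<noteq> []"
  shows "reach W (hd xs) (last xs)"
  using assms
proof (induction xs rule: rev_induct)
  case (snoc x xs)
  show ?case
  proof (cases "xs = []")
    case True
    then show ?thesis by (simp add: reach_refl)
  next
    case False
    then have "reach W (hd xs) (last xs)" "E (last xs) x" "last xs \<in> W" "x \<in> W"
      using snoc by (auto simp: is_path_append_iff)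
    then show ?thesis using False reach_step by simp
  qed
qed simp

section \<open>Spiders from chords, bridges and branches of a path\<close>

text \<open>The legs at \<open>c\<close> are the path backwards, the path forwards through
  \<open>bs\<close>, and the detour over \<open>zs\<close> to \<open>d\<close> followed by the path
  from \<open>d\<close> back towards \<open>bs\<close>. Empty \<open>zs\<close> is the case of a
  chord.\<close>

lemma chord_spider_split:
  assumes ps: "is_path (as @ c # bs @ cs @ d # ds)"
    and zs: "is_path (c # zs @ [d])" "set zs \<inter> set (as @ c # bs @ cs @ d # ds) = {}"
  shows "spider c (rev as) bs (zs @ d # rev cs)"
proof -
  have a: "is_path (as @ [c])" using ps is_path_appendD[of "as @ [c]" "bs @ cs @ d # ds"] by simp
  have b: "is_path (c # bs)"
    using ps is_path_appendD[of as "c # bs @ cs @ d # ds"] is_path_appendD[of "c # bs" "cs @ d # ds"] by simp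
  have "is_path (cs @ [d])"
    using ps is_path_appendD[of "as @ c # bs" "cs @ d # ds"] is_path_appendD[of "cs @ [d]" ds] by simp
  then have d: "is_path (d # rev cs)" using is_path_rev[of "cs @ [d]"] by simp
  have dist: "distinct (as @ c # bs @ cs @ d # ds)" using ps by (simp add: is_path_def)
  have "is_path ((c # zs @ [d]) @ rev cs)"
    unfolding is_path_append_iff[of "c # zs @ [d]"] using zs d dist by (auto simp: is_path_Cons)
  moreover have "is_path (c # rev as)" using is_path_rev[of "as @ [c]"] a by simp
  ultimately show ?thesis unfolding spider_def using b dist zs(2) by auto
qed

lemma path_split_nth:
  assumes "i + 2 * m \<le> j" "j < length ps" "1 \<le> m"
  shows "\<exists>as bs cs ds. ps = as @ ps ! i # bs @ cs @ ps ! j # ds \<and> length as = i \<and>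
           length bs = m \<and> length cs = j - i - 1 - m"
proof -
  have "ps = take i ps @ ps ! i # drop (Suc i) ps" using assms by (intro id_take_nth_drop) simp
  moreover have "drop (Suc i) ps = take m (drop (Suc i) ps) @ drop (Suc i + m) ps"
    by (metis add.commute append_take_drop_id drop_drop)
  moreover have "drop (Suc i + m) ps = take (j - i - 1 - m) (drop (Suc i + m) ps) @
        drop (Suc i + m) ps ! (j - i - 1 - m) # drop (Suc (j - i - 1 - m)) (drop (Suc i + m) ps)"
    using assms by (intro id_take_nth_drop) simp
  moreover have "drop (Suc i + m) ps ! (j - i - 1 - m) = ps ! j" using assms by simp
  ultimately have "ps = take i ps @ ps ! i # take m (drop (Suc i) ps) @
      take (j - i - 1 - m) (drop (Suc i + m) ps) @ ps ! j # drop (Suc (j - i - 1 - m)) (drop (Suc i + m) ps)"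
    by metis
  moreover have "length (take i ps) = i" "length (take m (drop (Suc i) ps)) = m"
    "length (take (j - i - 1 - m) (drop (Suc i + m) ps)) = j - i - 1 - m"
    using assms by simp_all
  ultimately show ?thesis by blast
qed

text \<open>The vertices before position \<open>i\<close> supply one leg. The vertices strictly
  between, together with \<open>ps ! j\<close>, are shared by the other two, whence the distance
  \<open>2 * m\<close>.\<close>

lemma chord_spider:
  assumes ps: "is_path ps" "set ps \<subseteq> W" and ij: "m \<le> i" "i + 2 * m \<le> j" "j < length ps" "1 \<le> m"
    and zs: "is_path (ps ! i # zs @ [ps ! j])" "set zs \<inter> set ps = {}" "set zs \<subseteq> W"
  shows "spider_in W m"
proof -
  obtain as bs cs ds where d: "ps = as @ ps ! i # bs @ cs @ ps ! j # ds" "length as = i"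
      "length bs = m" "length cs = j - i - 1 - m"
    using path_split_nth[OF ij(2-4)] by blast
  define c d where "c = ps ! i" and "d = ps ! j"
  have e: "ps = as @ c # bs @ cs @ d # ds" using d(1) by (simp add: c_def d_def)
  have "spider c (rev as) bs (zs @ d # rev cs)"
    using ps(1) zs unfolding e[symmetric] c_def[symmetric] d_def[symmetric]
    by (intro chord_spider_split[where ds = ds]) (simp_all add: e[symmetric])
  moreover have "sverts c (rev as) bs (zs @ d # rev cs) \<subseteq> W"
  proof -
    have "set ps = set (as @ c # bs @ cs @ d # ds)" using e by simp
    then show ?thesis using ps(2) zs(3) by (auto simp: sverts_def)
  qed
  ultimately show ?thesis
    by (rule spider_inI) (use d(2-) ij in auto)
qed

text \<open>On the reversed path the required \<open>m\<close> spare vertices move from before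
  \<open>i\<close> to behind \<open>j\<close>.\<close>

lemma chord_spider_rev:
  assumes ps: "is_path ps" "set ps \<subseteq> W" and ij: "j + m < length ps" "i + 2 * m \<le> j" "1 \<le> m"
    and zs: "is_path (ps ! i # zs @ [ps ! j])" "set zs \<inter> set ps = {}" "set zs \<subseteq> W"
  shows "spider_in W m"
proof (rule chord_spider)
  let ?n = "length ps"
  show "is_path (rev ps)" "set (rev ps) \<subseteq> W" using ps by (simp_all add: is_path_rev)
  show "m \<le> ?n - 1 - j" "?n - 1 - j + 2 * m \<le> ?n - 1 - i" "?n - 1 - i < length (rev ps)" "1 \<le> m"
    using ij by auto
  have "rev ps ! (?n - 1 - j) = ps ! j" "rev ps ! (?n - 1 - i) = ps ! i"
    using ij by (simp_all add: rev_nth)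
  then show "is_path (rev ps ! (?n - 1 - j) # rev zs @ [rev ps ! (?n - 1 - i)])"
    using zs(1) is_path_rev[of "ps ! i # zs @ [ps ! j]"] by simp
  show "set (rev zs) \<inter> set (rev ps) = {}" "set (rev zs) \<subseteq> W" using zs by auto
qed

lemma branch_spider:
  assumes ps: "is_path ps" "set ps \<subseteq> W" and i: "m \<le> i" "i + m < length ps"
    and zs: "is_path zs" "zs \<noteq> []" "E (ps ! i) (hd zs)" "set zs \<inter> set ps = {}" "set zs \<subseteq> W" "m \<le> length zs"
  shows "spider_in W m"
proof -
  define as bs c where "as = take i ps" and "bs = drop (Suc i) ps" and "c = ps ! i"
  have e: "ps = as @ c # bs"
    unfolding as_def bs_def c_def using i by (intro id_take_nth_drop) simp
  have "is_path (as @ [c])" using ps is_path_appendD[of "as @ [c]" bs] e by simp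
  then have 1: "is_path (c # rev as)" using is_path_rev[of "as @ [c]"] by simp
  have 2: "is_path (c # bs)" using ps is_path_appendD[of as "c # bs"] e by simp
  have dist: "distinct (as @ c # bs)" using ps e by (simp add: is_path_def)
  have set: "set ps = insert c (set as \<union> set bs)" using e by auto
  have 3: "is_path (c # zs)" using zs set by (auto simp: is_path_Cons c_def[symmetric])
  have "spider c (rev as) bs zs" unfolding spider_def using 1 2 3 dist zs(4) set by auto
  moreover have "sverts c (rev as) bs zs \<subseteq> W" using set ps(2) zs(5) by (auto simp: sverts_def)
  ultimately show ?thesis by (rule spider_inI) (use i zs in \<open>auto simp: as_def bs_def\<close>)
qed

text \<open>Bags along a longest path: chords and bridges span fewer than \<open>2 * m\<close>
  positions or join opposite ends, so the at most \<open>2 * m\<close> end vertices and a sliding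
  window of \<open>4 * m\<close> positions capture them. Components off the path have only short
  paths from their attachment, which adds the last \<open>m\<close>.\<close>

lemma td_connected_spiderless:
  assumes fin: "finite W" and r: "r \<in> W" and conn: "\<And>x. x \<in> W \<Longrightarrow> reach W r x"
    and no: "\<not> spider_in W m" and m: "1 \<le> m"
  shows "has_td W (7 * m)"
proof -
  let ?P = "\<lambda>xs. is_path xs \<and> xs \<noteq> [] \<and> set xs \<subseteq> W"
  have "?P [r]" using r by (simp add: is_path_def)
  moreover have "\<forall>xs. ?P xs \<longrightarrow> length xs < Suc (card W)"
    using fin by (metis card_mono distinct_card is_path_def less_Suc_eq_le)
  ultimately obtain ps where ps: "is_path ps" "ps \<noteq> []" "set ps \<subseteq> W"
      and longest: "\<And>xs. ?P xs \<Longrightarrow> length xs \<le> length ps"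
    using ex_has_greatest_nat[of ?P "[r]" length "Suc (card W)"] by blast
  define n where "n = length ps"
  have n: "0 < n" using ps by (simp add: n_def)
  have inj: "i = j" if "ps ! i = ps ! j" "i < n" "j < n" for i j
    using that ps(1) by (simp add: is_path_def n_def nth_eq_iff_index_eq)
  \<comment> \<open>Every vertex outside \<open>Ends\<close> has at least \<open>m\<close> path
    vertices on both sides, so it can be a branch vertex.\<close>
  define Ends where "Ends = (!) ps ` {i. i < n \<and> (i < m \<or> n \<le> i + m)}"
  define Win where "Win x = (!) ps ` {i. i < n \<and> x \<le> i \<and> i < x + 4 * m}" for x
  define Bs where "Bs = map (\<lambda>x. Ends \<union> Win x) [0..<n]"
  \<comment> \<open>The two chord lemmas need room before \<open>i\<close> or behind
    \<open>j\<close>; both fail only if \<open>i\<close> and \<open>j\<close> lie at opposite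
    ends.\<close>
  have link: "j < i + 2 * m \<or> i < m \<and> n \<le> j + m"
    if "j < n" "is_path (ps ! i # zs @ [ps ! j])" "set zs \<inter> set ps = {}" "set zs \<subseteq> W" for i j zs
    using chord_spider[OF ps(1,3) _ _ _ m that(2-4)] chord_spider_rev[OF ps(1,3) _ _ m that(2-4)] no that(1)
    by (force simp: n_def not_less)
  have cov: "covers Bs (set ps)"
    unfolding covers_def
  proof (intro conjI ballI impI)
    show "rip Bs" unfolding rip_def
    proof (intro conjI allI impI)
      show "Bs \<noteq> []" using n by (simp add: Bs_def)
      fix x assume x: "0 < x \<and> x < length Bs"
      have "Bs ! x \<inter> Bs ! l \<subseteq> Bs ! (x - 1)" if l: "l < x" for l
      proof
        fix v assume v: "v \<in> Bs ! x \<inter> Bs ! l"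
        have eq: "Bs ! y = Ends \<union> Win y" if "y < n" for y using that by (simp add: Bs_def)
        have xn: "x < n" "l < n" "x - 1 < n" using x l by (auto simp: Bs_def)
        show "v \<in> Bs ! (x - 1)"
        proof (cases "v \<in> Ends")
          case False
          then have vv: "v \<in> Win x" "v \<in> Win l" using v eq xn by auto
          obtain i where i: "v = ps ! i" "i < n" "x \<le> i" using vv(1) by (auto simp: Win_def)
          obtain i' where i': "v = ps ! i'" "i' < n" "i' < l + 4 * m" using vv(2) by (auto simp: Win_def)
          have "i = i'" using inj i i' by simp
          then have "v \<in> Win (x - 1)" using l i i' unfolding Win_def by (intro image_eqI[of _ _ i]) auto
          then show ?thesis using eq[OF xn(3)] by simp
        qed (use eq[OF xn(3)] in simp)
      qed
      then show "\<exists>j<x. \<forall>l<x. Bs ! x \<inter> Bs ! l \<subseteq> Bs ! j" using x by (intro exI[of _ "x - 1"]) auto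
    qed
    show "\<Union>(set Bs) = set ps"
    proof
      show "\<Union>(set Bs) \<subseteq> set ps" by (auto simp: Bs_def Ends_def Win_def n_def)
      show "set ps \<subseteq> \<Union>(set Bs)"
      proof
        fix v assume "v \<in> set ps"
        then obtain i where "i < n" "v = ps ! i" by (auto simp: in_set_conv_nth n_def)
        then have "v \<in> Win i" "i \<in> set [0..<n]" using m by (auto simp: Win_def intro!: imageI)
        then show "v \<in> \<Union>(set Bs)" unfolding Bs_def by auto
      qed
    qed
    have wlog: "\<exists>B\<in>set Bs. ps ! i \<in> B \<and> ps ! j \<in> B" if ij: "i < j" "j < n" "E (ps ! i) (ps ! j)" for i j
    proof -
      have "is_path (ps ! i # [] @ [ps ! j])" using ij(3) E_irrefl by (auto simp: is_path_def)
      then have "j < i + 2 * m \<or> i < m \<and> n \<le> j + m" using link[of j i "[]"] ij by simp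
      then show ?thesis
      proof
        assume "j < i + 2 * m"
        then have "ps ! i \<in> Win i" "ps ! j \<in> Win i" using ij m by (auto simp: Win_def intro!: imageI)
        moreover have "Ends \<union> Win i \<in> set Bs" using ij by (auto simp: Bs_def)
        ultimately show ?thesis by (meson UnCI)
      next
        assume "i < m \<and> n \<le> j + m"
        then have "ps ! i \<in> Ends" "ps ! j \<in> Ends" using ij by (auto simp: Ends_def intro!: imageI)
        moreover have "Ends \<union> Win i \<in> set Bs" using ij by (auto simp: Bs_def)
        ultimately show ?thesis by blast
      qed
    qed
    fix x y assume xy: "x \<in> set ps" "y \<in> set ps" "E x y"
    then obtain i j where ij: "x = ps ! i" "i < n" "y = ps ! j" "j < n"
      by (auto simp: in_set_conv_nth n_def)
    have "i \<noteq> j" using xy(3) ij E_irrefl by auto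
    then consider "i < j" | "j < i" by linarith
    then show "\<exists>B\<in>set Bs. x \<in> B \<and> y \<in> B"
    proof cases
      case 1
      then show ?thesis using wlog[of i j] ij xy(3) by simp
    next
      case 2
      then show ?thesis using wlog[of j i] ij E_sym[OF xy(3)] by auto
    qed
  qed
  have card: "card B \<le> 6 * m" if "B \<in> set Bs" for B
  proof -
    from that obtain x where x: "B = Ends \<union> Win x" by (auto simp: Bs_def)
    have "card Ends \<le> card {i. i < n \<and> (i < m \<or> n \<le> i + m)}" unfolding Ends_def
      by (intro card_image_le) simp
    also have "\<dots> \<le> card ({..<m} \<union> {n - m..<n})" by (intro card_mono) auto
    also have "\<dots> \<le> 2 * m" using card_Un_le[of "{..<m}" "{n - m..<n}"] by simp
    finally have 1: "card Ends \<le> 2 * m" .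
    have "card (Win x) \<le> card {i. i < n \<and> x \<le> i \<and> i < x + 4 * m}" unfolding Win_def
      by (intro card_image_le) simp
    also have "\<dots> \<le> card {x..<x + 4 * m}" by (intro card_mono) auto
    finally have "card (Win x) \<le> 4 * m" by simp
    then show ?thesis using 1 card_Un_le[of Ends "Win x"] unfolding x by linarith
  qed
  have "has_td W (6 * m + m)"
  proof (rule covers_hang_comps[OF cov card ps(3) fin])
    fix x assume x: "x \<in> W - set ps"
    let ?D = "component (W - set ps) x"
    have Dsub: "?D \<subseteq> W - set ps" by (rule comp_sub)
    have "hd ps \<in> W" "hd ps \<in> set ps" using ps by auto
    then have "reach W x (hd ps)" using conn x reach_sym reach_trans by blast
    then obtain xs s where xs: "is_path (xs @ [s])" "hd (xs @ [s]) = x" "set (xs @ [s]) \<subseteq> W" "s \<in> set ps" "set xs \<inter> set ps = {}"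
      using path_to_set[of W x "hd ps" "set ps"] x \<open>hd ps \<in> set ps\<close> by blast
    have xs0: "xs \<noteq> []" "hd xs = x" using xs x by (auto simp: hd_append split: if_splits)
    define u where "u = last xs"
    have "reach (W - set ps) x u" using path_reach[of xs "W - set ps"] xs xs0
      by (auto simp: u_def is_path_append_iff)
    moreover have "u \<in> set xs" using xs0 by (simp add: u_def)
    then have "u \<in> W - set ps" using xs by auto
    ultimately have u: "u \<in> ?D" by (simp add: component_def)
    then have Du: "?D = component (W - set ps) u" using comp_eq by simp
    have Eu: "E u s" using xs(1) xs0 by (auto simp: u_def is_path_append_iff)
    obtain i where i: "i < n" "s = ps ! i" using xs(4) by (auto simp: in_set_conv_nth n_def)
    show "has_td ?D m"
    proof (rule td_short_paths)
      show "finite ?D" using fin Dsub by (meson finite_Diff finite_subset)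
      show "u \<in> ?D" by (rule u)
      show "reach ?D u y" if "y \<in> ?D" for y
        using that u Dsub unfolding Du by (intro reach_comp) blast+
      fix zs assume zs: "is_path zs" "zs \<noteq> []" "hd zs = u" "set zs \<subseteq> ?D"
      then have zd: "set zs \<inter> set ps = {}" "set zs \<subseteq> W" using Dsub by blast+
      have pse: "ps = take i ps @ ps ! i # drop (Suc i) ps" using i by (intro id_take_nth_drop) (simp add: n_def)
      show "length zs \<le> m"
      proof (rule ccontr)
        assume len: "\<not> length zs \<le> m"
        \<comment> \<open>At an inner position a long path off \<open>ps\<close> is a third leg.
          Near an end it could replace that end and give a path longer than
          \<open>ps\<close>.\<close>
        consider "m \<le> i \<and> i + m < n" | "i < m" | "n \<le> i + m" by linarith
        then show False
        proof cases
          case 1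
          then show False using branch_spider[OF ps(1,3) _ _ zs(1,2) _ zd, of m i] zs Eu E_sym i len no
            by (auto simp: n_def)
        next
          case 2
          have d: "drop i ps = ps ! i # drop (Suc i) ps" using i by (simp add: Cons_nth_drop_Suc n_def)
          have "E (last (rev zs)) (hd (drop i ps))" using zs(2,3) Eu i d by (simp add: last_rev)
          moreover have "is_path (rev zs)" "is_path (drop i ps)" using zs(1) ps(1) is_path_rev is_path_drop by auto
          moreover have "set (rev zs) \<inter> set (drop i ps) = {}" using zd set_drop_subset[of i ps] by auto
          ultimately have "is_path (rev zs @ drop i ps)" by (simp add: is_path_append_iff)
          moreover have "set (rev zs @ drop i ps) \<subseteq> W" using zd ps(3) set_drop_subset[of i ps] by auto
          ultimately show False using longest[of "rev zs @ drop i ps"] zs(2) len 2 i by (auto simp: n_def)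
        next
          case 3
          have d: "take (Suc i) ps = take i ps @ [ps ! i]" using i by (simp add: take_Suc_conv_app_nth n_def)
          have "E (last (take (Suc i) ps)) (hd zs)" using zs(2,3) Eu i d E_sym by simp
          moreover have "is_path (take (Suc i) ps)" using ps(1) is_path_take by auto
          moreover have "set (take (Suc i) ps) \<inter> set zs = {}" using zd set_take_subset[of "Suc i" ps] by auto
          ultimately have "is_path (take (Suc i) ps @ zs)" using zs(1) by (simp add: is_path_append_iff)
          moreover have "set (take (Suc i) ps @ zs) \<subseteq> W" using zd ps(3) set_take_subset[of "Suc i" ps] by auto
          ultimately show False using longest[of "take (Suc i) ps @ zs"] zs(2) len 3 i by (auto simp: n_def)
        qed
      qed
    qed
    show "\<exists>B\<in>set Bs. \<forall>u\<in>?D. \<forall>y\<in>set ps. E u y \<longrightarrow> y \<in> B"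
    proof (cases "\<forall>u\<in>?D. \<forall>y\<in>set ps. E u y \<longrightarrow> y \<in> Ends")
      case True
      moreover have "Ends \<union> Win 0 \<in> set Bs" using n by (auto simp: Bs_def)
      ultimately show ?thesis by blast
    next
      case False
      then obtain u0 i0 where u0: "u0 \<in> ?D" "i0 < n" "E u0 (ps ! i0)" "ps ! i0 \<notin> Ends"
        by (auto simp: in_set_conv_nth n_def)
      then have i0: "m \<le> i0" "i0 + m < n" by (auto simp: Ends_def)
      \<comment> \<open>One attachment \<open>i0\<close> off the ends forces all attachments of the
        component to within distance \<open>2 * m\<close> of it. If the subtraction truncates, the
        window just starts at 0.\<close>
      have "y \<in> Win (i0 - 2 * m)" if y: "y \<in> set ps" "v \<in> ?D" "E v y" for v y
      proof -
        obtain j where j: "j < n" "y = ps ! j" using y(1) by (auto simp: in_set_conv_nth n_def)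
        have u0W: "u0 \<in> W - set ps" using u0(1) Dsub by blast
        have "v \<in> component (W - set ps) u0" using comp_eq[OF u0(1)] y(2) by simp
        then have "reach (W - set ps) u0 v" by (simp add: component_def)
        then obtain zs where zs: "is_path zs" "zs \<noteq> []" "hd zs = u0" "last zs = v" "set zs \<subseteq> W - set ps"
          using reach_path u0W by blast
        have "j < i0 + 2 * m \<and> i0 < j + 2 * m"
        proof (cases "j = i0")
          case True
          then show ?thesis using m by simp
        next
          case False
          then have ne: "ps ! i0 \<noteq> ps ! j" using inj[OF _ u0(2) j(1)] by auto
          have "set zs \<inter> set ps = {}" using zs(5) by blast
          then have "is_path ((ps ! i0 # zs) @ [ps ! j])"
            unfolding is_path_append_iff[of "ps ! i0 # zs"] is_path_Cons
            using zs u0 y j ne E_sym by (auto simp: is_path_def n_def)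
          then have p: "is_path (ps ! i0 # zs @ [ps ! j])" by simp
          have p': "is_path (ps ! j # rev zs @ [ps ! i0])"
            using is_path_rev[of "ps ! i0 # zs @ [ps ! j]"] p by simp
          have s: "set zs \<inter> set ps = {}" "set zs \<subseteq> W" "set (rev zs) \<inter> set ps = {}" "set (rev zs) \<subseteq> W"
            using zs(5) by auto
          show ?thesis using link[OF j(1) p s(1,2)] link[OF u0(2) p' s(3,4)] i0 by linarith
        qed
        then have "i0 - 2 * m \<le> j \<and> j < i0 - 2 * m + 4 * m" by linarith
        then show ?thesis using j by (auto simp: Win_def intro!: imageI)
      qed
      moreover have "Ends \<union> Win (i0 - 2 * m) \<in> set Bs" using u0(2) by (auto simp: Bs_def)
      ultimately show ?thesis by blast
    qed
  qed
  then show ?thesis by simp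
qed

lemma td_spiderless:
  assumes "finite W" "Y \<subseteq> W" "\<not> spider_in (W - Y) m" "1 \<le> m"
  shows "has_td W (card Y + 7 * m)"
proof (rule covers_hang_comps[OF covers_single[of Y] _ assms(2,1)])
  fix x assume x: "x \<in> W - Y"
  show "has_td (component (W - Y) x) (7 * m)"
  proof (rule td_connected_spiderless)
    show "finite (component (W - Y) x)" using assms(1) comp_sub by (meson finite_Diff finite_subset)
    show "x \<in> component (W - Y) x" using x by (rule comp_self)
    show "reach (component (W - Y) x) x y" if "y \<in> component (W - Y) x" for y using x that by (rule reach_comp)
    show "\<not> spider_in (component (W - Y) x) m" using assms(3) spider_in_mono comp_sub by blast
  qed (rule assms(4))
qed auto

section \<open>Large bicliques from bad pairs\<close>

text \<open>The only form in which large treewidth is used after \<open>not_td_rich\<close>: the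
  reserve \<open>N\<close> pays for vertices that are already occupied.\<close>

definition rich :: "nat \<Rightarrow> nat \<Rightarrow> bool" where
  "rich m N \<longleftrightarrow> (\<forall>Y. Y \<subseteq> V \<and> card Y \<le> N \<longrightarrow> spider_in (V - Y) m)"

definition biclique :: "nat \<Rightarrow> 'a set \<Rightarrow> 'a set \<Rightarrow> bool" where
  "biclique n A B \<longleftrightarrow> finite A \<and> finite B \<and> card A = n \<and> card B = n \<and> (\<forall>x\<in>A. \<forall>y\<in>B. E x y)"

text \<open>\<open>t\<close> is the leg length of the spiders in the forest to be embedded; the three predicates say that
  a pair of its vertices, at levels \<open>a\<close> and \<open>b\<close>, is always mapped to an edge. The remaining spiders of the
  forest are ignored, since there is always room for them.\<close>

definition leg_bad :: "nat \<Rightarrow> nat \<Rightarrow> nat \<Rightarrow> bool" where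
  "leg_bad t a b \<longleftrightarrow> (\<forall>c l0 l1 l2. spider c l0 l1 l2 \<and> t \<le> length l0 \<and> t \<le> length l1 \<and> t \<le> length l2 \<longrightarrow>
     E ((c # l0) ! a) ((c # l0) ! b))"

definition two_legs_bad :: "nat \<Rightarrow> nat \<Rightarrow> nat \<Rightarrow> bool" where
  "two_legs_bad t a b \<longleftrightarrow> (\<forall>c l0 l1 l2. spider c l0 l1 l2 \<and> t \<le> length l0 \<and> t \<le> length l1 \<and> t \<le> length l2 \<longrightarrow>
     E ((c # l0) ! a) ((c # l1) ! b))"

definition two_spiders_bad :: "nat \<Rightarrow> nat \<Rightarrow> nat \<Rightarrow> bool" where
  "two_spiders_bad t a b \<longleftrightarrow> (\<forall>c l0 l1 l2 c' l0' l1' l2'.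
     spider c l0 l1 l2 \<and> t \<le> length l0 \<and> t \<le> length l1 \<and> t \<le> length l2 \<and>
     spider c' l0' l1' l2' \<and> t \<le> length l0' \<and> t \<le> length l1' \<and> t \<le> length l2' \<and>
     sverts c l0 l1 l2 \<inter> sverts c' l0' l1' l2' = {} \<longrightarrow>
     E ((c # l0) ! a) ((c' # l0') ! b))"

lemma rich_spider: "rich m N \<Longrightarrow> Y \<subseteq> V \<Longrightarrow> card Y \<le> N \<Longrightarrow> spider_in (V - Y) m"
  by (simp add: rich_def)

lemma not_td_rich:
  assumes "\<not> has_td V (N + 7 * m)" "1 \<le> m"
  shows "rich m N"
  unfolding rich_def
proof (intro allI impI)
  fix Y assume Y: "Y \<subseteq> V \<and> card Y \<le> N"
  show "spider_in (V - Y) m"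
  proof (rule ccontr)
    assume "\<not> spider_in (V - Y) m"
    then have "has_td V (card Y + 7 * m)" using Y finV assms(2) by (intro td_spiderless) auto
    then have "has_td V (N + 7 * m)" by (rule has_td_mono) (use Y in simp)
    then show False using assms(1) by simp
  qed
qed

lemma rich_mono:
  assumes "rich m N" "m' \<le> m" "N' \<le> N"
  shows "rich m' N'"
  unfolding rich_def
proof (intro allI impI)
  fix Y assume Y: "Y \<subseteq> V \<and> card Y \<le> N'"
  then have "spider_in (V - Y) m" using assms by (intro rich_spider) auto
  then obtain c l0 l1 l2 where "spider c l0 l1 l2" "sverts c l0 l1 l2 \<subseteq> V - Y" "length l0 = m"
      "length l1 = m" "length l2 = m" unfolding spider_in_def by blast
  then show "spider_in (V - Y) m'" using assms(2) by (intro spider_inI) auto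
qed

lemma card_sverts: "card (sverts c l0 l1 l2) \<le> Suc (length l0 + length l1 + length l2)"
proof -
  have "sverts c l0 l1 l2 = set (c # l0 @ l1 @ l2)" by (auto simp: sverts_def)
  then show ?thesis using card_length[of "c # l0 @ l1 @ l2"] by simp
qed

lemma finite_sverts: "finite (sverts c l0 l1 l2)"
  by (simp add: sverts_def)

lemma nth_sverts: "k \<le> length l0 \<Longrightarrow> (c # l0) ! k \<in> sverts c l0 l1 l2"
  using nth_mem[of k "c # l0"] by (auto simp: sverts_def)

lemma spider_leg0:
  assumes "spider c l0 l1 l2" "is_path (c # l)" "set l \<inter> (set l1 \<union> set l2) = {}"
  shows "spider c l l1 l2"
  using assms unfolding spider_def by blast

section \<open>A bad pair on one leg\<close>

text \<open>\<open>l ! k\<close> is at level \<open>k + 1\<close>, so the new leg keeps the levels 0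
  to \<open>a\<close> and continues with \<open>l ! k\<close> at level \<open>a + 1\<close>.\<close>

lemma is_path_shortcut:
  assumes p: "is_path (c # l)" and k: "k < length l" "a \<le> k" and e: "E ((c # l) ! a) (l ! k)"
  shows "is_path (c # take a l @ drop k l)"
proof -
  have "is_path ((c # take a l) @ drop k l)"
    unfolding is_path_append_iff
  proof (intro conjI)
    show "is_path (c # take a l)" using p by (rule is_path_Cons_take)
    show "is_path (drop k l)" using is_path_drop[OF p, of "Suc k"] by simp
    have "distinct (c # l)" using p by (simp add: is_path_def)
    then show "set (c # take a l) \<inter> set (drop k l) = {}"
      using set_take_disj_set_drop_if_distinct[of l a k] k(2) set_drop_subset[of k l] by auto
    have "last (c # take a l) = (c # l) ! a"
    proof -
      have "c # take a l = take (Suc a) (c # l)" by simp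
      moreover have "take (Suc a) (c # l) = take a (c # l) @ [(c # l) ! a]"
        using k by (intro take_Suc_conv_app_nth) simp
      ultimately show ?thesis by simp
    qed
    then show "c # take a l = [] \<or> drop k l = [] \<or> E (last (c # take a l)) (hd (drop k l))"
      using e k(1) by (simp add: hd_drop_conv_nth)
  qed
  then show ?thesis by simp
qed

text \<open>Short-cutting the leg along an edge that badness provides moves the next such edge
  \<open>b - a - 1\<close> steps further out.\<close>

lemma leg_bad_jump:
  assumes bad: "leg_bad t a b" and ab: "a + 2 \<le> b" "b \<le> t"
    and sp: "spider c l0 l1 l2" "t \<le> length l1" "t \<le> length l2"
    and len: "a + j * (b - a - 1) + t \<le> length l0"
  shows "E ((c # l0) ! a) (l0 ! (a + j * (b - a - 1)))"
  using len
proof (induction j)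
  case 0
  have "is_path (c # l0)" using sp by (simp add: spider_def)
  then show ?case using is_path_nth[of "c # l0" a] 0 ab by simp
next
  case (Suc j)
  let ?d = "b - a - 1"
  let ?k = "a + j * ?d"
  \<comment> \<open>On this leg \<open>l0 ! ?k\<close> has level \<open>a + 1\<close>, so level
    \<open>b\<close> is the vertex \<open>b - a - 1\<close> places behind it.\<close>
  let ?l = "take a l0 @ drop ?k l0"
  have IH: "E ((c # l0) ! a) (l0 ! ?k)" using Suc by simp
  have len: "?k + ?d + t \<le> length l0" using Suc.prems by simp
  have "is_path (c # l0)" using sp by (simp add: spider_def)
  then have "is_path (c # ?l)" using is_path_shortcut[of c l0 ?k a] IH len ab by simp
  moreover have "set ?l \<subseteq> set l0" using set_take_subset[of a l0] set_drop_subset[of ?k l0] by auto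
  then have "set ?l \<inter> (set l1 \<union> set l2) = {}" using sp by (auto simp: spider_def)
  ultimately have "spider c ?l l1 l2" using spider_leg0 sp(1) by blast
  moreover have "t \<le> length ?l" using len by simp
  ultimately have "E ((c # ?l) ! a) ((c # ?l) ! b)" using bad sp unfolding leg_bad_def by blast
  moreover have "(c # ?l) ! a = (c # l0) ! a" using len ab by (cases a) (simp_all add: nth_append)
  moreover have "(c # ?l) ! b = l0 ! (a + Suc j * ?d)"
  proof -
    obtain b' where b': "b = Suc b'" using ab by (cases b) auto
    then have "(c # ?l) ! b = ?l ! b'" by simp
    also have "\<dots> = drop ?k l0 ! (b' - a)" using len ab b' by (simp add: nth_append)
    also have "\<dots> = l0 ! (?k + (b' - a))" using len ab b' by (intro nth_drop) simp
    also have "?k + (b' - a) = a + Suc j * ?d" using b' by simp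
    finally show ?thesis .
  qed
  ultimately show ?case by simp
qed

lemma bicliqueI:
  assumes f: "inj_on f {..<n}" and g: "inj_on g {..<n}"
    and E: "\<And>x y. x < n \<Longrightarrow> y < n \<Longrightarrow> E (f x) (g y)"
  shows "\<exists>A B. biclique n A B"
proof -
  have "biclique n (f ` {..<n}) (g ` {..<n})"
    unfolding biclique_def using E card_image[OF f] card_image[OF g] by auto
  then show ?thesis by blast
qed

text \<open>The vertex \<open>z\<close> at level \<open>a\<close> is adjacent to an arithmetic progression on its own leg;
  spiders centred at \<open>z\<close> then turn these adjacencies into a half graph.\<close>

lemma leg_bad_biclique:
  assumes bad: "leg_bad t a b" and ab: "a + 2 \<le> b" "b \<le> t" "1 \<le> a"
    and rich: "spider_in V ((2 * n + 2 * t + 2) * t)"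
  shows "\<exists>A B. biclique n A B"
proof -
  define M where "M = (2 * n + 2 * t + 2) * t"
  obtain c l0 l1 l2 where sp: "spider c l0 l1 l2" and len: "length l0 = M" "length l1 = M" "length l2 = M"
    using rich unfolding spider_in_def M_def by blast
  define d where "d = b - a - 1"
  have d: "1 \<le> d" "d \<le> t" "a \<le> t" using ab by (auto simp: d_def)
  \<comment> \<open>Chosen so that position \<open>a + K * d\<close>, where the third leg of the new
    spider starts, lies beyond every stretch \<open>m0\<close> needed for indices below
    \<open>2 * n\<close>.\<close>
  define K where "K = 2 * n + a + t"
  have MK: "a + K * d + t \<le> M"
  proof -
    have "K * d \<le> (2 * n + t + t) * t" unfolding K_def using d by (intro mult_le_mono) auto
    then show ?thesis using d unfolding M_def by (simp add: algebra_simps)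
  qed
  have tM: "t \<le> M" using MK by simp
  define z where "z = l0 ! (a - 1)"
  have z: "(c # l0) ! a = z" using ab by (simp add: z_def nth_Cons')
  have jump: "E z (l0 ! (a + j * d))" if "a + j * d + t \<le> M" for j
    using leg_bad_jump[OF bad ab(1,2) sp, of j] that len tM by (simp add: z d_def)
  have p0: "is_path (c # l0)" "is_path (c # l1)" "distinct l0" using sp by (auto simp: spider_def is_path_def)
  have aM: "a - 1 < length l0" using MK len ab by simp
  have edge: "E (l0 ! (2 * a + k * d - 1)) (l0 ! (2 * a + k' * d))" if k: "k < n" "n \<le> k'" "k' < 2 * n" for k k'
  proof -
    \<comment> \<open>The spider centred at \<open>z\<close>: \<open>m0\<close> starts at the
      neighbour of \<open>z\<close> with index \<open>k\<close>, \<open>m1\<close> returns to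
      \<open>c\<close> and follows \<open>l1\<close>, \<open>m2\<close> starts at the neighbour with
      index \<open>K\<close>. Level \<open>a\<close> of \<open>m0\<close> is position
      \<open>2 * a + k * d - 1\<close> of \<open>l0\<close>, and jump number \<open>k' - k\<close>
      from there reaches position \<open>2 * a + k' * d\<close>.\<close>
    define j where "j = k' - k"
    define s where "s = a + k * d"
    define L where "L = a + j * d + t"
    define m0 where "m0 = take L (drop s l0)"
    define m1 where "m1 = rev (take (a - 1) l0) @ c # l1"
    define m2 where "m2 = drop (a + K * d) l0"
    have kj: "k + j = k'" using k by (simp add: j_def)
    have sL: "s + L = 2 * a + k' * d + t" unfolding s_def L_def kj[symmetric] by (simp add: algebra_simps)
    have "k' * d + a + t \<le> K * d"
    proof -
      have "k' * d + (a + t) * 1 \<le> 2 * n * d + (a + t) * d"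
        using k d by (intro add_mono mult_le_mono) auto
      then show ?thesis unfolding K_def by (simp add: algebra_simps)
    qed
    then have sLK: "s + L \<le> a + K * d" using sL by linarith
    have sM: "s + L \<le> M" using sLK MK by linarith
    have lm: "length m0 = L" "t \<le> length m1" "t \<le> length m2"
      using sM MK len tM by (auto simp: m0_def m1_def m2_def)
    have kM: "a + k * d + t \<le> M" using sM unfolding s_def L_def by linarith
    have "hd m0 = l0 ! s" "m0 \<noteq> []"
      using sM len ab d by (auto simp: m0_def hd_drop_conv_nth hd_take L_def)
    then have e0: "E z (hd m0)" using jump[OF kM] by (simp add: s_def)
    have "hd m2 = l0 ! (a + K * d)" using MK len ab by (auto simp: m2_def hd_drop_conv_nth)
    then have e2: "E z (hd m2)" using jump[OF MK] by simp
    have set0: "set m0 \<subseteq> set (drop a l0)"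
      using set_take_subset[of L "drop s l0"] set_drop_subset_set_drop[of a s l0] by (auto simp: m0_def s_def)
    have set2: "set m2 \<subseteq> set (drop a l0)"
      using set_drop_subset_set_drop[of a "a + K * d" l0] by (auto simp: m2_def)
    have pz: "l0 = take (a - 1) l0 @ z # drop a l0"
      using id_take_nth_drop[OF aM] ab by (simp add: z_def)
    have dz: "distinct (take (a - 1) l0 @ z # drop a l0)" using p0(3) pz by simp
    have zn: "z \<notin> set (drop a l0)" "z \<notin> set (take (a - 1) l0)" using dz by auto
    have disj: "set m0 \<inter> set m2 = {}"
    proof -
      have "set (take (s + L) l0) \<inter> set (drop (a + K * d) l0) = {}"
        using p0(3) sLK by (rule set_take_disj_set_drop_if_distinct)
      moreover have "m0 = drop s (take (s + L) l0)" by (simp add: m0_def take_drop add.commute)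
      then have "set m0 \<subseteq> set (take (s + L) l0)" using set_drop_subset by metis
      ultimately show ?thesis by (auto simp: m2_def)
    qed
    have p1: "is_path (z # m1)"
    proof -
      have zl: "z \<in> set l0" using aM by (simp add: z_def)
      have "is_path (take (Suc a) (c # l0))" using p0(1) by (rule is_path_take)
      moreover have "take (Suc a) (c # l0) = c # take (a - 1) l0 @ [z]"
        using take_Suc_conv_app_nth[OF aM] ab by (simp add: z_def)
      ultimately have "is_path (rev (c # take (a - 1) l0 @ [z]))" using is_path_rev by metis
      then have "is_path (z # rev (take (a - 1) l0) @ [c])" by simp
      moreover have "set (z # rev (take (a - 1) l0) @ [c]) \<inter> set l1 = {}"
        using sp zl set_take_subset[of "a - 1" l0] by (auto simp: spider_def is_path_def)
      moreover have "is_path l1" "l1 = [] \<or> E c (hd l1)" using p0(2) by (auto simp: is_path_Cons)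
      ultimately have "is_path ((z # rev (take (a - 1) l0) @ [c]) @ l1)"
        unfolding is_path_append_iff[of _ l1] by simp
      then show ?thesis by (simp add: m1_def)
    qed
    have pd: "is_path (drop s l0)" "is_path m2" using p0(1) is_path_drop[of "c # l0" "Suc _"] by (auto simp: m2_def)
    have "spider z m0 m1 m2" unfolding spider_def
    proof (intro conjI)
      show "is_path (z # m0)" using e0 zn set0 pd(1) is_path_take by (auto simp: is_path_Cons m0_def)
      show "is_path (z # m1)" by (rule p1)
      show "is_path (z # m2)" using e2 zn set2 pd(2) by (auto simp: is_path_Cons)
      have "set m1 \<inter> set (drop a l0) = {}"
        using dz sp set_drop_subset[of a l0] by (auto simp: m1_def spider_def is_path_def)
      then show "set m0 \<inter> set m1 = {}" "set m1 \<inter> set m2 = {}" using set0 set2 by auto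
    qed (rule disj)
    then have "E ((z # m0) ! a) (m0 ! (a + j * d))"
      using leg_bad_jump[OF bad ab(1,2), of z m0 m1 m2 j] lm by (simp add: d_def L_def)
    moreover have "(z # m0) ! a = l0 ! (2 * a + k * d - 1)"
    proof -
      have "(z # m0) ! a = m0 ! (a - 1)" using ab by (simp add: nth_Cons')
      also have "\<dots> = l0 ! (s + (a - 1))" using sM len ab by (simp add: m0_def L_def)
      also have "s + (a - 1) = 2 * a + k * d - 1" using ab by (simp add: s_def)
      finally show ?thesis .
    qed
    moreover have "m0 ! (a + j * d) = l0 ! (2 * a + k' * d)"
    proof -
      have "m0 ! (a + j * d) = l0 ! (s + (a + j * d))" using sM len ab by (simp add: m0_def L_def)
      also have "s + (a + j * d) = 2 * a + k' * d"
        unfolding kj[symmetric] s_def add_mult_distrib by simp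
      finally show ?thesis .
    qed
    ultimately show ?thesis by simp
  qed
  have bound: "2 * a + k * d < M" if "k < 2 * n" for k
  proof -
    have "k * d + a * 1 \<le> 2 * n * d + a * d" using that d by (intro add_mono mult_le_mono) auto
    then have "k * d + a \<le> K * d" unfolding K_def by (simp add: algebra_simps)
    then show ?thesis using MK ab by linarith
  qed
  \<comment> \<open>Indices below \<open>n\<close> on one side and from \<open>n\<close> on at the
    other: on these the half graph is complete.\<close>
  show ?thesis
  proof (rule bicliqueI)
    show "inj_on (\<lambda>x. l0 ! ((2 * a - 1) + x * d)) {..<n}"
      using p0(3) d(1) bound len ab by (intro inj_on_nth_lin) (auto simp: less_imp_diff_less)
    show "inj_on (\<lambda>x. l0 ! ((2 * a + n * d) + x * d)) {..<n}"
    proof (rule inj_on_nth_lin[OF p0(3) d(1)])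
      fix x assume "x < n"
      then show "2 * a + n * d + x * d < length l0" using bound[of "n + x"] len by (simp add: algebra_simps)
    qed
    fix x y assume "x < n" "y < n"
    then show "E (l0 ! (2 * a - 1 + x * d)) (l0 ! (2 * a + n * d + y * d))"
      using edge[of x "n + y"] ab by (simp add: algebra_simps)
  qed
qed

section \<open>A bad pair on two legs of one spider\<close>

text \<open>Badness joins the vertex \<open>z\<close> at level \<open>b\<close> of \<open>l0\<close>
  to level \<open>a\<close> of both other legs, so \<open>z\<close> can become the centre. The first
  leg loses \<open>b\<close> vertices, the others only \<open>a - 1\<close>, as the vertex at level
  \<open>a\<close> is now their first.\<close>

lemma two_legs_bad_move:
  assumes bad: "two_legs_bad t a b" and ab: "1 \<le> a" "a \<le> b" "b \<le> t"
    and sp: "spider c l0 l1 l2" and len: "b + t \<le> length l0" "b + t \<le> length l1" "b + t \<le> length l2"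
  shows "\<exists>c'. spider c' (drop b l0) (drop (a - 1) l1) (drop (a - 1) l2)"
proof -
  define z where "z = l0 ! (b - 1)"
  have z: "(c # l0) ! b = z" using ab by (simp add: z_def nth_Cons')
  have nth: "(c # l) ! a = l ! (a - 1)" for l using ab by (simp add: nth_Cons')
  have "spider c l1 l0 l2" "spider c l2 l0 l1" using sp by (auto simp: spider_def)
  then have e: "E (l1 ! (a - 1)) z" "E (l2 ! (a - 1)) z"
    using bad len unfolding two_legs_bad_def nth[symmetric] z[symmetric] by (metis add_leD2)+
  have d: "distinct (c # l0)" "distinct (c # l1)" "distinct (c # l2)" using sp by (auto simp: spider_def is_path_def)
  have bl: "b - 1 < length l0" using len ab by simp
  then have zl: "z \<in> set l0" by (simp add: z_def)
  have dz: "drop (b - 1) l0 = z # drop b l0" using Cons_nth_drop_Suc[OF bl] ab by (simp add: z_def)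
  have pd: "is_path (drop k l0)" "is_path (drop k l1)" "is_path (drop k l2)" for k
    using sp is_path_drop[of "c # _" "Suc k"] by (auto simp: spider_def)
  have sub: "set (drop k l) \<subseteq> set l" for k and l :: "'a list" by (rule set_drop_subset)
  have "spider z (drop b l0) (drop (a - 1) l1) (drop (a - 1) l2)"
    unfolding spider_def
  proof (intro conjI)
    show "is_path (z # drop b l0)" using pd(1)[of "b - 1"] dz by simp
    have "z \<notin> set l1" "z \<notin> set l2" using zl sp by (auto simp: spider_def)
    then have "z \<notin> set (drop (a - 1) l1)" "z \<notin> set (drop (a - 1) l2)" using sub by blast+
    moreover have "hd (drop (a - 1) l1) = l1 ! (a - 1)" "hd (drop (a - 1) l2) = l2 ! (a - 1)"
      using len ab by (simp_all add: hd_drop_conv_nth)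
    ultimately show "is_path (z # drop (a - 1) l1)" "is_path (z # drop (a - 1) l2)"
      unfolding is_path_Cons using pd e E_sym by auto
    show "set (drop b l0) \<inter> set (drop (a - 1) l1) = {}" "set (drop b l0) \<inter> set (drop (a - 1) l2) = {}"
      "set (drop (a - 1) l1) \<inter> set (drop (a - 1) l2) = {}"
      using sp by (auto simp: spider_def dest!: in_set_dropD)
  qed
  then show ?thesis by blast
qed

lemma two_legs_bad_moves0:
  assumes bad: "two_legs_bad t a b" and ab: "1 \<le> a" "a \<le> b" "b \<le> t"
    and sp: "spider c l0 l1 l2" and len: "m * b + t \<le> length l0" "m * b + t \<le> length l1" "m * b + t \<le> length l2"
  shows "\<exists>c'. spider c' (drop (m * b) l0) (drop (m * (a - 1)) l1) (drop (m * (a - 1)) l2)"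
  using len
proof (induction m)
  case 0
  then show ?case using sp by auto
next
  case (Suc m)
  then obtain c' where c': "spider c' (drop (m * b) l0) (drop (m * (a - 1)) l1) (drop (m * (a - 1)) l2)" by auto
  have "m * (a - 1) \<le> m * b" using ab by (intro mult_le_mono) auto
  then have "\<exists>c'. spider c' (drop b (drop (m * b) l0)) (drop (a - 1) (drop (m * (a - 1)) l1))
      (drop (a - 1) (drop (m * (a - 1)) l2))"
  proof (intro two_legs_bad_move[OF bad ab c'])
    show "b + t \<le> length (drop (m * b) l0)" "b + t \<le> length (drop (m * (a - 1)) l1)"
      "b + t \<le> length (drop (m * (a - 1)) l2)"
      using Suc.prems \<open>m * (a - 1) \<le> m * b\<close> unfolding length_drop mult_Suc by linarith+
  qed
  then show ?case by (simp add: add.commute)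
qed

text \<open>Recentring repeatedly, \<open>m\<close> times on the first and \<open>k\<close> times on the second leg, places the
  levels \<open>a\<close> and \<open>b\<close> at positions depending linearly on \<open>m\<close> and \<open>k\<close>.\<close>

lemma two_legs_bad_edge:
  assumes bad: "two_legs_bad t a b" and ab: "1 \<le> a" "a \<le> b" "b \<le> t"
    and sp: "spider c l0 l1 l2"
    and len: "(m + k) * b + t \<le> length l0" "(m + k) * b + t \<le> length l1" "(m + k) * b + t \<le> length l2"
  shows "E (l0 ! (m * b + k * (a - 1) + (a - 1))) (l1 ! (m * (a - 1) + k * b + (b - 1)))"
proof -
  obtain c1 where c1: "spider c1 (drop (m * b) l0) (drop (m * (a - 1)) l1) (drop (m * (a - 1)) l2)"
    using two_legs_bad_moves0[OF bad ab sp, of m] len by (auto simp: algebra_simps)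
  have mle: "m * (a - 1) \<le> m * b" "k * (a - 1) \<le> k * b" using ab by (auto intro: mult_le_mono)
  have "\<exists>c'. spider c' (drop (k * b) (drop (m * (a - 1)) l1)) (drop (k * (a - 1)) (drop (m * b) l0))
     (drop (k * (a - 1)) (drop (m * (a - 1)) l2))"
  proof (intro two_legs_bad_moves0[OF bad ab spider_swap01[OF c1]])
    show "k * b + t \<le> length (drop (m * b) l0)" "k * b + t \<le> length (drop (m * (a - 1)) l1)"
      "k * b + t \<le> length (drop (m * (a - 1)) l2)"
      using len mle unfolding length_drop add_mult_distrib by linarith+
  qed
  then obtain c2 where "spider c2 (drop (m * (a - 1) + k * b) l1) (drop (m * b + k * (a - 1)) l0)
     (drop (m * (a - 1) + k * (a - 1)) l2)" by (auto simp: add.commute)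
  then have *: "spider c2 (drop (m * b + k * (a - 1)) l0) (drop (m * (a - 1) + k * b) l1)
     (drop (m * (a - 1) + k * (a - 1)) l2)" by (rule spider_swap01)
  have "E ((c2 # drop (m * b + k * (a - 1)) l0) ! a) ((c2 # drop (m * (a - 1) + k * b) l1) ! b)"
  proof -
    have "t \<le> length (drop (m * b + k * (a - 1)) l0)" "t \<le> length (drop (m * (a - 1) + k * b) l1)"
      "t \<le> length (drop (m * (a - 1) + k * (a - 1)) l2)"
      using len mle unfolding length_drop add_mult_distrib by linarith+
    then show ?thesis using bad *  unfolding two_legs_bad_def by blast
  qed
  moreover have "m * b + k * (a - 1) \<le> length l0" "m * (a - 1) + k * b \<le> length l1"
    using len mle unfolding add_mult_distrib by linarith+
  ultimately show ?thesis using ab by (simp add: nth_Cons' del: One_nat_def)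
qed

text \<open>With \<open>p = a - 1\<close> the two positions are \<open>m * b + k * p\<close> and
  \<open>m * p + k * b\<close> up to constants, a linear system with determinant
  \<open>D = b * b - p * p\<close>, which is positive. It is solved so that the first position
  depends on \<open>x\<close> alone and the second on \<open>y\<close> alone.\<close>

lemma two_legs_bad_biclique:
  assumes bad: "two_legs_bad t a b" and ab: "1 \<le> a" "a \<le> b" "b \<le> t"
    and rich: "spider_in V (4 * n * t * t + t)"
  shows "\<exists>A B. biclique n A B"
proof -
  define M where "M = 4 * n * t * t + t"
  obtain c l0 l1 l2 where sp: "spider c l0 l1 l2" and len: "length l0 = M" "length l1 = M" "length l2 = M"
    using rich unfolding spider_in_def M_def by blast
  define p where "p = a - 1"
  define D where "D = b * b - p * p"
  define N where "N = n * b"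
  have p: "p < b" using ab unfolding p_def by linarith
  then have "p * p < b * b" by (intro mult_strict_mono') auto
  then have D: "1 \<le> D" "D + p * p = b * b" by (auto simp: D_def)
  have edge: "E (l0 ! (N * (b + p) + p + x * D)) (l1 ! (N * (b + p) + (b - 1) + y * D)) \<and>
      N * (b + p) + p + x * D < M \<and> N * (b + p) + (b - 1) + y * D < M"
    if xy: "x < n" "y < n" for x y
  proof -
    have le: "y * p \<le> N" "x * p \<le> N" "x * b \<le> N" "y * b \<le> N"
      unfolding N_def using xy p by (auto intro!: mult_le_mono)
    \<comment> \<open>Cramer's rule for the increments \<open>x * D\<close> and
      \<open>y * D\<close>. The offset \<open>N\<close> keeps the subtractions exact, and
      \<open>m + k \<le> 4 * N\<close> accounts for the required leg length.\<close>
    define m k where "m = N + x * b - y * p" and "k = N + y * b - x * p"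
    have mk: "m + y * p = N + x * b" "k + x * p = N + y * b"
      unfolding m_def k_def using le by auto
    have X: "m * b + k * p = N * (b + p) + x * D"
    proof -
      have "(m + y * p) * b + (k + x * p) * p = (N + x * b) * b + (N + y * b) * p" using mk by simp
      then have "m * b + k * p + x * (p * p) = N * (b + p) + x * (b * b)" by (simp add: algebra_simps)
      then show ?thesis unfolding D(2)[symmetric] by (simp add: algebra_simps)
    qed
    have Y: "m * p + k * b = N * (b + p) + y * D"
    proof -
      have "(m + y * p) * p + (k + x * p) * b = (N + x * b) * p + (N + y * b) * b" using mk by simp
      then have "m * p + k * b + y * (p * p) = N * (b + p) + y * (b * b)" by (simp add: algebra_simps)
      then show ?thesis unfolding D(2)[symmetric] by (simp add: algebra_simps)
    qed
    have "m + k \<le> 4 * N" using mk le by linarith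
    also have "4 * N \<le> 4 * n * t" unfolding N_def using ab by simp
    finally have "(m + k) * b \<le> 4 * n * t * t" using ab by (intro mult_le_mono) auto
    then have L: "(m + k) * b + t \<le> M" by (simp add: M_def)
    have "m * p + k * b \<le> (m + k) * b" "m * b + k * p \<le> (m + k) * b"
      using p by (auto simp: algebra_simps intro: mult_le_mono)
    then have "m * p + k * b + (b - 1) < M" "m * b + k * p + p < M" using L p ab by linarith+
    moreover have "E (l0 ! (m * b + k * p + p)) (l1 ! (m * p + k * b + (b - 1)))"
      unfolding p_def using two_legs_bad_edge[OF bad ab sp, of m k] L len by simp
    ultimately show ?thesis unfolding X Y by (simp add: ac_simps)
  qed
  have dist: "distinct l0" "distinct l1" using sp by (auto simp: spider_def is_path_def)
  show ?thesis
  proof (rule bicliqueI)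
    show "inj_on (\<lambda>x. l0 ! (N * (b + p) + p + x * D)) {..<n}"
      using edge len by (intro inj_on_nth_lin dist D) auto
    show "inj_on (\<lambda>x. l1 ! (N * (b + p) + (b - 1) + x * D)) {..<n}"
      using edge len by (intro inj_on_nth_lin dist D) auto
  qed (use edge in blast)
qed

section \<open>A bad pair consisting of the centre and a vertex of a leg\<close>

text \<open>The leg containing \<open>s\<close> is cut off at \<open>s\<close> and listed first, so
  that it can be prolonged out of the spider while the other two legs stay long. For
  \<open>s = c\<close> the head is empty.\<close>

lemma spider_head:
  assumes sp: "spider c l0 l1 l2" and len: "m \<le> length l0" "m \<le> length l1" "m \<le> length l2"
    and s: "s \<in> sverts c l0 l1 l2"
  shows "\<exists>hs m1 m2. spider c hs m1 m2 \<and> last (c # hs) = s \<and>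
     sverts c hs m1 m2 \<subseteq> sverts c l0 l1 l2 \<and> m \<le> length m1 \<and> m \<le> length m2"
proof -
  have key: "\<exists>hs. spider c hs k1 k2 \<and> last (c # hs) = s \<and> sverts c hs k1 k2 \<subseteq> sverts c k0 k1 k2"
    if k: "spider c k0 k1 k2" "s \<in> set k0" for k0 k1 k2
  proof -
    obtain xs ys where xs: "k0 = xs @ s # ys" using split_list[OF k(2)] by blast
    have "k0 = (xs @ [s]) @ ys" using xs by simp
    then have t: "take (Suc (length xs)) k0 = xs @ [s]" by simp
    show ?thesis using spider_take[OF k(1), of "Suc (length xs)" "length k1" "length k2"]
      sverts_take[of c "Suc (length xs)" k0 "length k1" k1 "length k2" k2] t
      by (intro exI[of _ "xs @ [s]"]) simp
  qed
  consider "s = c" | "s \<in> set l0" | "s \<in> set l1" | "s \<in> set l2" using s by (auto simp: sverts_def)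
  then show ?thesis
  proof cases
    case 1
    then show ?thesis using spider_take[OF sp, of 0 "length l1" "length l2"] len
      by (intro exI[of _ "[]"] exI[of _ l1] exI[of _ l2]) (auto simp: sverts_def)
  next
    case 2
    then show ?thesis using key[OF sp] len by blast
  next
    case 3
    have "sverts c l1 l0 l2 = sverts c l0 l1 l2" by (auto simp: sverts_def)
    then show ?thesis using key[OF spider_swap01[OF sp] 3] len by blast
  next
    case 4
    have "sverts c l2 l0 l1 = sverts c l0 l1 l2" by (auto simp: sverts_def)
    then show ?thesis using key[OF spider_swap01[OF spider_swap12[OF sp]] 4] len by blast
  qed
qed

text \<open>A vertex splits its leg into two parts; the longer one, counted with the vertex, has at
  least half of the length.\<close>

lemma spider_tail:
  assumes sp: "spider c l0 l1 l2" and len: "m \<le> length l0" "m \<le> length l1" "m \<le> length l2"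
    and s: "s \<in> sverts c l0 l1 l2"
  shows "\<exists>tl. is_path (s # tl) \<and> set (s # tl) \<subseteq> sverts c l0 l1 l2 \<and> m \<le> 2 * length (s # tl)"
proof -
  have key: "\<exists>tl. is_path (s # tl) \<and> set (s # tl) \<subseteq> set l \<and> m \<le> 2 * length (s # tl)"
    if l: "is_path (c # l)" "s \<in> set l" "m \<le> length l" for l
  proof -
    obtain xs ys where xs: "l = xs @ s # ys" using split_list[OF l(2)] by blast
    have p: "is_path (s # ys)" "is_path (xs @ [s])"
      using is_path_appendD[of "c # xs" "s # ys"] is_path_appendD[of "[c]" l]
        is_path_appendD[of "xs @ [s]" ys] l(1) xs by auto
    have p2: "is_path (s # rev xs)" using is_path_rev[of "xs @ [s]"] p(2) by simp
    show ?thesis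
    proof (cases "length xs \<le> length ys")
      case True
      then show ?thesis using p l(3) xs by (intro exI[of _ ys]) auto
    next
      case False
      then show ?thesis using p2 l(3) xs by (intro exI[of _ "rev xs"]) auto
    qed
  qed
  have legs: "is_path (c # l0)" "is_path (c # l1)" "is_path (c # l2)" using sp by (auto simp: spider_def)
  have sub: "set l0 \<subseteq> sverts c l0 l1 l2" "set l1 \<subseteq> sverts c l0 l1 l2" "set l2 \<subseteq> sverts c l0 l1 l2"
    by (auto simp: sverts_def)
  consider "s = c" | "s \<in> set l0" | "s \<in> set l1" | "s \<in> set l2" using s by (auto simp: sverts_def)
  then show ?thesis
  proof cases
    case 1
    then show ?thesis using legs(1) len sub by (intro exI[of _ l0]) (auto simp: sverts_def)
  next
    case 2
    then show ?thesis using key[OF legs(1)] len sub by (meson subset_trans)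
  next
    case 3
    then show ?thesis using key[OF legs(2)] len sub by (meson subset_trans)
  next
    case 4
    then show ?thesis using key[OF legs(3)] len sub by (meson subset_trans)
  qed
qed

text \<open>The first leg of \<open>c\<close> is led along a connecting path to the other spider and
  then into it. Since level 0 is bad with level \<open>b\<close>, the jumps join \<open>c\<close> to
  every \<open>b - 1\<close>-st vertex of this leg, hence to many vertices of the other spider,
  however far away it is.\<close>

lemma centre_bad_neighbours:
  assumes bad: "leg_bad t 0 b" and b: "2 \<le> b" "b \<le> t"
    and sp: "spider c l0 l1 l2" and len: "t \<le> length l0" "t \<le> length l1" "t \<le> length l2"
    and sp': "spider c' l0' l1' l2'"
    and len': "2 * (n + 2) * t \<le> length l0'" "2 * (n + 2) * t \<le> length l1'" "2 * (n + 2) * t \<le> length l2'"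
    and disj: "sverts c l0 l1 l2 \<inter> sverts c' l0' l1' l2' = {}"
    and conn: "reach V c c'" "c \<in> V"
  shows "n \<le> card {y \<in> sverts c' l0' l1' l2'. E c y}"
proof -
  have "c \<in> sverts c l0 l1 l2" "c' \<in> sverts c' l0' l1' l2'" by (simp_all add: sverts_def)
  then obtain s rs s' where R: "is_path (s # rs @ [s'])" "s \<in> sverts c l0 l1 l2" "s' \<in> sverts c' l0' l1' l2'"
      "set rs \<inter> (sverts c l0 l1 l2 \<union> sverts c' l0' l1' l2') = {}"
    using path_set_to_set[OF conn(1,2) _ _ disj] by blast
  obtain hs m1 m2 where h: "spider c hs m1 m2" "last (c # hs) = s" "sverts c hs m1 m2 \<subseteq> sverts c l0 l1 l2"
      "t \<le> length m1" "t \<le> length m2"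
    using spider_head[OF sp len R(2)] by blast
  obtain tl where tl: "is_path (s' # tl)" "set (s' # tl) \<subseteq> sverts c' l0' l1' l2'"
      "2 * (n + 2) * t \<le> 2 * length (s' # tl)"
    using spider_tail[OF sp' len' R(3)] by blast
  define pre where "pre = hs @ rs"
  define leg where "leg = pre @ s' # tl"
  have subs: "set hs \<subseteq> sverts c l0 l1 l2" "c \<in> sverts c l0 l1 l2" "set m1 \<union> set m2 \<subseteq> sverts c l0 l1 l2"
    using h(3) by (auto simp: sverts_def)
  have "is_path (((c # hs) @ rs) @ (s' # tl))"
    unfolding is_path_append_iff[of _ "s' # tl"]
  proof (intro conjI)
    show "is_path (s' # tl)" by (rule tl)
    have rs: "is_path rs" "rs = [] \<or> E s (hd rs)" "E (last (s # rs)) s'"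
      using R(1) is_path_append_iff[of "s # rs" "[s']"] by (auto simp: is_path_Cons)
    have "is_path (c # hs)" using h(1) by (simp add: spider_def)
    then show "is_path ((c # hs) @ rs)"
      unfolding is_path_append_iff[of "c # hs"] using rs h(2) R(4) subs by auto
    show "set ((c # hs) @ rs) \<inter> set (s' # tl) = {}" using tl(2) R(4) subs disj by auto
    have "last ((c # hs) @ rs) = last (s # rs)" using h(2) by (cases rs) auto
    then show "(c # hs) @ rs = [] \<or> s' # tl = [] \<or> E (last ((c # hs) @ rs)) (hd (s' # tl))"
      using rs(3) by simp
  qed
  then have "is_path (c # leg)" by (simp add: leg_def pre_def)
  moreover have "set leg \<inter> (set m1 \<union> set m2) = {}"
  proof -
    have "set hs \<inter> (set m1 \<union> set m2) = {}" using h(1) by (auto simp: spider_def)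
    then show ?thesis using subs R(4) tl(2) disj by (auto simp: leg_def pre_def)
  qed
  ultimately have spl: "spider c leg m1 m2" using spider_leg0[OF h(1)] by blast
  define d where "d = b - 1"
  have d: "1 \<le> d" "d \<le> t" using b by (auto simp: d_def)
  \<comment> \<open>\<open>j0 * d\<close> is the first multiple of \<open>d\<close> beyond
    \<open>length pre\<close>, so all chosen positions lie inside the other spider.\<close>
  define j0 where "j0 = length pre div d + 1"
  have "length pre div d * d \<le> length pre" "length pre < length pre div d * d + d"
    using d mod_less_divisor[of d "length pre"] div_mult_mod_eq[of "length pre" d] by linarith+
  then have j0: "length pre < j0 * d" "j0 * d \<le> length pre + d" by (simp_all add: j0_def)
  have tlen: "n * t + 2 * t \<le> length (s' # tl)" using tl(3) by (simp add: algebra_simps)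
  have nd: "n * d \<le> n * t" using d by simp
  have idx: "j0 * d + x * d + t < length leg" if "x < n" for x
  proof -
    have "x * d + d = Suc x * d" by simp
    also have "\<dots> \<le> n * d" using that by (intro mult_le_mono) auto
    finally have "x * d + d \<le> n * t" using nd by linarith
    then have "j0 * d + x * d + t \<le> length pre + n * t + t" using j0(2) by linarith
    moreover have "n * t + t < length (s' # tl)" using tlen d by linarith
    ultimately show ?thesis by (simp add: leg_def)
  qed
  let ?f = "\<lambda>x. leg ! (j0 * d + x * d)"
  have inj: "inj_on ?f {..<n}"
  proof (rule inj_on_nth_lin[OF _ d(1)])
    show "distinct leg" using spl by (simp add: spider_def is_path_def)
    show "j0 * d + x * d < length leg" if "x < n" for x using idx[OF that] by linarith
  qed
  have "?f ` {..<n} \<subseteq> {y \<in> sverts c' l0' l1' l2'. E c y}"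
  proof
    fix y assume "y \<in> ?f ` {..<n}"
    then obtain x where x: "x < n" "y = leg ! (j0 * d + x * d)" by blast
    have "y = (s' # tl) ! (j0 * d + x * d - length pre)" using x(2) j0(1) by (simp add: leg_def nth_append)
    moreover have "j0 * d + x * d - length pre < length (s' # tl)"
      using idx[OF x(1)] j0(1) by (simp add: leg_def)
    ultimately have "y \<in> sverts c' l0' l1' l2'" using tl(2) nth_mem by (metis subsetD)
    moreover have "E c y"
      using leg_bad_jump[OF bad _ b(2) spl h(4,5), of "j0 + x"] b(1) idx[OF x(1)] x(2)
      by (simp add: d_def add_mult_distrib)
    ultimately show "y \<in> {y \<in> sverts c' l0' l1' l2'. E c y}" by simp
  qed
  then have "card (?f ` {..<n}) \<le> card {y \<in> sverts c' l0' l1' l2'. E c y}"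
    by (intro card_mono) (auto simp: finite_sverts)
  then show ?thesis using card_image[OF inj] by simp
qed

text \<open>All centres of long spiders have many neighbours in one fixed spider; by pigeonhole many of them
  have the same neighbours there.\<close>

lemma centre_bad_biclique:
  assumes bad: "leg_bad t 0 b" and b: "2 \<le> b" "b \<le> t"
    and conn: "\<And>x y. x \<in> V \<Longrightarrow> y \<in> V \<Longrightarrow> reach V x y"
    and m: "m = 2 * (n + 2) * t"
    and rich: "rich m (3 * m + 2 + n * 2 ^ (3 * m + 1))"
  shows "\<exists>A B. biclique n A B"
proof -
  obtain c' l0' l1' l2' where sp': "spider c' l0' l1' l2'" "sverts c' l0' l1' l2' \<subseteq> V"
      and len': "length l0' = m" "length l1' = m" "length l2' = m"
    using rich_spider[OF rich, of "{}"] unfolding spider_in_def by auto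
  define S where "S = sverts c' l0' l1' l2'"
  have S: "S \<subseteq> V" "finite S" "card S \<le> 3 * m + 1"
    using sp' len' card_sverts[of c' l0' l1' l2'] by (auto simp: S_def finite_sverts)
  have tm: "t \<le> m" unfolding m by (cases t) auto
  define P where "P = {x \<in> V. n \<le> card {y \<in> S. E x y}}"
  have finP: "finite P" "P \<subseteq> V" using finV by (auto simp: P_def)
  \<comment> \<open>Otherwise \<open>P\<close> could be deleted along with \<open>S\<close>, and the
    centre of a surviving spider would again belong to \<open>P\<close>. The power of 2 bounds the
    number of subsets of \<open>S\<close>, the classes of the pigeonhole argument.\<close>
  have "n * 2 ^ (3 * m + 1) < card P"
  proof (rule ccontr)
    assume "\<not> ?thesis"
    then have "card (S \<union> P) \<le> 3 * m + 2 + n * 2 ^ (3 * m + 1)" using card_Un_le[of S P] S by linarith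
    then have "spider_in (V - (S \<union> P)) m" using rich_spider[OF rich] S finP by auto
    then obtain c l0 l1 l2 where sp: "spider c l0 l1 l2" "sverts c l0 l1 l2 \<subseteq> V - (S \<union> P)"
        and len: "length l0 = m" "length l1 = m" "length l2 = m"
      unfolding spider_in_def by blast
    have c: "c \<in> V" "c \<notin> P" "c' \<in> V" using sp sp' by (auto simp: sverts_def)
    have "n \<le> card {y \<in> sverts c' l0' l1' l2'. E c y}"
    proof (rule centre_bad_neighbours[OF bad b sp(1) _ _ _ sp'(1)])
      show "sverts c l0 l1 l2 \<inter> sverts c' l0' l1' l2' = {}" using sp(2) S_def by blast
      show "reach V c c'" "c \<in> V" using conn c by auto
    qed (use len len' tm m in simp_all)
    then show False using c by (simp add: P_def S_def)
  qed
  moreover have "card (Pow S) \<le> 2 ^ (3 * m + 1)"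
    using S by (simp add: card_Pow del: power_Suc)
  then have "n * card (Pow S) \<le> n * 2 ^ (3 * m + 1)" by (rule mult_le_mono2)
  ultimately have "n * card (Pow S) < card P" by linarith
  moreover have "(\<lambda>x. {y \<in> S. E x y}) ` P \<subseteq> Pow S" by blast
  ultimately have "\<exists>T\<in>Pow S. n < card {x \<in> P. {y \<in> S. E x y} = T}"
    using S(2) by (intro pigeonhole_fibre finP) simp_all
  then obtain T where T: "T \<in> Pow S" "n < card {x \<in> P. {y \<in> S. E x y} = T}" by blast
  then have "{x \<in> P. {y \<in> S. E x y} = T} \<noteq> {}" by (metis card.empty not_less_zero)
  then have "n \<le> card T" by (auto simp: P_def)
  then obtain B where B: "B \<subseteq> T" "card B = n" "finite B" by (rule obtain_subset_with_card_n)
  have "n \<le> card {x \<in> P. {y \<in> S. E x y} = T}" using T(2) by simp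
  then obtain A where A: "A \<subseteq> {x \<in> P. {y \<in> S. E x y} = T}" "card A = n" "finite A"
    by (rule obtain_subset_with_card_n)
  have "biclique n A B" unfolding biclique_def using A B by auto
  then show ?thesis by blast
qed

section \<open>A bad pair in two spiders\<close>

text \<open>Greedy choice: a spider has at most \<open>3 * m + 1\<close> vertices, which join the
  deleted set before the next one is taken.\<close>

lemma disjoint_spiders:
  assumes rich: "rich m N" and Y: "Y \<subseteq> V" "card Y + k * (3 * m + 1) \<le> N"
  shows "\<exists>c l0 l1 l2. (\<forall>i<k. spider (c i) (l0 i) (l1 i) (l2 i) \<and> length (l0 i) = m \<and> length (l1 i) = m \<and>
       length (l2 i) = m \<and> sverts (c i) (l0 i) (l1 i) (l2 i) \<subseteq> V - Y) \<and>
     (\<forall>i<k. \<forall>j<k. i \<noteq> j \<longrightarrow> sverts (c i) (l0 i) (l1 i) (l2 i) \<inter> sverts (c j) (l0 j) (l1 j) (l2 j) = {})"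
  using Y(2)
proof (induction k)
  case 0
  then show ?case by simp
next
  case (Suc k)
  have "card Y + k * (3 * m + 1) \<le> N" using Suc.prems by simp
  then obtain c l0 l1 l2 where S: "\<And>i. i < k \<Longrightarrow> spider (c i) (l0 i) (l1 i) (l2 i) \<and> length (l0 i) = m \<and>
       length (l1 i) = m \<and> length (l2 i) = m \<and> sverts (c i) (l0 i) (l1 i) (l2 i) \<subseteq> V - Y"
     and disj: "\<And>i j. i < k \<Longrightarrow> j < k \<Longrightarrow> i \<noteq> j \<Longrightarrow> sverts (c i) (l0 i) (l1 i) (l2 i) \<inter> sverts (c j) (l0 j) (l1 j) (l2 j) = {}"
    using Suc.IH by blast
  define W where "W = (\<Union>i<k. sverts (c i) (l0 i) (l1 i) (l2 i))"
  have "card W \<le> (\<Sum>i<k. card (sverts (c i) (l0 i) (l1 i) (l2 i)))" unfolding W_def by (intro card_UN_le) simp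
  also have "\<dots> \<le> (\<Sum>i<k. 3 * m + 1)"
  proof (rule sum_mono)
    fix i assume "i \<in> {..<k}"
    then show "card (sverts (c i) (l0 i) (l1 i) (l2 i)) \<le> 3 * m + 1"
      using S[of i] card_sverts[of "c i" "l0 i" "l1 i" "l2 i"] by simp
  qed
  finally have "card W \<le> k * (3 * m + 1)" by simp
  then have "card (Y \<union> W) \<le> N" using card_Un_le[of Y W] Suc.prems by simp
  moreover have "Y \<union> W \<subseteq> V" using Y(1) S by (fastforce simp: W_def)
  ultimately have "spider_in (V - (Y \<union> W)) m" using rich_spider[OF rich] by blast
  then obtain c' l0' l1' l2' where n: "spider c' l0' l1' l2'" "sverts c' l0' l1' l2' \<subseteq> V - (Y \<union> W)"
      "length l0' = m" "length l1' = m" "length l2' = m" unfolding spider_in_def by blast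
  have nd: "sverts c' l0' l1' l2' \<inter> sverts (c i) (l0 i) (l1 i) (l2 i) = {}" if "i < k" for i
    using n(2) that by (auto simp: W_def)
  let ?c = "c(k := c')" and ?l0 = "l0(k := l0')" and ?l1 = "l1(k := l1')" and ?l2 = "l2(k := l2')"
  have 1: "\<forall>i<Suc k. spider (?c i) (?l0 i) (?l1 i) (?l2 i) \<and> length (?l0 i) = m \<and> length (?l1 i) = m \<and>
      length (?l2 i) = m \<and> sverts (?c i) (?l0 i) (?l1 i) (?l2 i) \<subseteq> V - Y"
  proof (intro allI impI)
    fix i assume "i < Suc k"
    then consider "i = k" | "i < k" by linarith
    then show "spider (?c i) (?l0 i) (?l1 i) (?l2 i) \<and> length (?l0 i) = m \<and> length (?l1 i) = m \<and>
      length (?l2 i) = m \<and> sverts (?c i) (?l0 i) (?l1 i) (?l2 i) \<subseteq> V - Y"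
      using n S[of i] by cases auto
  qed
  have 2: "\<forall>i<Suc k. \<forall>j<Suc k. i \<noteq> j \<longrightarrow>
      sverts (?c i) (?l0 i) (?l1 i) (?l2 i) \<inter> sverts (?c j) (?l0 j) (?l1 j) (?l2 j) = {}"
  proof (intro allI impI)
    fix i j assume ij: "i < Suc k" "j < Suc k" "i \<noteq> j"
    then consider "i = k" "j < k" | "i < k" "j = k" | "i < k" "j < k" by linarith
    then show "sverts (?c i) (?l0 i) (?l1 i) (?l2 i) \<inter> sverts (?c j) (?l0 j) (?l1 j) (?l2 j) = {}"
    proof cases
      case 1
      then show ?thesis using nd[of j] by simp
    next
      case 2
      then show ?thesis using nd[of i] by (simp add: Int_commute)
    next
      case 3
      then show ?thesis using disj[of i j] ij by simp
    qed
  qed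
  show ?case using 1 2 by (intro exI conjI)
qed

lemma two_spiders_badD:
  assumes "two_spiders_bad t a b"
    and "spider c l0 l1 l2" "t \<le> length l0" "t \<le> length l1" "t \<le> length l2"
    and "spider c' l0' l1' l2'" "t \<le> length l0'" "t \<le> length l1'" "t \<le> length l2'"
    and "sverts c l0 l1 l2 \<inter> sverts c' l0' l1' l2' = {}"
  shows "E ((c # l0) ! a) ((c' # l0') ! b)"
  using assms unfolding two_spiders_bad_def by blast

text \<open>Of \<open>2 * n\<close> disjoint spiders the first \<open>n\<close> contribute their
  vertices at level \<open>a\<close>, the others those at level \<open>b\<close>; any two spiders
  from different groups are an instance of the bad pair.\<close>

lemma two_spiders_bad_biclique:
  assumes bad: "two_spiders_bad t a b" and ab: "a \<le> t" "b \<le> t"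
    and rich: "rich t (2 * n * (3 * t + 1))"
  shows "\<exists>A B. biclique n A B"
proof -
  have "\<exists>c l0 l1 l2. (\<forall>i<2 * n. spider (c i) (l0 i) (l1 i) (l2 i) \<and> length (l0 i) = t \<and> length (l1 i) = t \<and>
       length (l2 i) = t \<and> sverts (c i) (l0 i) (l1 i) (l2 i) \<subseteq> V - {}) \<and>
     (\<forall>i<2 * n. \<forall>j<2 * n. i \<noteq> j \<longrightarrow> sverts (c i) (l0 i) (l1 i) (l2 i) \<inter> sverts (c j) (l0 j) (l1 j) (l2 j) = {})"
    by (rule disjoint_spiders[OF rich]) simp_all
  then obtain c l0 l1 l2 where S: "\<forall>i<2 * n. spider (c i) (l0 i) (l1 i) (l2 i) \<and> length (l0 i) = t \<and>
       length (l1 i) = t \<and> length (l2 i) = t \<and> sverts (c i) (l0 i) (l1 i) (l2 i) \<subseteq> V - {}"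
     and disj: "\<forall>i<2 * n. \<forall>j<2 * n. i \<noteq> j \<longrightarrow>
        sverts (c i) (l0 i) (l1 i) (l2 i) \<inter> sverts (c j) (l0 j) (l1 j) (l2 j) = {}"
    by (elim exE conjE)
  have inj: "i = j" if "i < 2 * n" "j < 2 * n" "k \<le> t" "(c i # l0 i) ! k = (c j # l0 j) ! k" for i j k
  proof (rule ccontr)
    assume "i \<noteq> j"
    moreover have "(c i # l0 i) ! k \<in> sverts (c i) (l0 i) (l1 i) (l2 i)" "(c j # l0 j) ! k \<in> sverts (c j) (l0 j) (l1 j) (l2 j)"
      using S that(1-3) by (auto intro!: nth_sverts)
    ultimately show False using disj that by auto
  qed
  show ?thesis
  proof (rule bicliqueI)
    show "inj_on (\<lambda>i. (c i # l0 i) ! a) {..<n}" using inj ab by (intro inj_onI) force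
    show "inj_on (\<lambda>i. (c (n + i) # l0 (n + i)) ! b) {..<n}"
    proof (rule inj_onI)
      fix x y assume "x \<in> {..<n}" "y \<in> {..<n}" "(c (n + x) # l0 (n + x)) ! b = (c (n + y) # l0 (n + y)) ! b"
      then show "x = y" using inj[of "n + x" "n + y" b] ab by auto
    qed
    fix x y assume xy: "x < n" "y < n"
    have "sverts (c x) (l0 x) (l1 x) (l2 x) \<inter> sverts (c (n + y)) (l0 (n + y)) (l1 (n + y)) (l2 (n + y)) = {}"
      using xy by (intro disj[rule_format]) auto
    then show "E ((c x # l0 x) ! a) ((c (n + y) # l0 (n + y)) ! b)"
      using S[rule_format, of x] S[rule_format, of "n + y"] xy
      by (intro two_spiders_badD[OF bad, of _ _ "l1 x" "l2 x" _ _ "l1 (n + y)" "l2 (n + y)"]) auto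
  qed
qed

end

section \<open>Embedding two spiders into cliques and bicliques\<close>

text \<open>Position \<open>(j, i, k)\<close> is level \<open>k\<close> on leg \<open>i\<close> of the spider number \<open>j\<close>; centres are \<open>(j, 0, 0)\<close>.\<close>

definition positions :: "nat \<Rightarrow> (nat \<times> nat \<times> nat) set" where
  "positions t = {(j, i, k). j < 2 \<and> i < 3 \<and> k \<le> t \<and> (k = 0 \<longrightarrow> i = 0)}"

text \<open>\<open>6 * t + 6\<close> is \<open>2 * 3 * (t + 1)\<close>, which counts each centre
  once per leg; it is the size that \<open>host\<close> demands of each side.\<close>

lemma finite_positions: "finite (positions t)" and card_positions: "card (positions t) \<le> 6 * t + 6"
proof -
  have s: "positions t \<subseteq> {..<2} \<times> {..<3} \<times> {..t}" by (auto simp: positions_def)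
  show "finite (positions t)" by (rule finite_subset[OF s]) simp
  have "card (positions t) \<le> card ({..<2::nat} \<times> {..<3::nat} \<times> {..t})" by (rule card_mono[OF _ s]) simp
  then show "card (positions t) \<le> 6 * t + 6" by (simp add: card_cartesian_product)
qed

lemma extend_inj:
  fixes g :: "'i \<Rightarrow> 'v"
  assumes fin: "finite I" and I0: "I0 \<subseteq> I" "inj_on g I0"
    and Side: "\<And>p. p \<in> I - I0 \<Longrightarrow> card I \<le> card (Side p)"
  shows "\<exists>f. inj_on f I \<and> (\<forall>p\<in>I0. f p = g p) \<and> (\<forall>p\<in>I - I0. f p \<in> Side p)"
proof -
  have "\<exists>f. inj_on f (I0 \<union> J) \<and> (\<forall>p\<in>I0. f p = g p) \<and> (\<forall>p\<in>J. f p \<in> Side p)"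
    if "finite J" "J \<subseteq> I - I0" for J
    using that
  proof (induction J rule: finite_induct)
    case empty
    then show ?case using I0 by auto
  next
    case (insert q J)
    then obtain f where f: "inj_on f (I0 \<union> J)" "\<forall>p\<in>I0. f p = g p" "\<forall>p\<in>J. f p \<in> Side p" by auto
    have q: "q \<in> I - I0" "q \<notin> I0 \<union> J" using insert by auto
    have "I0 \<union> J \<subset> I" using insert.prems q I0(1) by auto
    then have "card (I0 \<union> J) < card I" using fin by (intro psubset_card_mono)
    moreover have "card (f ` (I0 \<union> J)) \<le> card (I0 \<union> J)"
      using fin insert.hyps(1) I0(1) by (intro card_image_le) (auto intro: finite_subset)
    ultimately have "card (f ` (I0 \<union> J)) < card (Side q)" using Side[OF q(1)] by linarith
    then have "\<not> Side q \<subseteq> f ` (I0 \<union> J)"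
      using fin insert.hyps(1) I0(1) card_mono[of "f ` (I0 \<union> J)" "Side q"]
      by (meson finite_UnI finite_imageI finite_subset not_less)
    then obtain v where v: "v \<in> Side q" "v \<notin> f ` (I0 \<union> J)" by blast
    have eq: "(f(q := v)) p = f p" if "p \<in> I0 \<union> J" for p using that q(2) by auto
    have "inj_on (f(q := v)) (I0 \<union> J)" using f(1) v(2) by (rule inj_on_fun_updI)
    moreover have "(f(q := v)) q \<notin> (f(q := v)) ` (I0 \<union> J - {q})" using v(2) q(2) by auto
    ultimately have "inj_on (f(q := v)) (I0 \<union> insert q J)"
      unfolding Un_insert_right inj_on_insert by (rule conjI)
    moreover have "\<forall>p\<in>I0. (f(q := v)) p = g p" using f(2) q(2) by auto
    moreover have "\<forall>p\<in>insert q J. (f(q := v)) p \<in> Side p" using f(3) v(1) by auto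
    ultimately show ?case by blast
  qed
  from this[of "I - I0"] fin I0(1) show ?thesis by (auto simp: Un_absorb1)
qed

context ugraph
begin

text \<open>\<open>(j, 0, 0)\<close> is the only position of spider \<open>j\<close> at level 0,
  hence the case distinction for the predecessor of level 1.\<close>

definition embed :: "(nat \<times> nat \<times> nat \<Rightarrow> 'a) \<Rightarrow> nat \<Rightarrow> bool" where
  "embed f t \<longleftrightarrow> inj_on f (positions t) \<and>
     (\<forall>j i k. (j, i, Suc k) \<in> positions t \<longrightarrow> E (f (j, if k = 0 then 0 else i, k)) (f (j, i, Suc k)))"

definition embed_leg :: "(nat \<times> nat \<times> nat \<Rightarrow> 'a) \<Rightarrow> nat \<Rightarrow> nat \<Rightarrow> nat \<Rightarrow> 'a list" where
  "embed_leg f t j i = map (\<lambda>k. f (j, i, k)) [1..<Suc t]"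

lemma length_embed_leg: "length (embed_leg f t j i) = t"
  by (simp add: embed_leg_def)

lemma embed_leg_nth: "k \<le> t \<Longrightarrow> (f (j, 0, 0) # embed_leg f t j i) ! k = f (j, if k = 0 then 0 else i, k)"
  by (cases k) (simp_all add: embed_leg_def del: upt_Suc)

lemma set_embed_leg: "set (embed_leg f t j i) = (\<lambda>k. f (j, i, k)) ` {1..t}"
  by (auto simp: embed_leg_def)

lemma embed_spider:
  assumes f: "embed f t" and j: "j < 2"
  shows "spider (f (j, 0, 0)) (embed_leg f t j 0) (embed_leg f t j 1) (embed_leg f t j 2)"
proof -
  have inj: "inj_on f (positions t)" using f by (simp add: embed_def)
  have path: "is_path (f (j, 0, 0) # embed_leg f t j i)" if i: "i < 3" for i
    unfolding is_path_def
  proof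
    have "inj_on (\<lambda>k. f (j, i, k)) {1..t}"
    proof (rule inj_onI)
      fix k l assume "k \<in> {1..t}" "l \<in> {1..t}" "f (j, i, k) = f (j, i, l)"
      then have "(j, i, k) = (j, i, l)" using inj_onD[OF inj] i j by (auto simp: positions_def)
      then show "k = l" by simp
    qed
    moreover have "set [1..<Suc t] = {1..t}" by auto
    ultimately have "distinct (embed_leg f t j i)"
      unfolding embed_leg_def distinct_map by (simp del: upt_Suc)
    moreover have "f (j, 0, 0) \<noteq> f (j, i, k)" if "k \<in> {1..t}" for k
    proof
      assume eq: "f (j, 0, 0) = f (j, i, k)"
      have "(j, 0, 0) \<in> positions t" "(j, i, k) \<in> positions t" using i j that by (auto simp: positions_def)
      then have "(j, 0, 0) = (j, i, k)" using inj_onD[OF inj eq] by blast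
      then show False using that by simp
    qed
    then have "f (j, 0, 0) \<notin> set (embed_leg f t j i)" unfolding set_embed_leg by blast
    ultimately show "distinct (f (j, 0, 0) # embed_leg f t j i)" by simp
    show "successively E (f (j, 0, 0) # embed_leg f t j i)"
      unfolding successively_conv_nth
    proof (intro allI impI)
      fix k assume "Suc k < length (f (j, 0, 0) # embed_leg f t j i)"
      then have k: "Suc k \<le> t" by (simp add: length_embed_leg)
      then have "(j, i, Suc k) \<in> positions t" using i j by (simp add: positions_def)
      then have "E (f (j, if k = 0 then 0 else i, k)) (f (j, i, Suc k))" using f by (simp add: embed_def)
      then show "E ((f (j, 0, 0) # embed_leg f t j i) ! k) ((f (j, 0, 0) # embed_leg f t j i) ! Suc k)"
        using embed_leg_nth[of k t f j i] embed_leg_nth[of "Suc k" t f j i] k by simp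
    qed
  qed
  have disj: "set (embed_leg f t j i) \<inter> set (embed_leg f t j i') = {}" if i: "i < 3" "i' < 3" "i \<noteq> i'" for i i'
  proof -
    have "f (j, i, k) \<noteq> f (j, i', k')" if "k \<in> {1..t}" "k' \<in> {1..t}" for k k'
    proof
      assume "f (j, i, k) = f (j, i', k')"
      then have "(j, i, k) = (j, i', k')" using inj_onD[OF inj] i j that by (auto simp: positions_def)
      then show False using i by simp
    qed
    then show ?thesis unfolding set_embed_leg by blast
  qed
  show ?thesis unfolding spider_def using path disj by simp
qed

lemma embed_disjoint:
  assumes "embed f t"
  shows "sverts (f (0, 0, 0)) (embed_leg f t 0 0) (embed_leg f t 0 1) (embed_leg f t 0 2) \<inter>
     sverts (f (1, 0, 0)) (embed_leg f t 1 0) (embed_leg f t 1 1) (embed_leg f t 1 2) = {}"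
proof -
  have inj: "inj_on f (positions t)" using assms by (simp add: embed_def)
  have s: "sverts (f (j, 0, 0)) (embed_leg f t j 0) (embed_leg f t j 1) (embed_leg f t j 2) \<subseteq> f ` {p \<in> positions t. fst p = j}"
    if "j < 2" for j
    using that by (auto simp: sverts_def set_embed_leg positions_def)
  have a: "f ` {p \<in> positions t. fst p = 0} \<inter> f ` {p \<in> positions t. fst p = 1} = {}"
    using inj_on_image_Int[OF inj, of "{p \<in> positions t. fst p = 0}" "{p \<in> positions t. fst p = 1}"] by auto
  have b: "sverts (f (0, 0, 0)) (embed_leg f t 0 0) (embed_leg f t 0 1) (embed_leg f t 0 2) \<subseteq> f ` {p \<in> positions t. fst p = 0}"
    by (rule s) simp
  have c: "sverts (f (1, 0, 0)) (embed_leg f t 1 0) (embed_leg f t 1 1) (embed_leg f t 1 2) \<subseteq> f ` {p \<in> positions t. fst p = 1}"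
    by (rule s) simp
  show ?thesis using Int_mono[OF b c] unfolding a by (rule subset_empty[THEN iffD1])
qed

lemma leg_badD:
  assumes "leg_bad t a b" "spider c l0 l1 l2" "t \<le> length l0" "t \<le> length l1" "t \<le> length l2"
  shows "E ((c # l0) ! a) ((c # l0) ! b)"
  using assms unfolding leg_bad_def by blast

lemma two_legs_badD:
  assumes "two_legs_bad t a b" "spider c l0 l1 l2" "t \<le> length l0" "t \<le> length l1" "t \<le> length l2"
  shows "E ((c # l0) ! a) ((c # l1) ! b)"
  using assms unfolding two_legs_bad_def by blast

lemma leg_bad_embed:
  assumes "leg_bad t a b" "embed f t" "a \<le> t" "b \<le> t"
  shows "E (f (0, 0, a)) (f (0, 0, b))"
proof -
  have "E ((f (0, 0, 0) # embed_leg f t 0 0) ! a) ((f (0, 0, 0) # embed_leg f t 0 0) ! b)"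
    by (rule leg_badD[OF assms(1) embed_spider[OF assms(2)]]) (simp_all add: length_embed_leg)
  then show ?thesis using embed_leg_nth[of a t f 0 0] embed_leg_nth[of b t f 0 0] assms(3,4) by (simp split: if_splits)
qed

lemma two_legs_bad_embed:
  assumes "two_legs_bad t a b" "embed f t" "1 \<le> a" "a \<le> t" "1 \<le> b" "b \<le> t"
  shows "E (f (0, 0, a)) (f (0, 1, b))" "E (f (0, 1, a)) (f (0, 0, b))"
proof -
  have sp: "spider (f (0, 0, 0)) (embed_leg f t 0 0) (embed_leg f t 0 1) (embed_leg f t 0 2)"
    using embed_spider[OF assms(2), of 0] by simp
  have "E ((f (0, 0, 0) # embed_leg f t 0 0) ! a) ((f (0, 0, 0) # embed_leg f t 0 1) ! b)"
    by (rule two_legs_badD[OF assms(1) sp]) (simp_all add: length_embed_leg)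
  then show "E (f (0, 0, a)) (f (0, 1, b))"
    using embed_leg_nth[of a t f 0 0] embed_leg_nth[of b t f 0 1] assms(3-) by simp
  have "E ((f (0, 0, 0) # embed_leg f t 0 1) ! a) ((f (0, 0, 0) # embed_leg f t 0 0) ! b)"
    by (rule two_legs_badD[OF assms(1) spider_swap01[OF sp]]) (simp_all add: length_embed_leg)
  then show "E (f (0, 1, a)) (f (0, 0, b))"
    using embed_leg_nth[of a t f 0 1] embed_leg_nth[of b t f 0 0] assms(3-) by simp
qed

lemma two_spiders_bad_sym: "two_spiders_bad t a b \<Longrightarrow> two_spiders_bad t b a"
  unfolding two_spiders_bad_def[of t b a]
proof (intro allI impI, elim conjE)
  fix c l0 l1 l2 c' l0' l1' l2'
  assume bad: "two_spiders_bad t a b"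
    and *: "spider c l0 l1 l2" "t \<le> length l0" "t \<le> length l1" "t \<le> length l2"
      "spider c' l0' l1' l2'" "t \<le> length l0'" "t \<le> length l1'" "t \<le> length l2'"
      "sverts c l0 l1 l2 \<inter> sverts c' l0' l1' l2' = {}"
  have "sverts c' l0' l1' l2' \<inter> sverts c l0 l1 l2 = {}" using *(9) by blast
  then show "E ((c # l0) ! b) ((c' # l0') ! a)" by (rule E_sym[OF two_spiders_badD[OF bad *(5-8,1-4)]])
qed

lemma two_spiders_bad_embed:
  assumes "two_spiders_bad t a b" "embed f t" "a \<le> t" "b \<le> t"
  shows "E (f (0, 0, a)) (f (1, 0, b))"
proof -
  have "E ((f (0, 0, 0) # embed_leg f t 0 0) ! a) ((f (1, 0, 0) # embed_leg f t 1 0) ! b)"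
    by (rule two_spiders_badD[OF assms(1) embed_spider[OF assms(2)] _ _ _ embed_spider[OF assms(2)]])
      (use embed_disjoint[OF assms(2)] in \<open>simp_all add: length_embed_leg\<close>)
  then show ?thesis using embed_leg_nth[of a t f 0 0] embed_leg_nth[of b t f 1 0] assms(3,4) by (simp split: if_splits)
qed

section \<open>Hosts, direct embeddings and ears\<close>

text \<open>Covers both structures: a biclique with an independent side, and a clique as
  \<open>A = B\<close>, for which the guard \<open>x \<noteq> y\<close> is there. Either side alone
  has room for both spiders.\<close>

definition host :: "nat \<Rightarrow> 'a set \<Rightarrow> 'a set \<Rightarrow> bool" where
  "host t A B \<longleftrightarrow> 6 * t + 6 \<le> card A \<and> 6 * t + 6 \<le> card B \<and> (\<forall>x\<in>A. \<forall>y\<in>B. x \<noteq> y \<longrightarrow> E x y)"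

text \<open>Levels alternate between the sides. The shift \<open>s j\<close> may differ for the two
  spiders because no edge joins them, so parity constrains only pairs within one spider.\<close>

lemma embed_direct:
  assumes H: "host t A B"
  shows "\<exists>f. embed f t \<and> (\<forall>j i k. (j, i, k) \<in> positions t \<longrightarrow> f (j, i, k) \<in> (if even (k + s j) then A else B))"
proof -
  let ?S = "\<lambda>(j, i, k). if even (k + s j) then A else B"
  have "\<exists>f. inj_on f (positions t) \<and> (\<forall>p\<in>{}. f p = undefined p) \<and> (\<forall>p\<in>positions t - {}. f p \<in> ?S p)"
  proof (rule extend_inj[OF finite_positions])
    show "card (positions t) \<le> card (?S p)" if "p \<in> positions t - {}" for p
      using H card_positions[of t] unfolding host_def by (cases p) auto
  qed simp_all
  then obtain f where f: "inj_on f (positions t)" "\<And>p. p \<in> positions t \<Longrightarrow> f p \<in> ?S p"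
    unfolding Diff_empty by blast
  have fS: "f (j, i, k) \<in> (if even (k + s j) then A else B)" if "(j, i, k) \<in> positions t" for j i k
    using f(2)[OF that] by simp
  have "E (f (j, if k = 0 then 0 else i, k)) (f (j, i, Suc k))" if p: "(j, i, Suc k) \<in> positions t" for j i k
  proof -
    have q: "(j, if k = 0 then 0 else i, k) \<in> positions t" using p by (auto simp: positions_def)
    have "f (j, if k = 0 then 0 else i, k) \<noteq> f (j, i, Suc k)" using inj_onD[OF f(1) _ q p] by auto
    then show ?thesis using fS[OF p] fS[OF q] H E_sym unfolding host_def by (auto split: if_splits)
  qed
  then show ?thesis using f(1) fS unfolding embed_def by (intro exI[of _ f]) blast
qed

text \<open>Level \<open>b\<close> of the first leg goes to a vertex \<open>w\<close> outside the host; the leg then leaves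
  \<open>w\<close> along an ear and returns to the host at \<open>a2\<close>, where the parities are reset.\<close>

lemma embed_ear:
  assumes H: "host t A B" and b: "1 \<le> b" "b \<le> t"
    and es: "is_path (es @ [a2])" "es \<noteq> []" "set es \<inter> (A \<union> B) = {}" "a2 \<in> A \<union> B"
    and a1: "a1 \<in> A" "E (hd es) a1" "a1 \<noteq> a2"
    and y: "(jy, iy, ky) \<in> positions t" "\<not> (jy = 0 \<and> iy = 0 \<and> b \<le> Suc ky)"
    and v: "v \<in> (if odd (ky + b) then A else B)" "v \<noteq> a1" "v \<noteq> a2"
  shows "\<exists>f. embed f t \<and> f (0, 0, b) = hd es \<and> f (jy, iy, ky) = v"
proof -
  \<comment> \<open>Laid along the first leg: \<open>a1\<close> at level \<open>b - 1\<close>,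
    \<open>hd es\<close> at level \<open>b\<close>, \<open>a2\<close> at level \<open>b + r\<close>.
    Level \<open>k\<close> thus reads entry \<open>Suc k - b\<close>, and whatever would exceed
    level \<open>t\<close> is cut off.\<close>
  define P where "P = a1 # es @ [a2]"
  define r where "r = length es"
  have lP: "length P = r + 2" by (simp add: P_def r_def)
  have pathP: "is_path P"
    unfolding P_def is_path_Cons using es a1 E_sym by auto
  have vP: "v \<notin> set P" using v es(3) by (auto simp: P_def split: if_splits)
  define g where "g = (\<lambda>(j::nat, i::nat, k). if (j, i, k) = (jy, iy, ky) then v else P ! (Suc k - b))"
  define J where "J = {(0::nat, 0::nat, k) | k. b \<le> Suc k \<and> k \<le> t \<and> Suc k - b < r + 2}"
  define I0 where "I0 = insert (jy, iy, ky) J"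
  have yJ: "(jy, iy, ky) \<notin> J" using y(2) by (auto simp: J_def)
  have gJ: "g (0, 0, k) = P ! (Suc k - b)" if "(0, 0, k) \<in> J" for k
    using that yJ by (auto simp: g_def)
  have injg: "inj_on g I0"
    unfolding I0_def inj_on_insert
  proof
    show "inj_on g J"
    proof (rule inj_onI)
      fix p q assume pq: "p \<in> J" "q \<in> J" "g p = g q"
      then obtain k l where k: "p = (0, 0, k)" "q = (0, 0, l)" "b \<le> Suc k" "b \<le> Suc l"
          "Suc k - b < r + 2" "Suc l - b < r + 2" by (auto simp: J_def)
      then have "P ! (Suc k - b) = P ! (Suc l - b)" using pq gJ by simp
      then have "Suc k - b = Suc l - b" using pathP k lP by (simp add: is_path_def nth_eq_iff_index_eq)
      then show "p = q" using k by simp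
    qed
    have "g p \<in> set P" if "p \<in> J" for p
    proof -
      from that obtain k where k: "p = (0, 0, k)" "Suc k - b < r + 2" by (auto simp: J_def)
      then show ?thesis using gJ[of k] that lP by simp
    qed
    moreover have "g (jy, iy, ky) = v" by (simp add: g_def)
    ultimately show "g (jy, iy, ky) \<notin> g ` (J - {(jy, iy, ky)})" using vP by auto
  qed
  have I0sub: "I0 \<subseteq> positions t" using y(1) by (auto simp: I0_def J_def positions_def)
  \<comment> \<open>\<open>S0\<close> puts level \<open>b - 1\<close> into \<open>A\<close>, where
    \<open>a1\<close> is, and serves all positions off the ear's leg as well. \<open>S1\<close>
    restarts the alternation at level \<open>b + r\<close> on the side of \<open>a2\<close>.\<close>
  define S0 where "S0 k = (if odd (k + b) then A else B)" for k
  define S1 where "S1 k = (if even (k + b + r) = (a2 \<in> A) then A else B)" for k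
  define Side where "Side = (\<lambda>(j::nat, i::nat, k). if j = 0 \<and> i = 0 \<and> b \<le> k then S1 k else S0 k)"
  have "\<exists>f. inj_on f (positions t) \<and> (\<forall>p\<in>I0. f p = g p) \<and> (\<forall>p\<in>positions t - I0. f p \<in> Side p)"
  proof (rule extend_inj[OF finite_positions I0sub injg])
    show "card (positions t) \<le> card (Side p)" if "p \<in> positions t - I0" for p
      using H card_positions[of t] unfolding host_def Side_def S0_def S1_def by (cases p) auto
  qed
  then obtain f where f: "inj_on f (positions t)" "\<And>p. p \<in> I0 \<Longrightarrow> f p = g p"
      "\<And>p. p \<in> positions t \<Longrightarrow> p \<notin> I0 \<Longrightarrow> f p \<in> Side p" by auto
  have fJ: "f (0, 0, k) = P ! (Suc k - b)" if "b \<le> Suc k" "k \<le> t" "Suc k - b < r + 2" for k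
  proof -
    have "(0, 0, k) \<in> J" using that by (auto simp: J_def)
    then show ?thesis using gJ f(2) by (simp add: I0_def)
  qed
  have cross: "E x z" if "x \<in> A \<and> z \<in> B \<or> x \<in> B \<and> z \<in> A" "x \<noteq> z" for x z
    using H that unfolding host_def by (auto intro: E_sym)
  have fS0: "f (j, i, k) \<in> S0 k" if p: "(j, i, k) \<in> positions t" and n: "\<not> (j = 0 \<and> i = 0 \<and> b \<le> k)" for j i k
  proof (cases "(j, i, k) \<in> I0")
    case False
    then show ?thesis using f(3)[OF p] n by (auto simp: Side_def)
  next
    case True
    then consider "(j, i, k) = (jy, iy, ky)" | "(j, i, k) \<in> J" by (auto simp: I0_def)
    then show ?thesis
    proof cases
      case 1
      then show ?thesis using f(2)[OF True] v(1) by (simp add: g_def S0_def)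
    next
      case 2
      then have "j = 0" "i = 0" "Suc k = b" using n by (auto simp: J_def)
      then show ?thesis using fJ[of k] a1(1) b by (auto simp: P_def S0_def)
    qed
  qed
  have fS1: "f (0, 0, k) \<in> S1 k" if k: "b + r \<le> k" "k \<le> t" for k
  proof (cases "k = b + r")
    case True
    then have "f (0, 0, k) = P ! (Suc r)" using fJ[of k] k by (simp add: Suc_diff_le)
    also have "\<dots> = a2" by (simp add: P_def r_def)
    finally show ?thesis using es(4) True by (auto simp: S1_def)
  next
    case False
    then have "(0, 0, k) \<notin> I0" using k y(2) by (auto simp: I0_def J_def)
    moreover have "(0, 0, k) \<in> positions t" using k by (simp add: positions_def)
    ultimately show ?thesis using f(3)[of "(0, 0, k)"] k by (simp add: Side_def)
  qed
  have "E (f (j, if k = 0 then 0 else i, k)) (f (j, i, Suc k))" if p: "(j, i, Suc k) \<in> positions t" for j i k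
  proof -
    have q: "(j, if k = 0 then 0 else i, k) \<in> positions t" using p by (auto simp: positions_def)
    have ne: "f (j, if k = 0 then 0 else i, k) \<noteq> f (j, i, Suc k)" using inj_onD[OF f(1) _ q p] by auto
    have kt: "Suc k \<le> t" using p by (simp add: positions_def)
    show ?thesis
    proof (cases "j = 0 \<and> i = 0 \<and> b \<le> Suc k")
      case True
      then have e: "(j, if k = 0 then 0 else i, k) = (0, 0, k)" "(j, i, Suc k) = (0, 0, Suc k)" by auto
      have "E (f (0, 0, k)) (f (0, 0, Suc k))"
      proof (cases "Suc (Suc k) - b < r + 2")
        case True': True
        then have "f (0, 0, k) = P ! (Suc k - b)" "f (0, 0, Suc k) = P ! (Suc (Suc k - b))"
          using fJ[of k] fJ[of "Suc k"] True kt by (simp_all add: Suc_diff_le)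
        then show ?thesis using is_path_nth[OF pathP, of "Suc k - b"] True True' lP by (simp add: Suc_diff_le)
      next
        case False
        then have "b + r \<le> k" using True by simp
        then have "f (0, 0, k) \<in> S1 k" "f (0, 0, Suc k) \<in> S1 (Suc k)" using fS1 kt by auto
        then show ?thesis using ne[unfolded e] by (intro cross) (auto simp: S1_def split: if_splits)
      qed
      then show ?thesis unfolding e .
    next
      case False
      then have "f (j, i, Suc k) \<in> S0 (Suc k)" using fS0[OF p] by simp
      moreover have "f (j, if k = 0 then 0 else i, k) \<in> S0 k" using False b by (intro fS0[OF q]) auto
      ultimately show ?thesis using ne by (intro cross) (auto simp: S0_def split: if_splits)
    qed
  qed
  then have "embed f t" using f(1) by (auto simp: embed_def)
  moreover have "f (0, 0, b) = hd es" using fJ[of b] b es(2) by (cases es) (auto simp: P_def Suc_diff_le r_def)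
  moreover have "f (jy, iy, ky) = v" using f(2) by (simp add: I0_def g_def)
  ultimately show ?thesis by blast
qed

text \<open>A path from \<open>w\<close> to \<open>v\<close> avoiding \<open>a1\<close> is followed
  until it first meets the host. If it ends at the only non-neighbour of \<open>w\<close> in
  \<open>Z\<close>, then \<open>w\<close> is adjacent to a third vertex of \<open>Z\<close>; that
  single edge is taken as the ear instead, and \<open>v\<close> stays free.\<close>

lemma ear_exists:
  assumes w: "w \<in> V" "w \<notin> A \<union> B" "E w a1" and a1: "a1 \<in> A"
    and v: "v \<in> Z" "v \<noteq> a1" "\<not> E w v" and Z: "Z \<subseteq> A \<union> B" "3 \<le> card Z" and AB: "A \<union> B \<subseteq> V"
    and conn: "\<And>x y. x \<in> V - {a1} \<Longrightarrow> y \<in> V - {a1} \<Longrightarrow> reach (V - {a1}) x y"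
  shows "\<exists>es a2 v'. is_path (es @ [a2]) \<and> es \<noteq> [] \<and> hd es = w \<and> set es \<inter> (A \<union> B) = {} \<and>
     a2 \<in> A \<union> B \<and> a1 \<noteq> a2 \<and> v' \<in> Z \<and> v' \<noteq> a1 \<and> v' \<noteq> a2 \<and> \<not> E w v'"
proof -
  have w1: "w \<in> V - {a1}" using w(1,2) a1 by auto
  have v1: "v \<in> V - {a1}" "v \<in> (A \<union> B) - {a1}" using v Z AB by auto
  obtain xs s where xs: "is_path (xs @ [s])" "hd (xs @ [s]) = w" "set (xs @ [s]) \<subseteq> V - {a1}"
      "s \<in> (A \<union> B) - {a1}" "set xs \<inter> ((A \<union> B) - {a1}) = {}"
    using path_to_set[OF conn[OF w1 v1(1)] w1 v1(2)] by blast
  have x0: "xs \<noteq> []" "hd xs = w" using xs w(2) by (auto simp: hd_append split: if_splits)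
  have x1: "set xs \<inter> (A \<union> B) = {}" using xs(3,5) by auto
  show ?thesis
  proof (cases "\<exists>v'\<in>Z. v' \<noteq> a1 \<and> v' \<noteq> s \<and> \<not> E w v'")
    case True
    then obtain v' where "v' \<in> Z" "v' \<noteq> a1" "v' \<noteq> s" "\<not> E w v'" by blast
    then show ?thesis using xs x0 x1 by (intro exI[of _ xs] exI[of _ s] exI[of _ v']) auto
  next
    case False
    then have s: "s = v" using v by blast
    have "\<not> Z \<subseteq> {a1, v}"
    proof
      assume "Z \<subseteq> {a1, v}"
      then have "card Z \<le> card {a1, v}" by (intro card_mono) auto
      also have "\<dots> \<le> 2" using v(2) by simp
      finally show False using Z(2) by simp
    qed
    then obtain z where z: "z \<in> Z" "z \<noteq> a1" "z \<noteq> v" by blast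
    then have "E w z" using False s by blast
    then have "is_path ([w] @ [z])" using E_irrefl by (auto simp: is_path_def)
    then show ?thesis using w z v Z(1) by (intro exI[of _ "[w]"] exI[of _ z] exI[of _ v]) auto
  qed
qed

section \<open>Refuting badness with an independent side\<close>

text \<open>The kinds of non-adjacent pairs in the forest: levels at distance at least 2 on one leg
  (the centre being level 0), positive levels on two legs, any levels in two spiders. By symmetry
  \<open>a \<le> b\<close> is no loss.\<close>

definition bad :: "nat \<Rightarrow> bool" where
  "bad t \<longleftrightarrow> (\<exists>a b. a + 2 \<le> b \<and> b \<le> t \<and> leg_bad t a b) \<or>
     (\<exists>a b. 1 \<le> a \<and> a \<le> b \<and> b \<le> t \<and> two_legs_bad t a b) \<or>
     (\<exists>a b. a \<le> b \<and> b \<le> t \<and> two_spiders_bad t a b)"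

definition clique_on :: "'a set \<Rightarrow> bool" where
  "clique_on K \<longleftrightarrow> (\<forall>x\<in>K. \<forall>y\<in>K. x \<noteq> y \<longrightarrow> E x y)"

text \<open>The parameters of \<open>rich\<close> are sums of what the single cases need. The
  one-leg case is split at \<open>a = 0\<close>, where recentring at level \<open>a\<close> would
  change nothing.\<close>

lemma bad_biclique:
  assumes "bad t" and conn: "\<And>x y. x \<in> V \<Longrightarrow> y \<in> V \<Longrightarrow> reach V x y"
    and m1: "m1 = 2 * (n + 2) * t"
    and rich: "rich ((2 * n + 2 * t + 2) * t + m1 + (4 * n * t * t + t))
       ((3 * m1 + 2 + n * 2 ^ (3 * m1 + 1)) + 2 * n * (3 * t + 1))"
  shows "\<exists>A B. biclique n A B"
proof -
  have sp: "spider_in V m" if "m \<le> (2 * n + 2 * t + 2) * t + m1 + (4 * n * t * t + t)" for m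
    using rich_spider[OF rich_mono[OF rich that order_refl], of "{}"] by simp
  consider a b where "a + 2 \<le> b" "b \<le> t" "1 \<le> a" "leg_bad t a b"
    | b where "2 \<le> b" "b \<le> t" "leg_bad t 0 b"
    | a b where "1 \<le> a" "a \<le> b" "b \<le> t" "two_legs_bad t a b"
    | a b where "a \<le> b" "b \<le> t" "two_spiders_bad t a b"
  proof -
    have *: "thesis" if "a + 2 \<le> b" "b \<le> t" "leg_bad t a b" for a b
      using that \<open>\<And>a b. \<lbrakk>a + 2 \<le> b; b \<le> t; 1 \<le> a; leg_bad t a b\<rbrakk> \<Longrightarrow> thesis\<close>[of a b]
        \<open>\<And>b. \<lbrakk>2 \<le> b; b \<le> t; leg_bad t 0 b\<rbrakk> \<Longrightarrow> thesis\<close>[of b] by (cases a) auto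
    show thesis using assms(1) * that unfolding bad_def by blast
  qed
  then show ?thesis
  proof cases
    case 1
    then show ?thesis using leg_bad_biclique[OF 1(4,1-3), of n] sp by simp
  next
    case 2
    have "rich m1 (3 * m1 + 2 + n * 2 ^ (3 * m1 + 1))" by (rule rich_mono[OF rich]) auto
    then show ?thesis using centre_bad_biclique[OF 2(3,1,2) conn m1] by blast
  next
    case 3
    then show ?thesis using two_legs_bad_biclique[OF 3(4,1-3), of n] sp by simp
  next
    case 4
    have "rich t (2 * n * (3 * t + 1))" by (rule rich_mono[OF rich]) auto
    then show ?thesis using two_spiders_bad_biclique[OF 4(3)] 4(1,2) by simp
  qed
qed

text \<open>A pair at levels of equal parity, or in two spiders, goes into the independent side
  \<open>A\<close>. At different parities one vertex goes to some \<open>w\<close> outside with a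
  neighbour and a non-neighbour in \<open>A\<close>, which exists because vertices of
  \<open>A\<close> are not twins.\<close>

lemma indep_host_not_bad:
  assumes H: "host t A B" and AB: "A \<union> B \<subseteq> V" and ind: "\<And>x y. x \<in> A \<Longrightarrow> y \<in> A \<Longrightarrow> \<not> E x y"
    and twins: "\<And>x y. x \<in> V \<Longrightarrow> y \<in> V \<Longrightarrow> x \<noteq> y \<Longrightarrow> \<not> E x y \<Longrightarrow> \<exists>w. E x w \<noteq> E y w"
    and conn: "\<And>a x y. x \<in> V - {a} \<Longrightarrow> y \<in> V - {a} \<Longrightarrow> reach (V - {a}) x y"
  shows "\<not> bad t"
proof
  assume "bad t"
  have direct: False if "embed f t" "f p \<in> A" "f q \<in> A" "E (f p) (f q)" for f p q
    using that ind by blast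
  have ear: "\<exists>f. embed f t \<and> \<not> E (f (jy, iy, ky)) (f (0, 0, b))"
    if b: "1 \<le> b" "b \<le> t" and y: "(jy, iy, ky) \<in> positions t" "\<not> (jy = 0 \<and> iy = 0 \<and> b \<le> Suc ky)"
      and odd: "odd (ky + b)" for jy iy ky b
  proof -
    have cA: "6 \<le> card A" using H by (simp add: host_def)
    then have "2 \<le> card A" by simp
    then obtain A2 where "A2 \<subseteq> A" "card A2 = 2" by (rule obtain_subset_with_card_n)
    then obtain x1 x2 where x: "x1 \<in> A" "x2 \<in> A" "x1 \<noteq> x2" by (auto simp: card_2_iff)
    then obtain w where "E x1 w \<noteq> E x2 w" using twins[of x1 x2] ind AB by blast
    then obtain a1 v where w: "a1 \<in> A" "v \<in> A" "v \<noteq> a1" "E a1 w" "\<not> E v w" using x by blast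
    \<comment> \<open>\<open>w\<close> is off the host: adjacent to \<open>a1\<close>, so not in the
      independent \<open>A\<close>; not adjacent to \<open>v\<close>, so not in
      \<open>B\<close>.\<close>
    have wA: "w \<notin> A" using ind w by blast
    have wB: "w \<notin> B"
    proof
      assume "w \<in> B"
      moreover have "v \<noteq> w" using w(2) wA by auto
      ultimately have "E v w" using H w(2) unfolding host_def by simp
      then show False using w(5) by simp
    qed
    have "w \<in> V" "E w a1" "\<not> E w v" using w E_sym E_V by blast+
    moreover have "w \<notin> A \<union> B" using wA wB by blast
    ultimately obtain es a2 v' where e: "is_path (es @ [a2])" "es \<noteq> []" "hd es = w" "set es \<inter> (A \<union> B) = {}"
       "a2 \<in> A \<union> B" "a1 \<noteq> a2" "v' \<in> A" "v' \<noteq> a1" "v' \<noteq> a2" "\<not> E w v'"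
      using ear_exists[of w A B a1 v A] w(1-3) AB cA conn by auto
    have "\<exists>f. embed f t \<and> f (0, 0, b) = hd es \<and> f (jy, iy, ky) = v'"
      using e w odd \<open>E w a1\<close> by (intro embed_ear[OF H b e(1,2,4,5) w(1) _ e(6) y]) simp_all
    then obtain f where f: "embed f t" "f (0, 0, b) = w" "f (jy, iy, ky) = v'" using e(3) by auto
    have "\<not> E v' w" using e(10) E_sym by blast
    then show ?thesis using f by (intro exI[of _ f]) simp
  qed
  from \<open>bad t\<close> consider a b where "a + 2 \<le> b" "b \<le> t" "leg_bad t a b"
    | a b where "1 \<le> a" "a \<le> b" "b \<le> t" "two_legs_bad t a b"
    | a b where "a \<le> b" "b \<le> t" "two_spiders_bad t a b" unfolding bad_def by blast
  then show False
  proof cases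
    case 1
    show ?thesis
    proof (cases "even (a + b)")
      case True
      obtain f where f: "embed f t" "\<And>j i k. (j, i, k) \<in> positions t \<Longrightarrow> f (j, i, k) \<in> (if even (k + a) then A else B)"
        using embed_direct[OF H, of "\<lambda>_. a"] by blast
      have "f (0, 0, a) \<in> A" "f (0, 0, b) \<in> A" using f(2)[of 0 0 a] f(2)[of 0 0 b] 1 True by (auto simp: positions_def add.commute)
      then show ?thesis using direct[OF f(1)] leg_bad_embed[OF 1(3) f(1)] 1 by simp
    next
      case False
      have "\<exists>f. embed f t \<and> \<not> E (f (0, 0, a)) (f (0, 0, b))" using 1 False by (intro ear) (auto simp: positions_def)
      then show ?thesis using leg_bad_embed[OF 1(3)] 1 by auto
    qed
  next
    case 2
    show ?thesis
    proof (cases "even (a + b)")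
      case True
      obtain f where f: "embed f t" "\<And>j i k. (j, i, k) \<in> positions t \<Longrightarrow> f (j, i, k) \<in> (if even (k + a) then A else B)"
        using embed_direct[OF H, of "\<lambda>_. a"] by blast
      have "f (0, 0, a) \<in> A" "f (0, 1, b) \<in> A" using f(2)[of 0 0 a] f(2)[of 0 1 b] 2 True by (auto simp: positions_def add.commute)
      then show ?thesis using direct[OF f(1)] two_legs_bad_embed(1)[OF 2(4) f(1)] 2 by simp
    next
      case False
      \<comment> \<open>The ear runs along leg 0 and carries level \<open>b\<close>, so level
        \<open>a\<close> is put on leg 1.\<close>
      have "\<exists>f. embed f t \<and> \<not> E (f (0, 1, a)) (f (0, 0, b))" using 2 False by (intro ear) (auto simp: positions_def)
      then show ?thesis using two_legs_bad_embed(2)[OF 2(4)] 2 by auto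
    qed
  next
    case 3
    obtain f where f: "embed f t" "\<And>j i k. (j, i, k) \<in> positions t \<Longrightarrow> f (j, i, k) \<in> (if even (k + (if j = 0 then a else b)) then A else B)"
      using embed_direct[OF H, of "\<lambda>j. if j = 0 then a else b"] by blast
    have "f (0, 0, a) \<in> A" "f (1, 0, b) \<in> A" using f(2)[of 0 0 a] f(2)[of 1 0 b] 3 by (auto simp: positions_def)
    then show ?thesis using direct[OF f(1)] two_spiders_bad_embed[OF 3(3) f(1)] 3 by simp
  qed
qed

section \<open>Refuting badness with a maximal clique\<close>

text \<open>To make two centres non-adjacent, one is a vertex \<open>w\<close> outside the clique,
  with three disjoint ways into it. Each leg follows \<open>M i\<close> until it reaches
  \<open>K\<close> and then stays there, or stops earlier at level \<open>t\<close>; the second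
  spider lies in \<open>K\<close>.\<close>

lemma embed_tripod:
  fixes M :: "nat \<Rightarrow> 'a list"
  assumes K: "clique_on K" "6 * t + 6 \<le> card K" and w: "w \<notin> K"
    and sp: "spider w (M 0) (M 1) (M 2)"
    and M: "\<And>i. i < 3 \<Longrightarrow> M i \<noteq> [] \<and> last (M i) \<in> K \<and> set (butlast (M i)) \<inter> K = {}"
    and v: "v \<in> K" "\<And>i. i < 3 \<Longrightarrow> v \<noteq> last (M i)"
  shows "\<exists>f. embed f t \<and> f (0, 0, 0) = w \<and> f (1, 0, 0) = v"
proof -
  define J where "J = {(0::nat, i, k) | i k. i < 3 \<and> k \<le> t \<and> k \<le> length (M i) \<and> (k = 0 \<longrightarrow> i = 0)}"
  define I0 where "I0 = insert (1, 0, 0) J"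
  define g where "g = (\<lambda>(j::nat, i, k). if j = 0 then (w # M i) ! k else v)"
  have J3: "i = 0 \<or> i = 1 \<or> i = 2" if "i < 3" for i :: nat using that by linarith
  have path: "is_path (w # M i)" if "i < 3" for i :: nat using J3[OF that] sp by (auto simp: spider_def)
  have disj: "set (M i) \<inter> set (M i') = {}" if "i < 3" "i' < 3" "i \<noteq> i'" for i i'
    using J3[OF that(1)] J3[OF that(2)] that(3) sp by (auto simp: spider_def)
  have vM: "v \<notin> set (w # M i)" if "i < 3" for i
  proof
    assume "v \<in> set (w # M i)"
    then have "v \<in> set (M i)" using w v(1) by auto
    moreover have "butlast (M i) @ [last (M i)] = M i" using M[OF that] by simp
    then have "set (M i) = insert (last (M i)) (set (butlast (M i)))"
      using set_append[of "butlast (M i)" "[last (M i)]"] by simp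
    ultimately have "v \<in> set (butlast (M i)) \<or> v = last (M i)" by blast
    then show False using M[OF that] v that by blast
  qed
  have injJ: "inj_on g J"
  proof (rule inj_onI)
    fix p q assume pq: "p \<in> J" "q \<in> J" "g p = g q"
    then obtain i k i' k' where p: "p = (0, i, k)" "i < 3" "k \<le> length (M i)" "k = 0 \<longrightarrow> i = 0"
        and q: "q = (0, i', k')" "i' < 3" "k' \<le> length (M i')" "k' = 0 \<longrightarrow> i' = 0"
      unfolding J_def by blast
    have eq: "(w # M i) ! k = (w # M i') ! k'" using pq(3) p(1) q(1) by (simp add: g_def)
    have dist: "distinct (w # M i)" "distinct (w # M i')" using path p q by (auto simp: is_path_def)
    show "p = q"
    proof (cases "i = i'")
      case True
      then show ?thesis using eq dist p q nth_eq_iff_index_eq[OF dist(1), of k k'] by simp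
    next
      case False
      have mem: "(w # M i) ! k = w \<and> k = 0 \<or> (w # M i) ! k \<in> set (M i) \<and> k \<noteq> 0"
        "(w # M i') ! k' = w \<and> k' = 0 \<or> (w # M i') ! k' \<in> set (M i') \<and> k' \<noteq> 0"
        using p q by (auto simp: nth_Cons')
      then show ?thesis using eq dist disj[OF p(2) q(2) False] p q by auto
    qed
  qed
  have gJ: "g p \<in> set (w # M i) \<and> i < 3" if "p \<in> J" "i = fst (snd p)" for p i
    using that by (auto simp: J_def g_def nth_Cons')
  have injg: "inj_on g I0" unfolding I0_def inj_on_insert
  proof
    have "g (1, 0, 0) = v" by (simp add: g_def)
    moreover have "v \<notin> g ` (J - {(1, 0, 0)})"
    proof
      assume "v \<in> g ` (J - {(1, 0, 0)})"
      then obtain p where p: "p \<in> J" "v = g p" by blast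
      show False using gJ[OF p(1) refl] vM p(2) by blast
    qed
    ultimately show "g (1, 0, 0) \<notin> g ` (J - {(1, 0, 0)})" by simp
  qed (rule injJ)
  have I0: "I0 \<subseteq> positions t" by (auto simp: I0_def J_def positions_def)
  have "\<exists>f. inj_on f (positions t) \<and> (\<forall>p\<in>I0. f p = g p) \<and> (\<forall>p\<in>positions t - I0. f p \<in> K)"
    by (rule extend_inj[OF finite_positions I0 injg]) (use K card_positions[of t] in simp)
  then obtain f where f: "inj_on f (positions t)" "\<And>p. p \<in> I0 \<Longrightarrow> f p = g p" "\<And>p. p \<in> positions t \<Longrightarrow> p \<notin> I0 \<Longrightarrow> f p \<in> K"
    by blast
  have f1: "f (1, i, k) \<in> K" if "(1, i, k) \<in> positions t" for i k
  proof (cases "(1, i, k) \<in> I0")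
    case True
    then have "f (1, i, k) = v" using f(2) by (simp add: g_def)
    then show ?thesis using v by simp
  qed (use f(3) that in blast)
  have f0: "f (0, if k = 0 then 0 else i, k) = (w # M i) ! k" if "i < 3" "k \<le> t" "k \<le> length (M i)" for i k
  proof -
    have "(0, if k = 0 then 0 else i, k) \<in> J" using that by (auto simp: J_def)
    then show ?thesis using f(2) by (auto simp: I0_def g_def)
  qed
  have f0K: "f (0, i, k) \<in> K" if "i < 3" "k \<le> t" "length (M i) \<le> k" for i k
  proof (cases "k = length (M i)")
    case True
    have k0: "k \<noteq> 0" using M[OF that(1)] True by auto
    then have "f (0, i, k) = (w # M i) ! k" using f0[of i k] that True by simp
    also have "\<dots> = last (M i)" using k0 M[OF that(1)] True by (simp add: last_conv_nth nth_Cons')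
    finally show ?thesis using M[OF that(1)] by simp
  next
    case False
    then have "(0, i, k) \<notin> I0" using that by (auto simp: I0_def J_def)
    moreover have "(0, i, k) \<in> positions t" using that False by (auto simp: positions_def)
    ultimately show ?thesis using f(3) by blast
  qed
  have "E (f (j, if k = 0 then 0 else i, k)) (f (j, i, Suc k))" if p: "(j, i, Suc k) \<in> positions t" for j i k
  proof -
    have q: "(j, if k = 0 then 0 else i, k) \<in> positions t" using p by (auto simp: positions_def)
    have ne: "f (j, if k = 0 then 0 else i, k) \<noteq> f (j, i, Suc k)" using inj_onD[OF f(1) _ q p] by auto
    have b: "i < 3" "Suc k \<le> t" "j < 2" using p by (auto simp: positions_def)
    consider "j = 1" | "j = 0" "Suc k \<le> length (M i)" | "j = 0" "length (M i) \<le> k" using b by linarith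
    then show ?thesis
    proof cases
      case 1
      have "f (j, i, Suc k) \<in> K" "f (j, if k = 0 then 0 else i, k) \<in> K"
        using f1[of i "Suc k"] f1[of "if k = 0 then 0 else i" k] p q unfolding 1 by blast+
      then show ?thesis using ne K(1) by (simp add: clique_on_def)
    next
      case 2
      have "f (0, if k = 0 then 0 else i, k) = (w # M i) ! k" using f0 b 2 by simp
      moreover have "f (0, i, Suc k) = (w # M i) ! Suc k" using f0[of i "Suc k"] b 2 by simp
      ultimately show ?thesis using is_path_nth[OF path[OF b(1)], of k] 2 by simp
    next
      case 3
      then have "k \<noteq> 0" using M[OF b(1)] by auto
      then show ?thesis using f0K[of i k] f0K[of i "Suc k"] b 3 ne K(1) by (simp add: clique_on_def)
    qed
  qed
  then have "embed f t" using f(1) by (auto simp: embed_def)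
  moreover have "f (0, 0, 0) = w" using f0[of 0 0] by simp
  moreover have "f (1, 0, 0) = v" using f(2) by (simp add: I0_def g_def)
  ultimately show ?thesis by blast
qed

text \<open>The neighbours in \<open>K\<close> of a component \<open>D\<close> of the rest form a
  clique; if there were at most two, they would separate \<open>D\<close> from the remainder of
  \<open>K\<close>. Three of them have neighbours \<open>u1\<close>, \<open>u2\<close>,
  \<open>u3\<close> in \<open>D\<close>; a path from \<open>u1\<close> to \<open>u2\<close> and one
  from \<open>u3\<close> to it meet in \<open>w\<close>. As \<open>w\<close> may equal some of
  these, a leg can be a single vertex.\<close>

lemma tripod_exists:
  assumes w0: "w0 \<in> V - K" and K: "K \<subseteq> V" "clique_on K" "3 \<le> card K"
    and conn: "\<And>U x y. \<lbrakk>U \<subseteq> V; clique_on U; card U \<le> 2; x \<in> V - U; y \<in> V - U\<rbrakk> \<Longrightarrow> reach (V - U) x y"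
  shows "\<exists>w M. w \<in> V - K \<and> spider w (M 0) (M 1) (M (2::nat)) \<and>
     (\<forall>i<3. M i \<noteq> [] \<and> last (M i) \<in> K \<and> set (butlast (M i)) \<inter> K = {})"
proof -
  define D where "D = component (V - K) w0"
  define T where "T = {k \<in> K. \<exists>u\<in>D. E u k}"
  have finK: "finite K" using K(1) finV finite_subset by blast
  have Dsub: "D \<subseteq> V - K" unfolding D_def by (rule comp_sub)
  have "3 \<le> card T"
  proof (rule ccontr)
    assume "\<not> 3 \<le> card T"
    then have c: "card T \<le> 2" by simp
    have T: "T \<subseteq> V" "clique_on T" using K by (auto simp: T_def clique_on_def)
    have "\<not> K \<subseteq> T"
    proof
      assume "K \<subseteq> T"
      then have "card K \<le> card T" using finK by (intro card_mono) (auto simp: T_def)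
      then show False using c K(3) by simp
    qed
    then obtain k where k: "k \<in> K - T" by blast
    have w1: "w0 \<in> V - T" using w0 by (auto simp: T_def)
    have "reach (V - T) w0 k" using k K(1) by (intro conn[OF T c w1]) auto
    then obtain xs s where xs: "is_path (xs @ [s])" "hd (xs @ [s]) = w0" "set (xs @ [s]) \<subseteq> V - T"
        "s \<in> K - T" "set xs \<inter> (K - T) = {}"
      using path_to_set[OF _ w1 k] by blast
    have x0: "xs \<noteq> []" "hd xs = w0" using xs w0 by (auto simp: hd_append split: if_splits)
    have x1: "set xs \<subseteq> V - K" using xs(3,5) by auto
    have "reach (V - K) w0 (last xs)" using path_reach[OF _ x1 x0(1)] x0(2) xs(1) by (auto simp: is_path_append_iff)
    moreover have "last xs \<in> V - K" using x1 x0(1) last_in_set by blast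
    ultimately have "last xs \<in> D" by (simp add: D_def component_def)
    moreover have "E (last xs) s" using xs(1) x0(1) by (auto simp: is_path_append_iff)
    ultimately have "s \<in> T" using xs(4) by (auto simp: T_def)
    then show False using xs(4) by blast
  qed
  then obtain T3 where T3: "T3 \<subseteq> T" "card T3 = 3" by (rule obtain_subset_with_card_n)
  from T3(2) obtain k1 k2 k3 where "T3 = {k1, k2, k3}" and kne: "k1 \<noteq> k2" "k1 \<noteq> k3" "k2 \<noteq> k3"
    by (auto simp: card_3_iff)
  then have kT: "k1 \<in> T" "k2 \<in> T" "k3 \<in> T" using T3(1) by auto
  obtain u1 u2 u3 where u: "u1 \<in> D" "u2 \<in> D" "u3 \<in> D" "E u1 k1" "E u2 k2" "E u3 k3"
    using kT unfolding T_def by blast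
  have kK: "k1 \<in> K" "k2 \<in> K" "k3 \<in> K" using kT by (auto simp: T_def)
  have DD: "reach D x y" if "x \<in> D" "y \<in> D" for x y
  proof -
    have "reach D w0 x" "reach D w0 y" using that w0 unfolding D_def by (auto intro: reach_comp)
    then show ?thesis using reach_sym reach_trans by blast
  qed
  obtain ps where ps: "is_path ps" "ps \<noteq> []" "hd ps = u1" "last ps = u2" "set ps \<subseteq> D"
    using reach_path[OF DD[OF u(1,2)] u(1)] by blast
  have "hd ps \<in> set ps" using ps(2) by simp
  then have u1p: "u1 \<in> set ps" using ps(3) by simp
  obtain xs w where xs: "is_path (xs @ [w])" "hd (xs @ [w]) = u3" "set (xs @ [w]) \<subseteq> D"
      "w \<in> set ps" "set xs \<inter> set ps = {}"
    using path_to_set[OF DD[OF u(3,1)] u(3) u1p] by blast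
  obtain p1 p2 where p: "ps = p1 @ w # p2" using split_list[OF xs(4)] by blast
  define M where "M = (\<lambda>i::nat. if i = 0 then rev p1 @ [k1] else if i = 1 then p2 @ [k2] else rev xs @ [k3])"
  have KD: "k \<notin> D" if "k \<in> K" for k using that Dsub by blast
  have pd: "set p1 \<subseteq> D" "set p2 \<subseteq> D" "set xs \<subseteq> D" "w \<in> D" using ps(5) xs(3) p by auto
  have "is_path (k1 # (p1 @ [w]))"
  proof -
    have "is_path (p1 @ [w])" using ps(1) p is_path_appendD[of "p1 @ [w]" p2] by simp
    moreover have "hd (p1 @ [w]) = u1" using ps(3) p by (cases p1) auto
    ultimately show ?thesis unfolding is_path_Cons using u(4) E_sym pd KD kK by auto
  qed
  then have 1: "is_path (w # rev p1 @ [k1])" using is_path_rev[of "k1 # (p1 @ [w])"] by simp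
  have "is_path ((w # p2) @ [k2])"
  proof -
    have "is_path (w # p2)" using ps(1) p is_path_appendD[of p1 "w # p2"] by simp
    moreover have "last (w # p2) = u2" using ps(4) p by simp
    ultimately show ?thesis unfolding is_path_append_iff[of "w # p2"] using u(5) pd KD kK by (auto simp: is_path_def)
  qed
  then have 2: "is_path (w # p2 @ [k2])" by simp
  have "is_path (k3 # (xs @ [w]))"
    unfolding is_path_Cons using xs(1,2) u(6) E_sym pd KD kK by auto
  then have 3: "is_path (w # rev xs @ [k3])" using is_path_rev[of "k3 # (xs @ [w])"] by simp
  have d: "distinct ps" using ps(1) by (simp add: is_path_def)
  have "spider w (M 0) (M 1) (M 2)"
    unfolding spider_def M_def using 1 2 3 d p xs(5) kne pd KD kK by auto
  moreover have "\<forall>i<3. M i \<noteq> [] \<and> last (M i) \<in> K \<and> set (butlast (M i)) \<inter> K = {}"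
    using kK pd KD by (auto simp: M_def butlast_append)
  moreover have "w \<in> V - K" using pd Dsub by blast
  ultimately show ?thesis by blast
qed

text \<open>With \<open>A = B = K\<close> parity disappears and only adjacency obstructs. A vertex
  \<open>w\<close> outside with a neighbour in \<open>K\<close> also has a non-neighbour there by
  maximality, and the ear settles every pair with a vertex at a positive level.\<close>

lemma clique_not_bad:
  assumes K: "K \<subseteq> V" "clique_on K" "6 * t + 6 \<le> card K" and max: "\<And>w. w \<in> V - K \<Longrightarrow> \<exists>v\<in>K. \<not> E w v"
    and ne: "K \<noteq> V"
    and conn: "\<And>U x y. \<lbrakk>U \<subseteq> V; clique_on U; card U \<le> 2; x \<in> V - U; y \<in> V - U\<rbrakk> \<Longrightarrow> reach (V - U) x y"
  shows "\<not> bad t"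
proof
  assume "bad t"
  have finK: "finite K" using K(1) finV finite_subset by blast
  have H: "host t K K" using K by (auto simp: host_def clique_on_def)
  obtain w0 where w0: "w0 \<in> V - K" using K(1) ne by blast
  have conn1: "reach (V - {a}) x y" if "a \<in> V" "x \<in> V - {a}" "y \<in> V - {a}" for a x y
    using that by (intro conn) (auto simp: clique_on_def)
  have "K \<noteq> {}" using K(3) by auto
  then obtain k0 where k0: "k0 \<in> K" by blast
  have "reach V w0 k0" using conn[of "{}" w0 k0] w0 k0 K(1) by (auto simp: clique_on_def)
  then obtain xs s where xs: "is_path (xs @ [s])" "hd (xs @ [s]) = w0" "set (xs @ [s]) \<subseteq> V" "s \<in> K" "set xs \<inter> K = {}"
    using path_to_set[of V w0 k0 K] w0 k0 by blast
  have x0: "xs \<noteq> []" using xs w0 by (auto simp: hd_append split: if_splits)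
  define w where "w = last xs"
  have "w \<in> set xs" using x0 by (simp add: w_def)
  then have w: "w \<in> V" "w \<notin> K" using xs by auto
  have ws: "E w s" using xs(1) x0 by (auto simp: w_def is_path_append_iff)
  obtain v where v: "v \<in> K" "\<not> E w v" using max w by blast
  have ear: "\<exists>f. embed f t \<and> \<not> E (f (jy, iy, ky)) (f (0, 0, b))"
    if b: "1 \<le> b" "b \<le> t" and y: "(jy, iy, ky) \<in> positions t" "\<not> (jy = 0 \<and> iy = 0 \<and> b \<le> Suc ky)"
      for jy iy ky b
  proof -
    have "v \<noteq> s" using ws v by auto
    have "\<exists>es a2 v'. is_path (es @ [a2]) \<and> es \<noteq> [] \<and> hd es = w \<and> set es \<inter> (K \<union> K) = {} \<and>
       a2 \<in> K \<union> K \<and> s \<noteq> a2 \<and> v' \<in> K \<and> v' \<noteq> s \<and> v' \<noteq> a2 \<and> \<not> E w v'"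
    proof (rule ear_exists)
      show "reach (V - {s}) x y" if "x \<in> V - {s}" "y \<in> V - {s}" for x y
        using that xs(3) by (intro conn1) auto
    qed (use w ws xs(4) v K \<open>v \<noteq> s\<close> in auto)
    then obtain es a2 v' where e: "is_path (es @ [a2])" "es \<noteq> []" "hd es = w" "set es \<inter> (K \<union> K) = {}"
       "a2 \<in> K \<union> K" "s \<noteq> a2" "v' \<in> K" "v' \<noteq> s" "v' \<noteq> a2" "\<not> E w v'"
      by blast
    have "\<exists>f. embed f t \<and> f (0, 0, b) = hd es \<and> f (jy, iy, ky) = v'"
      using e ws by (intro embed_ear[OF H b e(1,2,4,5) xs(4) _ e(6) y]) simp_all
    then obtain f where f: "embed f t" "f (0, 0, b) = w" "f (jy, iy, ky) = v'" using e(3) by auto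
    have "\<not> E v' w" using e(10) E_sym by blast
    then show ?thesis using f by (intro exI[of _ f]) simp
  qed
  \<comment> \<open>The ear passes through an inner vertex of a leg, so it needs
    \<open>1 \<le> b\<close>; what remains is the pair of the two centres.\<close>
  consider a b where "a + 2 \<le> b" "b \<le> t" "leg_bad t a b"
    | a b where "1 \<le> a" "a \<le> b" "b \<le> t" "two_legs_bad t a b"
    | a b where "1 \<le> b" "a \<le> b" "b \<le> t" "two_spiders_bad t a b"
    | "two_spiders_bad t 0 0" 
  proof -
    have *: thesis if "a \<le> b" "b \<le> t" "two_spiders_bad t a b" for a b
      using that \<open>\<And>a b. \<lbrakk>1 \<le> b; a \<le> b; b \<le> t; two_spiders_bad t a b\<rbrakk> \<Longrightarrow> thesis\<close>[of b a]
        \<open>two_spiders_bad t 0 0 \<Longrightarrow> thesis\<close> by (cases b) auto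
    from \<open>bad t\<close> show thesis using * that unfolding bad_def by blast
  qed
  then show False
  proof cases
    case 1
    have "\<exists>f. embed f t \<and> \<not> E (f (0, 0, a)) (f (0, 0, b))" using 1 by (intro ear) (auto simp: positions_def)
    then show ?thesis using leg_bad_embed[OF 1(3)] 1 by auto
  next
    case 2
    have "\<exists>f. embed f t \<and> \<not> E (f (0, 1, a)) (f (0, 0, b))" using 2 by (intro ear) (auto simp: positions_def)
    then show ?thesis using two_legs_bad_embed(2)[OF 2(4)] 2 by auto
  next
    case 3
    have "\<exists>f. embed f t \<and> \<not> E (f (1, 0, a)) (f (0, 0, b))" using 3 by (intro ear) (auto simp: positions_def)
    then show ?thesis using E_sym[OF two_spiders_bad_embed[OF two_spiders_bad_sym[OF 3(4)]]] 3 by auto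
  next
    case 4
    have "\<exists>w M v. w \<in> V - K \<and> spider w (M 0) (M 1) (M (2::nat)) \<and>
       (\<forall>i<3. M i \<noteq> [] \<and> last (M i) \<in> K \<and> set (butlast (M i)) \<inter> K = {}) \<and>
       v \<in> K \<and> \<not> E w v \<and> (\<forall>i<3. v \<noteq> last (M i))"
    proof -
      have "3 \<le> card K" using K(3) by simp
      then obtain w M where w: "w \<in> V - K" and M: "spider w (M 0) (M 1) (M (2::nat))"
        "\<forall>i<3. M i \<noteq> [] \<and> last (M i) \<in> K \<and> set (butlast (M i)) \<inter> K = {}"
        using tripod_exists[OF w0 K(1,2) _ conn] by blast
      \<comment> \<open>The second centre has to be a non-neighbour of \<open>w\<close> at which no
        leg ends. Three neighbours in \<open>K\<close> give legs of one edge, which avoid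
        non-neighbours by themselves; with at most two, neighbours and end vertices exclude at most
        five of the at least six vertices of \<open>K\<close>.\<close>
      define NK where "NK = {k \<in> K. E w k}"
      have finN: "finite NK" using finK by (simp add: NK_def)
      show ?thesis
      proof (cases "3 \<le> card NK")
        case True
        then obtain T3 where T3: "T3 \<subseteq> NK" "card T3 = 3" by (rule obtain_subset_with_card_n)
        from T3(2) obtain k1 k2 k3 where "T3 = {k1, k2, k3}" and kne: "k1 \<noteq> k2" "k1 \<noteq> k3" "k2 \<noteq> k3"
          by (auto simp: card_3_iff)
        then have kN: "k1 \<in> NK" "k2 \<in> NK" "k3 \<in> NK" using T3(1) by auto
        obtain v where v: "v \<in> K" "\<not> E w v" using max w by blast
        define M' where "M' = (\<lambda>i::nat. if i = 0 then [k1] else if i = 1 then [k2] else [k3])"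
        have "spider w (M' 0) (M' 1) (M' 2)" unfolding spider_def M'_def
          using kN kne w by (auto simp: is_path_def NK_def)
        moreover have "\<forall>i<3. M' i \<noteq> [] \<and> last (M' i) \<in> K \<and> set (butlast (M' i)) \<inter> K = {}"
          using kN by (auto simp: M'_def NK_def)
        moreover have "\<forall>i<3. v \<noteq> last (M' i)" using kN v by (auto simp: M'_def NK_def)
        ultimately show ?thesis using w v by (intro exI[of _ w] exI[of _ M'] exI[of _ v]) simp
      next
        case False
        let ?L = "{last (M 0), last (M 1), last (M 2)}"
        have "card ?L \<le> 3" using card_length[of "[last (M 0), last (M 1), last (M 2)]"] by simp
        then have "card (NK \<union> ?L) \<le> 5" using False card_Un_le[of NK ?L] by linarith
        then have "\<not> K \<subseteq> NK \<union> ?L" using K(3) card_mono[of "NK \<union> ?L" K] finN by auto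
        then obtain v where v: "v \<in> K" "v \<notin> NK" "v \<notin> ?L" by blast
        have "v \<noteq> last (M i)" if "i < 3" for i
        proof -
          have "i = 0 \<or> i = 1 \<or> i = 2" using that by linarith
          then show ?thesis using v(3) by auto
        qed
        then show ?thesis using w M v by (intro exI[of _ w] exI[of _ M] exI[of _ v]) (auto simp: NK_def)
      qed
    qed
    then obtain w M v where *: "w \<in> V - K" "spider w (M 0) (M 1) (M (2::nat))"
       "\<forall>i<3. M i \<noteq> [] \<and> last (M i) \<in> K \<and> set (butlast (M i)) \<inter> K = {}"
       "v \<in> K" "\<not> E w v" "\<forall>i<3. v \<noteq> last (M i)" by blast
    have "\<exists>f. embed f t \<and> f (0, 0, 0) = w \<and> f (1, 0, 0) = v"
      using * by (intro embed_tripod[OF K(2,3)]) auto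
    then obtain f where "embed f t" "f (0, 0, 0) = w" "f (1, 0, 0) = v" by blast
    then show ?thesis using two_spiders_bad_embed[OF 4, of f] *(5) by simp
  qed
qed

lemma maximal_clique:
  assumes "K \<subseteq> V" "clique_on K"
  shows "\<exists>K'. K \<subseteq> K' \<and> K' \<subseteq> V \<and> clique_on K' \<and> (\<forall>w\<in>V - K'. \<exists>v\<in>K'. \<not> E w v)"
proof -
  let ?P = "\<lambda>L. K \<subseteq> L \<and> L \<subseteq> V \<and> clique_on L"
  have "\<forall>L. ?P L \<longrightarrow> card L < Suc (card V)" using finV by (simp add: card_mono less_Suc_eq_le)
  then obtain L where L: "?P L" "\<And>L'. ?P L' \<Longrightarrow> card L' \<le> card L"
    using ex_has_greatest_nat[of ?P K card "Suc (card V)"] assms by blast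
  have "\<exists>v\<in>L. \<not> E w v" if w: "w \<in> V - L" for w
  proof (rule ccontr)
    assume "\<not> (\<exists>v\<in>L. \<not> E w v)"
    then have "?P (insert w L)" using L(1) w E_sym by (auto simp: clique_on_def)
    then have "card (insert w L) \<le> card L" by (rule L(2))
    moreover have "finite L" using L(1) finV finite_subset by blast
    ultimately show False using w by simp
  qed
  then show ?thesis using L(1) by blast
qed

text \<open>A clique in \<open>A\<close> is enlarged to a maximal one, and maximality takes over the
  role of the absence of twins; an independent set becomes one side of a host together with
  \<open>B\<close>. Sets of at most one vertex are cliques, so \<open>conn\<close> also yields
  connectedness and excludes cut vertices.\<close>

lemma rich_not_bad:
  assumes r: "\<forall>(W::'a set) (F::'a set set). finite W \<and> card W \<ge> n \<longrightarrow>
      (\<exists>R \<subseteq> W. card R = 6 * t + 6 \<and> clique R F \<or> card R = 6 * t + 6 \<and> indep R F)"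
    and conn: "\<And>U x y. \<lbrakk>U \<subseteq> V; clique_on U; card U \<le> 2; x \<in> V - U; y \<in> V - U\<rbrakk> \<Longrightarrow> reach (V - U) x y"
    and twins: "\<And>x y. x \<in> V \<Longrightarrow> y \<in> V \<Longrightarrow> x \<noteq> y \<Longrightarrow> \<not> E x y \<Longrightarrow> \<exists>w. E x w \<noteq> E y w"
    and ncl: "\<not> clique_on V"
    and m1: "m1 = 2 * (n + 2) * t"
    and rich: "rich ((2 * n + 2 * t + 2) * t + m1 + (4 * n * t * t + t))
       ((3 * m1 + 2 + n * 2 ^ (3 * m1 + 1)) + 2 * n * (3 * t + 1))"
  shows "\<not> bad t"
proof
  assume bad: "bad t"
  have conn0: "reach V x y" if "x \<in> V" "y \<in> V" for x y
    using conn[of "{}" x y] that by (simp add: clique_on_def)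
  have conn1: "reach (V - {a}) x y" if "x \<in> V - {a}" "y \<in> V - {a}" for a x y
  proof (cases "a \<in> V")
    case True
    then show ?thesis using that by (intro conn) (auto simp: clique_on_def)
  next
    case False
    then show ?thesis using conn0[of x y] that by simp
  qed
  obtain A B where AB: "biclique n A B" using bad_biclique[OF bad conn0 m1 rich] by blast
  let ?F = "{{x, y} | x y. E x y}"
  have F: "{x, y} \<in> ?F \<longleftrightarrow> E x y" for x y using E_sym by (auto simp: doubleton_eq_iff)
  have AB': "finite A" "card A = n" "card B = n" "\<And>x y. x \<in> A \<Longrightarrow> y \<in> B \<Longrightarrow> E x y" using AB by (auto simp: biclique_def)
  obtain R where R: "R \<subseteq> A" "card R = 6 * t + 6" "clique R ?F \<or> indep R ?F"
    using r[rule_format, of A ?F] AB' by auto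
  have nR: "6 * t + 6 \<le> n" using R(1,2) AB' card_mono by metis
  have "R \<noteq> {}" "B \<noteq> {}" using R(2) nR AB'(3) by auto
  then have RB: "R \<subseteq> V" "B \<subseteq> V" using AB'(4) R(1) E_V E_sym by blast+
  show False
  proof (cases "clique R ?F")
    case True
    then have "clique_on R" unfolding clique_def clique_on_def F .
    then obtain K where K: "R \<subseteq> K" "K \<subseteq> V" "clique_on K" "\<And>w. w \<in> V - K \<Longrightarrow> \<exists>v\<in>K. \<not> E w v"
      using maximal_clique[OF RB(1)] by blast
    have "finite K" using K(2) finV finite_subset by blast
    then have "6 * t + 6 \<le> card K" using card_mono[OF _ K(1)] R(2) by simp
    moreover have "K \<noteq> V" using ncl K(3) by blast
    ultimately show ?thesis using clique_not_bad[OF K(2,3) _ K(4) _ conn] bad by blast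
  next
    case False
    then have "indep R ?F" using R(3) by blast
    then have ind: "\<not> E x y" if "x \<in> R" "y \<in> R" for x y
      using that E_irrefl unfolding indep_def F by (cases "x = y") auto
    have "host t R B" unfolding host_def using R nR AB'(3,4) by auto
    then show ?thesis using indep_host_not_bad[OF _ _ ind twins conn1] RB bad by blast
  qed
qed

end

section \<open>Self-intersections producing disjoint spiders\<close>

text \<open>Intersecting, for every \<open>\<phi>\<close> in \<open>Phi\<close>, two copies of \<open>G\<close> that meet exactly in the image
  of \<open>\<phi>\<close> leaves \<open>F\<close>: a non-edge of \<open>F\<close> is removed by the copies whose \<open>\<phi>\<close> witnesses it.\<close>

lemma si_arrowI:
  fixes G :: "'a graph" and F :: "nat graph"
  assumes G: "wf_graph G" and F: "wf_graph F" and Phi: "finite Phi" "Phi \<noteq> {}"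
    and hom: "\<And>\<phi>. \<phi> \<in> Phi \<Longrightarrow> inj_on \<phi> (verts F) \<and> \<phi> ` verts F \<subseteq> verts G \<and>
        (\<forall>e\<in>edges F. \<phi> ` e \<in> edges G)"
    and sep: "\<And>u v. \<lbrakk>u \<in> verts F; v \<in> verts F; u \<noteq> v; {u, v} \<notin> edges F\<rbrakk> \<Longrightarrow>
        \<exists>\<phi>\<in>Phi. {\<phi> u, \<phi> v} \<notin> edges G"
  shows "si_arrow G F"
proof -
  have finV: "finite (verts G)" "finite (verts F)" using G F by (auto simp: wf_graph_def)
  obtain idx :: "'a \<Rightarrow> nat" where idx: "inj_on idx (verts G)"
    using finite_imp_inj_to_nat_seg[OF finV(1)] by blast
  obtain base where base: "\<And>x. x \<in> verts F \<Longrightarrow> x < base"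
    using finite_nat_set_iff_bounded[THEN iffD1, OF finV(2)] by blast
  \<comment> \<open>On the image of \<open>\<phi>\<close> its inverse; elsewhere fresh numbers from
    \<open>base\<close> on, at even or odd distance from \<open>base\<close> according to
    \<open>b\<close>, so the copies for 0 and 1 share no fresh number.\<close>
  define \<alpha> where "\<alpha> = (\<lambda>(\<phi>, b::nat) x. if x \<in> \<phi> ` verts F then inv_into (verts F) \<phi> x else base + 2 * idx x + b)"
  have low: "\<alpha> (\<phi>, b) x \<in> verts F \<and> \<phi> (\<alpha> (\<phi>, b) x) = x" if "x \<in> \<phi> ` verts F" for \<phi> b x
    using that by (simp add: \<alpha>_def inv_into_into f_inv_into_f)
  have high: "\<alpha> (\<phi>, b) x = base + 2 * idx x + b" if "x \<notin> \<phi> ` verts F" for \<phi> b x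
    using that by (simp add: \<alpha>_def)
  have img: "\<alpha> (\<phi>, b) (\<phi> u) = u" if "\<phi> \<in> Phi" "u \<in> verts F" for \<phi> b u
    using that hom by (simp add: \<alpha>_def inv_into_f_f)
  have lowD: "x = \<phi> (\<alpha> (\<phi>, b) x)" if "\<alpha> (\<phi>, b) x \<in> verts F" for \<phi> b x
  proof (cases "x \<in> \<phi> ` verts F")
    case True
    from low[OF True, of b] show ?thesis by simp
  next
    case False
    then show ?thesis using base[OF that] high by simp
  qed
  have inj: "inj_on (\<alpha> (\<phi>, b)) (verts G)" for \<phi> b
  proof (rule inj_onI)
    fix x y assume xy: "x \<in> verts G" "y \<in> verts G" "\<alpha> (\<phi>, b) x = \<alpha> (\<phi>, b) y"
    show "x = y"
    proof (cases "\<alpha> (\<phi>, b) x \<in> verts F")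
      case True
      then have "x = \<phi> (\<alpha> (\<phi>, b) x)" by (rule lowD)
      also have "\<dots> = y" using lowD[of \<phi> b y] True xy(3) by simp
      finally show ?thesis .
    next
      case False
      then have "x \<notin> \<phi> ` verts F" "y \<notin> \<phi> ` verts F" using low xy(3) by metis+
      then have "idx x = idx y" using xy(3) high by simp
      then show ?thesis using idx xy by (simp add: inj_on_def)
    qed
  qed
  obtain \<alpha>s where \<alpha>s: "set \<alpha>s = \<alpha> ` (Phi \<times> {0, 1})"
    using finite_list[of "\<alpha> ` (Phi \<times> {0, 1})"] Phi(1) by auto
  have in\<alpha>: "\<alpha> (\<phi>, b) \<in> set \<alpha>s" if "\<phi> \<in> Phi" "b \<in> {0, 1}" for \<phi> b
    unfolding \<alpha>s using that by blast
  define H where "H = inter_maps G \<alpha>s"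
  have vH: "verts H = (\<Inter>\<alpha>\<in>set \<alpha>s. \<alpha> ` verts G)"
    by (simp add: H_def inter_maps_def graph_map_def verts_def)
  have eH: "edges H = (\<Inter>\<alpha>\<in>set \<alpha>s. (\<lambda>e. \<alpha> ` e) ` edges G)"
    by (simp add: H_def inter_maps_def graph_map_def edges_def)
  have V: "verts H = verts F"
  proof
    show "verts F \<subseteq> verts H"
    proof
      fix u assume u: "u \<in> verts F"
      have "u \<in> \<alpha> (\<phi>, b) ` verts G" if "\<phi> \<in> Phi" for \<phi> b
        using img[OF that u, of b] hom[OF that] u by (metis image_eqI image_subset_iff)
      then show "u \<in> verts H" unfolding vH \<alpha>s by auto
    qed
    show "verts H \<subseteq> verts F"
    proof
      fix n assume n: "n \<in> verts H"
      show "n \<in> verts F"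
      proof (rule ccontr)
        assume nF: "n \<notin> verts F"
        obtain \<phi> where \<phi>: "\<phi> \<in> Phi" using Phi(2) by blast
        have "n \<in> \<alpha> (\<phi>, 0) ` verts G" "n \<in> \<alpha> (\<phi>, 1) ` verts G"
          using n in\<alpha>[OF \<phi>] unfolding vH by blast+
        then obtain x y where "n = \<alpha> (\<phi>, 0) x" "n = \<alpha> (\<phi>, 1) y" by blast
        moreover from this have "x \<notin> \<phi> ` verts F" "y \<notin> \<phi> ` verts F" using low nF by metis+
        ultimately have "2 * idx x = 2 * idx y + 1" using high by simp
        then show False by presburger
      qed
    qed
  qed
  have pairF: "\<exists>u v. e = {u, v} \<and> u \<noteq> v \<and> u \<in> verts F \<and> v \<in> verts F" if "e \<in> edges F" for e
    using F that by (auto simp: wf_graph_def)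
  have pairG: "\<exists>u v. e = {u, v} \<and> u \<noteq> v \<and> u \<in> verts G \<and> v \<in> verts G" if "e \<in> edges G" for e
    using G that by (auto simp: wf_graph_def)
  have E1: "edges F \<subseteq> edges H"
  proof
    fix e assume e: "e \<in> edges F"
    then obtain u v where uv: "e = {u, v}" "u \<in> verts F" "v \<in> verts F" using pairF by blast
    have "e \<in> (\<lambda>e. \<alpha> (\<phi>, b) ` e) ` edges G" if \<phi>: "\<phi> \<in> Phi" for \<phi> b
    proof (rule image_eqI)
      show "e = \<alpha> (\<phi>, b) ` (\<phi> ` e)" using img[OF \<phi>] uv by simp
      show "\<phi> ` e \<in> edges G" using hom[OF \<phi>] e by blast
    qed
    then show "e \<in> edges H" unfolding eH \<alpha>s by auto
  qed
  have E2: "edges H \<subseteq> edges F"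
  proof
    fix e assume e: "e \<in> edges H"
    obtain \<phi>0 where \<phi>0: "\<phi>0 \<in> Phi" using Phi(2) by blast
    have ex: "\<exists>x y. e = {\<alpha> (\<phi>, b) x, \<alpha> (\<phi>, b) y} \<and> {x, y} \<in> edges G \<and> x \<noteq> y \<and> x \<in> verts G \<and> y \<in> verts G"
      if "\<phi> \<in> Phi" "b \<in> {0, 1}" for \<phi> b
    proof -
      have "e \<in> (\<lambda>e. \<alpha> (\<phi>, b) ` e) ` edges G" using e in\<alpha>[OF that] unfolding eH by blast
      then obtain e' where e': "e' \<in> edges G" "e = \<alpha> (\<phi>, b) ` e'" by blast
      obtain x y where "e' = {x, y}" "x \<noteq> y" "x \<in> verts G" "y \<in> verts G" using pairG[OF e'(1)] by blast
      then show ?thesis using e' by (intro exI[of _ x] exI[of _ y]) simp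
    qed
    have sub: "e \<subseteq> verts F"
    proof -
      have "e \<subseteq> \<alpha>' ` verts G" if \<alpha>': "\<alpha>' \<in> set \<alpha>s" for \<alpha>'
      proof -
        obtain e' where "e' \<in> edges G" "e = \<alpha>' ` e'" using e \<alpha>' unfolding eH by blast
        moreover have "e' \<subseteq> verts G" using pairG[OF calculation(1)] by blast
        ultimately show ?thesis by blast
      qed
      then have "e \<subseteq> verts H" unfolding vH by blast
      then show ?thesis using V by simp
    qed
    obtain x0 y0 where 0: "e = {\<alpha> (\<phi>0, 0) x0, \<alpha> (\<phi>0, 0) y0}" "x0 \<noteq> y0" "x0 \<in> verts G" "y0 \<in> verts G"
      using ex[OF \<phi>0, of 0] by blast
    define u v where "u = \<alpha> (\<phi>0, 0) x0" and "v = \<alpha> (\<phi>0, 0) y0"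
    have uv: "e = {u, v}" "u \<noteq> v" using 0 inj_onD[OF inj, of \<phi>0 0 x0 y0] by (auto simp: u_def v_def)
    show "e \<in> edges F"
    proof (rule ccontr)
      assume ne: "e \<notin> edges F"
      have "u \<in> verts F" "v \<in> verts F" using sub uv(1) by auto
      moreover have "{u, v} \<notin> edges F" using ne uv(1) by simp
      ultimately obtain \<phi> where \<phi>: "\<phi> \<in> Phi" "{\<phi> u, \<phi> v} \<notin> edges G" using sep uv(2) by blast
      obtain x y where xy: "e = {\<alpha> (\<phi>, 0) x, \<alpha> (\<phi>, 0) y}" "{x, y} \<in> edges G" using ex[OF \<phi>(1), of 0] by blast
      have "\<alpha> (\<phi>, 0) x \<in> verts F" "\<alpha> (\<phi>, 0) y \<in> verts F" using sub xy(1) by auto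
      then have "x = \<phi> (\<alpha> (\<phi>, 0) x)" "y = \<phi> (\<alpha> (\<phi>, 0) y)" using lowD by blast+
      then have "{x, y} = \<phi> ` e" unfolding xy(1) by simp
      then have "{x, y} = {\<phi> u, \<phi> v}" using uv(1) by simp
      then show False using xy(2) \<phi>(2) by simp
    qed
  qed
  have "graph_iso H F" unfolding graph_iso_def V using E1 E2
    by (intro exI[of _ id]) auto
  moreover have "\<alpha>s \<noteq> []" using \<alpha>s Phi(2) by auto
  moreover have "\<forall>\<alpha>\<in>set \<alpha>s. inj_on \<alpha> (verts G)" unfolding \<alpha>s using inj by auto
  ultimately show ?thesis unfolding si_arrow_def H_def by blast
qed

section \<open>The vertex numbering of the forest\<close>

text \<open>The offset of level \<open>k\<close> on leg \<open>i\<close> within one block of the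
  numbering in \<open>spider_edges t t t\<close>.\<close>

definition leg_pos :: "nat \<Rightarrow> nat \<Rightarrow> nat \<Rightarrow> nat" where
  "leg_pos t i k = (if k = 0 then 0 else i * t + k)"

lemma leg_pos_le: "i < 3 \<Longrightarrow> k \<le> t \<Longrightarrow> leg_pos t i k \<le> 3 * t"
proof -
  assume "i < 3" "k \<le> t"
  then have "i * t \<le> 2 * t" by (intro mult_le_mono) auto
  then have "i * t + k \<le> 3 * t" using \<open>k \<le> t\<close> by linarith
  then show ?thesis by (simp add: leg_pos_def)
qed

lemma leg_pos_decode:
  assumes "r \<le> 3 * t"
  shows "\<exists>i k. i < 3 \<and> k \<le> t \<and> (k = 0 \<longrightarrow> i = 0) \<and> r = leg_pos t i k"
proof -
  consider "r = 0" | "1 \<le> r" "r \<le> t" | "t < r" "r \<le> 2 * t" | "2 * t < r" using assms by linarith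
  then show ?thesis
  proof cases
    case 1
    then show ?thesis by (intro exI[of _ 0]) (simp add: leg_pos_def)
  next
    case 2
    then show ?thesis by (intro exI[of _ 0] exI[of _ r]) (simp add: leg_pos_def)
  next
    case 3
    then show ?thesis by (intro exI[of _ 1] exI[of _ "r - t"]) (simp add: leg_pos_def)
  next
    case 4
    then show ?thesis using assms by (intro exI[of _ 2] exI[of _ "r - 2 * t"]) (simp add: leg_pos_def)
  qed
qed

text \<open>\<open>1 \<le> t\<close> matters: for \<open>t = 0\<close> the left-hand side still
  contains an edge at the centre, while the right-hand side is empty.\<close>

lemma spider_edges_leg_pos:
  assumes "1 \<le> t"
  shows "spider_edges t t t off = {{off + leg_pos t i k, off + leg_pos t i (Suc k)} | i k. i < 3 \<and> k < t}"
    (is "?L = ?R")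
proof
  have R: "{off + leg_pos t i k, off + leg_pos t i (Suc k)} \<in> ?R" if "i < 3" "k < t" for i k using that by blast
  show "?L \<subseteq> ?R"
  proof
    fix e assume "e \<in> ?L"
    then consider "e = {off, off + 1}" | "e = {off, off + t + 1}" | "e = {off, off + t + t + 1}"
      | i where "e = {off + i, off + i + 1}" "1 \<le> i" "i < t"
      | i where "e = {off + i, off + i + 1}" "t + 1 \<le> i" "i < t + t"
      | i where "e = {off + i, off + i + 1}" "t + t + 1 \<le> i" "i < t + t + t"
      unfolding spider_edges_def by blast
    then show "e \<in> ?R"
    proof cases
      case 1
      then show ?thesis using R[of 0 0] assms by (simp add: leg_pos_def)
    next
      case 2
      then show ?thesis using R[of 1 0] assms by (simp add: leg_pos_def)
    next
      case 3
      then show ?thesis using R[of 2 0] assms by (simp add: leg_pos_def mult_2 add.assoc)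
    next
      case (4 i)
      then show ?thesis using R[of 0 i] by (simp add: leg_pos_def)
    next
      case (5 i)
      then show ?thesis using R[of 1 "i - t"] by (simp add: leg_pos_def)
    next
      case (6 i)
      then show ?thesis using R[of 2 "i - 2 * t"] by (simp add: leg_pos_def)
    qed
  qed
  show "?R \<subseteq> ?L"
  proof
    fix e assume "e \<in> ?R"
    then obtain i k where e: "e = {off + leg_pos t i k, off + leg_pos t i (Suc k)}" "i < 3" "k < t" by blast
    then consider "i = 0" "k = 0" | "i = 1" "k = 0" | "i = 2" "k = 0" | "i = 0" "0 < k"
      | "i = 1" "0 < k" | "i = 2" "0 < k" by linarith
    then show "e \<in> ?L"
    proof cases
      case 4
      then have "e = {off + k, off + k + 1}" using e by (simp add: leg_pos_def)
      moreover have "1 \<le> k \<and> k < t" using e 4 by simp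
      ultimately show ?thesis unfolding spider_edges_def by blast
    next
      case 5
      then have "e = {off + (t + k), off + (t + k) + 1}" using e by (simp add: leg_pos_def)
      moreover have "t + 1 \<le> t + k \<and> t + k < t + t" using e 5 by simp
      ultimately show ?thesis unfolding spider_edges_def by blast
    next
      case 6
      then have "e = {off + (t + t + k), off + (t + t + k) + 1}" using e by (simp add: leg_pos_def mult_2)
      moreover have "t + t + 1 \<le> t + t + k \<and> t + t + k < t + t + t" using e 6 by simp
      ultimately show ?thesis unfolding spider_edges_def by blast
    qed (use e in \<open>simp_all add: leg_pos_def spider_edges_def mult_2 add.assoc\<close>)
  qed
qed

definition vtx :: "nat \<Rightarrow> nat \<Rightarrow> nat \<Rightarrow> nat \<Rightarrow> nat" where
  "vtx t j i k = j * (3 * t + 1) + leg_pos t i k"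

lemma vtx_in: "j < t \<Longrightarrow> i < 3 \<Longrightarrow> k \<le> t \<Longrightarrow> vtx t j i k \<in> verts (tS t)"
  using leg_pos_le[of i k t] unfolding tS_def verts_def vtx_def fst_conv by (intro UN_I[of j]) auto

lemma vtx_decode:
  assumes "v \<in> verts (tS t)"
  shows "\<exists>j i k. j < t \<and> i < 3 \<and> k \<le> t \<and> (k = 0 \<longrightarrow> i = 0) \<and> v = vtx t j i k"
proof -
  obtain j where j: "j < t" "j * (3 * t + 1) \<le> v" "v \<le> j * (3 * t + 1) + 3 * t"
    using assms by (auto simp: tS_def verts_def)
  then have "v - j * (3 * t + 1) \<le> 3 * t" by linarith
  then obtain i k where "i < 3" "k \<le> t" "k = 0 \<longrightarrow> i = 0" "v - j * (3 * t + 1) = leg_pos t i k"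
    using leg_pos_decode by blast
  moreover from this(4) have "v = vtx t j i k" using j(2) unfolding vtx_def by linarith
  ultimately show ?thesis using j(1) by blast
qed

lemma edges_tS:
  assumes "1 \<le> t"
  shows "edges (tS t) = {{vtx t j i k, vtx t j i (Suc k)} | j i k. j < t \<and> i < 3 \<and> k < t}"
  unfolding tS_def edges_def vtx_def snd_conv spider_edges_leg_pos[OF assms] by blast

lemma wf_tS:
  assumes "1 \<le> t"
  shows "wf_graph (tS t)"
  unfolding wf_graph_def
proof (intro conjI ballI)
  show "finite (verts (tS t))" by (simp add: tS_def verts_def)
  fix e assume "e \<in> edges (tS t)"
  then obtain j i k where e: "e = {vtx t j i k, vtx t j i (Suc k)}" "j < t" "i < 3" "k < t"
    unfolding edges_tS[OF assms] by blast
  moreover have "vtx t j i k \<noteq> vtx t j i (Suc k)" by (simp add: vtx_def leg_pos_def)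
  ultimately show "\<exists>u v. e = {u, v} \<and> u \<noteq> v \<and> u \<in> verts (tS t) \<and> v \<in> verts (tS t)"
    using vtx_in[of j t i k] vtx_in[of j t i "Suc k"]
    by (intro exI[of _ "vtx t j i k"] exI[of _ "vtx t j i (Suc k)"]) simp
qed

context ugraph
begin

section \<open>From embeddings of the forest to bad pairs\<close>

text \<open>For \<open>D = {..<t}\<close> these are the copies of \<open>tS t\<close> as a subgraph,
  not necessarily induced. Smaller \<open>D\<close> give partial copies, to be completed by
  \<open>extend_family\<close>.\<close>

definition family :: "nat \<Rightarrow> nat set \<Rightarrow> (nat \<Rightarrow> 'a) \<Rightarrow> (nat \<Rightarrow> nat \<Rightarrow> 'a list) \<Rightarrow> bool" where
  "family t D C L \<longleftrightarrow>
     (\<forall>x\<in>D. spider (C x) (L x 0) (L x 1) (L x 2) \<and> (\<forall>i<3. length (L x i) = t) \<and>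
        sverts (C x) (L x 0) (L x 1) (L x 2) \<subseteq> V) \<and>
     (\<forall>x\<in>D. \<forall>y\<in>D. x \<noteq> y \<longrightarrow> sverts (C x) (L x 0) (L x 1) (L x 2) \<inter> sverts (C y) (L y 0) (L y 1) (L y 2) = {})"

definition family_map :: "nat \<Rightarrow> (nat \<Rightarrow> 'a) \<Rightarrow> (nat \<Rightarrow> nat \<Rightarrow> 'a list) \<Rightarrow> nat \<Rightarrow> 'a" where
  "family_map t C L v = (let j = v div (3 * t + 1); r = v mod (3 * t + 1) in
     if r = 0 then C j else L j ((r - 1) div t) ! ((r - 1) mod t))"

lemma family_map_vtx:
  assumes "i < 3" "k \<le> t"
  shows "family_map t C L (vtx t j i k) = (C j # L j i) ! k"
proof -
  have r: "leg_pos t i k < 3 * t + 1" using leg_pos_le[OF assms] by simp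
  have "vtx t j i k div (3 * t + 1) = j" "vtx t j i k mod (3 * t + 1) = leg_pos t i k"
    using r by (simp_all add: vtx_def del: add_Suc_right add_Suc)
  then have *: "family_map t C L (vtx t j i k) =
      (if leg_pos t i k = 0 then C j else L j ((leg_pos t i k - 1) div t) ! ((leg_pos t i k - 1) mod t))"
    unfolding family_map_def Let_def by presburger
  show ?thesis
  proof (cases k)
    case 0
    then show ?thesis using * by (simp add: leg_pos_def)
  next
    case (Suc l)
    then have "leg_pos t i k - 1 = i * t + l" "leg_pos t i k \<noteq> 0" "l < t" using assms by (auto simp: leg_pos_def)
    moreover from this have "(i * t + l) div t = i" "(i * t + l) mod t = l" by simp_all
    ultimately show ?thesis using * Suc by simp
  qed
qed

lemma family_hom:
  assumes fam: "family t {..<t} C L" and t: "1 \<le> t"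
  shows "inj_on (family_map t C L) (verts (tS t))"
    and "u \<in> verts (tS t) \<Longrightarrow> family_map t C L u \<in> V"
    and "e \<in> edges (tS t) \<Longrightarrow> \<exists>x y. family_map t C L ` e = {x, y} \<and> E x y"
proof -
  have sp: "spider (C x) (L x 0) (L x 1) (L x 2)" "sverts (C x) (L x 0) (L x 1) (L x 2) \<subseteq> V"
     "i < 3 \<Longrightarrow> length (L x i) = t" if "x < t" for x i
    using fam that unfolding family_def by auto
  have path: "is_path (C x # L x i)" if "x < t" "i < 3" for x i
    using sp(1)[OF that(1)] leg_cases[OF that(2)] by (auto simp: spider_def)
  have disjL: "set (L x i) \<inter> set (L x i') = {}" if "x < t" "i < 3" "i' < 3" "i \<noteq> i'" for x i i'
    using sp(1)[OF that(1)] leg_cases[OF that(2)] leg_cases[OF that(3)] that(4) by (auto simp: spider_def)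
  have mem: "(C x # L x i) ! k \<in> sverts (C x) (L x 0) (L x 1) (L x 2)" if "x < t" "i < 3" "k \<le> t" for x i k
  proof -
    have "(C x # L x i) ! k \<in> set (C x # L x i)" using that sp(3) by (intro nth_mem) simp
    then show ?thesis using leg_cases[OF that(2)] by (auto simp: sverts_def)
  qed
  show "inj_on (family_map t C L) (verts (tS t))"
  proof (rule inj_onI)
    fix u v assume uv: "u \<in> verts (tS t)" "v \<in> verts (tS t)" "family_map t C L u = family_map t C L v"
    obtain j i k where u: "j < t" "i < 3" "k \<le> t" "k = 0 \<longrightarrow> i = 0" "u = vtx t j i k"
      using vtx_decode[OF uv(1)] by blast
    obtain j' i' k' where v: "j' < t" "i' < 3" "k' \<le> t" "k' = 0 \<longrightarrow> i' = 0" "v = vtx t j' i' k'"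
      using vtx_decode[OF uv(2)] by blast
    have eq: "(C j # L j i) ! k = (C j' # L j' i') ! k'" using uv(3) u v family_map_vtx by simp
    have jj: "j = j'"
    proof (rule ccontr)
      assume "j \<noteq> j'"
      then have "sverts (C j) (L j 0) (L j 1) (L j 2) \<inter> sverts (C j') (L j' 0) (L j' 1) (L j' 2) = {}"
        using fam u(1) v(1) unfolding family_def by blast
      then show False using mem[OF u(1-3)] mem[OF v(1-3)] eq by auto
    qed
    have dist: "distinct (C j # L j i)" "distinct (C j # L j i')"
      using path u v jj by (auto simp: is_path_def)
    have len: "length (L j i) = t" "length (L j i') = t" using sp(3) u v jj by auto
    have "i = i' \<and> k = k'"
    proof (cases "i = i'")
      case True
      then show ?thesis using eq jj dist u v len nth_eq_iff_index_eq[OF dist(1), of k k'] by simp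
    next
      case False
      have "(C j # L j i) ! k = C j \<and> k = 0 \<or> (C j # L j i) ! k \<in> set (L j i) \<and> k \<noteq> 0"
        "(C j # L j i') ! k' = C j \<and> k' = 0 \<or> (C j # L j i') ! k' \<in> set (L j i') \<and> k' \<noteq> 0"
        using u v len by (auto simp: nth_Cons')
      then show ?thesis using eq dist disjL[OF u(1) u(2) v(2) False] jj u v by auto
    qed
    then show "u = v" using u v jj by simp
  qed
  show "family_map t C L u \<in> V" if u: "u \<in> verts (tS t)"
  proof -
    obtain j i k where "j < t" "i < 3" "k \<le> t" "u = vtx t j i k" using vtx_decode[OF u] by blast
    then have "family_map t C L u \<in> sverts (C j) (L j 0) (L j 1) (L j 2)" using family_map_vtx mem[of j i k] by simp
    then show ?thesis using sp(2)[OF \<open>j < t\<close>] by blast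
  qed
  show "\<exists>x y. family_map t C L ` e = {x, y} \<and> E x y" if e: "e \<in> edges (tS t)"
  proof -
    obtain j i k where e: "e = {vtx t j i k, vtx t j i (Suc k)}" "j < t" "i < 3" "k < t"
      using e unfolding edges_tS[OF t] by blast
    then have "family_map t C L ` e = {(C j # L j i) ! k, (C j # L j i) ! Suc k}"
      using family_map_vtx[of i k t C L j] family_map_vtx[of i "Suc k" t C L j] by simp
    moreover have "E ((C j # L j i) ! k) ((C j # L j i) ! Suc k)"
      using is_path_nth[OF path[of j i], of k] e sp(3) by simp
    ultimately show ?thesis by blast
  qed
qed

text \<open>The reason why only the spiders that meet the bad pair matter. The given ones occupy at
  most \<open>t * (3 * t + 1)\<close> vertices and \<open>t\<close> fresh ones as many again; fresh
  spiders with index in \<open>D\<close> are discarded.\<close>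

lemma extend_family:
  assumes fam: "family t D C0 L0" and D: "D \<subseteq> {..<t}" and rich: "rich t (2 * t * (3 * t + 1))"
  shows "\<exists>C L. family t {..<t} C L \<and> (\<forall>x\<in>D. C x = C0 x \<and> L x = L0 x)"
proof -
  define Y where "Y = (\<Union>x\<in>D. sverts (C0 x) (L0 x 0) (L0 x 1) (L0 x 2))"
  have finD: "finite D" using D finite_subset by blast
  have "card Y \<le> (\<Sum>x\<in>D. card (sverts (C0 x) (L0 x 0) (L0 x 1) (L0 x 2)))"
    unfolding Y_def by (rule card_UN_le[OF finD])
  also have "\<dots> \<le> (\<Sum>x\<in>D. 3 * t + 1)"
  proof (rule sum_mono)
    fix x assume "x \<in> D"
    then have "\<forall>i<3. length (L0 x i) = t" using fam by (simp add: family_def)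
    then show "card (sverts (C0 x) (L0 x 0) (L0 x 1) (L0 x 2)) \<le> 3 * t + 1"
      using card_sverts[of "C0 x" "L0 x 0" "L0 x 1" "L0 x 2"] by simp
  qed
  also have "\<dots> = card D * (3 * t + 1)" by simp
  also have "\<dots> \<le> t * (3 * t + 1)"
  proof (rule mult_le_mono1)
    show "card D \<le> t" using card_mono[OF _ D] by simp
  qed
  finally have "card Y \<le> t * (3 * t + 1)" .
  then have cY: "card Y + t * (3 * t + 1) \<le> 2 * t * (3 * t + 1)" by simp
  have YV: "Y \<subseteq> V" using fam by (auto simp: Y_def family_def)
  obtain c l0 l1 l2 where S: "\<forall>i<t. spider (c i) (l0 i) (l1 i) (l2 i) \<and> length (l0 i) = t \<and> length (l1 i) = t \<and>
       length (l2 i) = t \<and> sverts (c i) (l0 i) (l1 i) (l2 i) \<subseteq> V - Y"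
     and disj: "\<forall>i<t. \<forall>j<t. i \<noteq> j \<longrightarrow> sverts (c i) (l0 i) (l1 i) (l2 i) \<inter> sverts (c j) (l0 j) (l1 j) (l2 j) = {}"
    using disjoint_spiders[OF rich YV cY] by (elim exE conjE)
  define C where "C x = (if x \<in> D then C0 x else c x)" for x
  define L where "L x = (if x \<in> D then L0 x else (\<lambda>i. if i = 0 then l0 x else if i = 1 then l1 x else l2 x))" for x
  let ?S = "\<lambda>x. sverts (C x) (L x 0) (L x 1) (L x 2)"
  have new: "?S x \<subseteq> V - Y" if "x < t" "x \<notin> D" for x using S that by (simp add: C_def L_def)
  have old: "?S x \<subseteq> Y" if "x \<in> D" for x using that by (auto simp: C_def L_def Y_def)
  have "family t {..<t} C L" unfolding family_def
  proof (intro conjI ballI impI)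
    fix x assume x: "x \<in> {..<t}"
    have "spider (C x) (L x 0) (L x 1) (L x 2) \<and> (\<forall>i<3. length (L x i) = t) \<and> ?S x \<subseteq> V"
    proof (cases "x \<in> D")
      case True
      then show ?thesis using fam by (simp add: C_def L_def family_def)
    next
      case False
      then have "length (L x i) = t" for i using S x by (simp add: L_def)
      then show ?thesis using S x False new[of x] by (auto simp: C_def L_def)
    qed
    then show "spider (C x) (L x 0) (L x 1) (L x 2)" "\<forall>i<3. length (L x i) = t" "?S x \<subseteq> V" by auto
    fix y assume y: "y \<in> {..<t}" "x \<noteq> y"
    consider "x \<in> D" "y \<in> D" | "x \<in> D" "y \<notin> D" | "x \<notin> D" "y \<in> D" | "x \<notin> D" "y \<notin> D" by blast
    then show "?S x \<inter> ?S y = {}"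
    proof cases
      case 1
      then show ?thesis using fam y by (simp add: C_def L_def family_def)
    next
      case 2
      then show ?thesis using old[of x] new[of y] y by blast
    next
      case 3
      then show ?thesis using old[of y] new[of x] x by blast
    next
      case 4
      then show ?thesis using disj x y by (simp add: C_def L_def)
    qed
  qed
  then show ?thesis by (intro exI[of _ C] exI[of _ L]) (simp add: C_def L_def)
qed

lemma path_in_V: "is_path (c # l) \<Longrightarrow> l \<noteq> [] \<Longrightarrow> set (c # l) \<subseteq> V"
proof (induction l arbitrary: c)
  case (Cons x l)
  then have e: "E c x" "is_path (x # l)" by (auto simp: is_path_Cons)
  then have "c \<in> V" "x \<in> V" using E_V E_sym by blast+
  then show ?case using Cons.IH[of x] e(2) by (cases "l = []") auto
qed simp

lemma spider_in_V:
  assumes "spider c l0 l1 l2" "l0 \<noteq> []" "l1 \<noteq> []" "l2 \<noteq> []"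
  shows "sverts c l0 l1 l2 \<subseteq> V"
  using assms path_in_V[of c l0] path_in_V[of c l1] path_in_V[of c l2] by (auto simp: spider_def sverts_def)

text \<open>The bad pair may lie on any legs, while the badness predicates speak of the first two;
  this moves \<open>l0\<close> and \<open>l1\<close> to the legs \<open>i\<close> and
  \<open>i'\<close>.\<close>

definition place :: "nat \<Rightarrow> nat \<Rightarrow> 'a list \<Rightarrow> 'a list \<Rightarrow> 'a list \<Rightarrow> nat \<Rightarrow> 'a list" where
  "place i i' l0 l1 l2 m = (if m = i then l0 else if m = i' then l1 else l2)"

lemma place_spider:
  assumes "spider c l0 l1 l2" "i < 3" "i' < 3" "i \<noteq> i'"
  shows "spider c (place i i' l0 l1 l2 0) (place i i' l0 l1 l2 1) (place i i' l0 l1 l2 2)"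
    and "sverts c (place i i' l0 l1 l2 0) (place i i' l0 l1 l2 1) (place i i' l0 l1 l2 2) = sverts c l0 l1 l2"
  using assms leg_cases[OF assms(2)] leg_cases[OF assms(3)]
  by (auto simp: place_def spider_def sverts_def)

text \<open>Otherwise every non-edge of the forest would be a non-edge under some family, and these
  finitely many maps would satisfy the hypotheses of \<open>si_arrowI\<close>.\<close>

lemma not_si_arrow_pair:
  assumes G: "wf_graph G" "V = verts G" "E = adj G" and t: "1 \<le> t"
    and no: "\<not> si_arrow G (tS t)" and rich: "rich t (2 * t * (3 * t + 1))"
  shows "\<exists>u v. u \<in> verts (tS t) \<and> v \<in> verts (tS t) \<and> u \<noteq> v \<and> {u, v} \<notin> edges (tS t) \<and>
     (\<forall>C L. family t {..<t} C L \<longrightarrow> E (family_map t C L u) (family_map t C L v))"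
proof (rule ccontr)
  assume "\<not> ?thesis"
  then have ex: "\<exists>C L. family t {..<t} C L \<and> \<not> E (family_map t C L u) (family_map t C L v)"
    if "u \<in> verts (tS t)" "v \<in> verts (tS t)" "u \<noteq> v" "{u, v} \<notin> edges (tS t)" for u v
    using that by blast
  define Q where "Q = {(u, v). u \<in> verts (tS t) \<and> v \<in> verts (tS t) \<and> u \<noteq> v \<and> {u, v} \<notin> edges (tS t)}"
  have "Q \<subseteq> verts (tS t) \<times> verts (tS t)" by (auto simp: Q_def)
  then have finQ: "finite Q" by (rule finite_subset) (simp add: tS_def verts_def)
  have "\<forall>p\<in>Q. \<exists>\<phi>. (\<exists>C L. family t {..<t} C L \<and> \<phi> = family_map t C L) \<and> \<not> E (\<phi> (fst p)) (\<phi> (snd p))"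
    using ex unfolding Q_def by fastforce
  then obtain \<Phi> where Phi: "\<And>p. p \<in> Q \<Longrightarrow> (\<exists>C L. family t {..<t} C L \<and> \<Phi> p = family_map t C L) \<and>
      \<not> E (\<Phi> p (fst p)) (\<Phi> p (snd p))" by metis
  \<comment> \<open>One arbitrary family keeps the collection of maps non-empty without exhibiting a
    non-edge of \<open>tS t\<close>.\<close>
  have "family t {} (\<lambda>_. undefined) (\<lambda>_ _. [])" by (simp add: family_def)
  then obtain C0 L0 where fam0: "family t {..<t} C0 L0" using extend_family[OF _ _ rich] by blast
  have "si_arrow G (tS t)"
  proof (rule si_arrowI[OF G(1) wf_tS[OF t]])
    show "finite (insert (family_map t C0 L0) (\<Phi> ` Q))" "insert (family_map t C0 L0) (\<Phi> ` Q) \<noteq> {}" using finQ by auto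
    fix \<phi> assume "\<phi> \<in> insert (family_map t C0 L0) (\<Phi> ` Q)"
    then obtain C L where fam: "family t {..<t} C L" "\<phi> = family_map t C L" using fam0 Phi by blast
    have "\<phi> ` e \<in> edges G" if "e \<in> edges (tS t)" for e
    proof -
      obtain x y where "\<phi> ` e = {x, y}" "E x y" using family_hom(3)[OF fam(1) t \<open>e \<in> edges (tS t)\<close>] fam(2) by auto
      then show ?thesis using G(3) by (simp add: adj_def)
    qed
    then show "inj_on \<phi> (verts (tS t)) \<and> \<phi> ` verts (tS t) \<subseteq> verts G \<and> (\<forall>e\<in>edges (tS t). \<phi> ` e \<in> edges G)"
      using family_hom(1,2)[OF fam(1) t] fam(2) G(2) by auto
  next
    fix u v assume "u \<in> verts (tS t)" "v \<in> verts (tS t)" "u \<noteq> v" "{u, v} \<notin> edges (tS t)"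
    then have "(u, v) \<in> Q" by (simp add: Q_def)
    then show "\<exists>\<phi>\<in>insert (family_map t C0 L0) (\<Phi> ` Q). {\<phi> u, \<phi> v} \<notin> edges G"
      using Phi[of "(u, v)"] G(3) by (intro bexI[of _ "\<Phi> (u, v)"]) (auto simp: adj_def)
  qed
  then show False using no by simp
qed

lemma two_legs_bad_sym: "two_legs_bad t a b \<Longrightarrow> two_legs_bad t b a"
  unfolding two_legs_bad_def[of t b a]
proof (intro allI impI, elim conjE)
  fix c l0 l1 l2
  assume bad: "two_legs_bad t a b" and sp: "spider c l0 l1 l2" "t \<le> length l0" "t \<le> length l1" "t \<le> length l2"
  show "E ((c # l0) ! b) ((c # l1) ! a)"
    by (rule E_sym[OF two_legs_badD[OF bad spider_swap01[OF sp(1)]]]) (use sp in simp_all)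
qed

lemma leg_bad_sym: "leg_bad t a b \<Longrightarrow> leg_bad t b a"
  unfolding leg_bad_def using E_sym by blast

lemma nth_Cons_take: "k \<le> t \<Longrightarrow> (c # take t l) ! k = (c # l) ! k"
  by (cases k) auto

text \<open>Any spider with long legs, cut down to length \<open>t\<close> and with its legs
  permuted, is member \<open>j\<close> of a complete family; so a condition on all families becomes
  one on all such spiders.\<close>

lemma single_spider_bad:
  assumes all: "\<And>C L. family t {..<t} C L \<Longrightarrow> E ((C j # L j i) ! k) ((C j # L j i') ! k')"
    and j: "j < t" and i: "i < 3" "i' < 3" and k: "k \<le> t" "k' \<le> t"
    and rich: "rich t (2 * t * (3 * t + 1))"
    and p: "p < 3" "p' < 3" "p \<noteq> p'"
    and sp: "spider c l0 l1 l2" "t \<le> length l0" "t \<le> length l1" "t \<le> length l2"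
  shows "E ((c # place p p' l0 l1 l2 i) ! k) ((c # place p p' l0 l1 l2 i') ! k')"
proof -
  have t: "1 \<le> t" using j by simp
  define M where "M = place p p' (take t l0) (take t l1) (take t l2)"
  have spt: "spider c (take t l0) (take t l1) (take t l2)" by (rule spider_take[OF sp(1)])
  have "family t {j} (\<lambda>_. c) (\<lambda>_. M)" unfolding family_def
  proof (intro conjI ballI impI)
    show "spider c (M 0) (M 1) (M 2)" unfolding M_def by (rule place_spider[OF spt p])
    show "\<forall>i<3. length (M i) = t" using sp by (auto simp: M_def place_def)
    have "sverts c (take t l0) (take t l1) (take t l2) \<subseteq> V" using sp t by (intro spider_in_V spt) auto
    then show "sverts c (M 0) (M 1) (M 2) \<subseteq> V" unfolding M_def place_spider(2)[OF spt p] .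
  qed auto
  then obtain C L where "family t {..<t} C L" "C j = c" "L j = M"
    using extend_family[OF _ _ rich, of "{j}" "\<lambda>_. c" "\<lambda>_. M"] j by auto
  then have "E ((c # M i) ! k) ((c # M i') ! k')" using all[of C L] by simp
  moreover have "M m = take t (place p p' l0 l1 l2 m)" for m by (simp add: M_def place_def)
  ultimately show ?thesis using k by (simp add: nth_Cons_take)
qed

lemma two_spiders_bad_of_family:
  assumes all: "\<And>C L. family t {..<t} C L \<Longrightarrow> E ((C j # L j i) ! k) ((C j' # L j' i') ! k')"
    and j: "j < t" "j' < t" "j \<noteq> j'" and i: "i < 3" "i' < 3" and k: "k \<le> t" "k' \<le> t"
    and rich: "rich t (2 * t * (3 * t + 1))"
  shows "two_spiders_bad t k k'"
  unfolding two_spiders_bad_def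
proof (intro allI impI, elim conjE)
  fix c l0 l1 l2 c' l0' l1' l2'
  assume sp: "spider c l0 l1 l2" "t \<le> length l0" "t \<le> length l1" "t \<le> length l2"
    and sp': "spider c' l0' l1' l2'" "t \<le> length l0'" "t \<le> length l1'" "t \<le> length l2'"
    and disj: "sverts c l0 l1 l2 \<inter> sverts c' l0' l1' l2' = {}"
  have t: "1 \<le> t" using j by simp
  define o1 where "o1 m = (if m = 0 then 1 else 0 :: nat)" for m :: nat
  have o1: "o1 m < 3" "m \<noteq> o1 m" for m by (simp_all add: o1_def)
  define M where "M = place i (o1 i) (take t l0) (take t l1) (take t l2)"
  define M' where "M' = place i' (o1 i') (take t l0') (take t l1') (take t l2')"
  have spt: "spider c (take t l0) (take t l1) (take t l2)" "spider c' (take t l0') (take t l1') (take t l2')"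
    by (rule spider_take[OF sp(1)], rule spider_take[OF sp'(1)])
  have spM: "spider c (M 0) (M 1) (M 2)" "spider c' (M' 0) (M' 1) (M' 2)"
    unfolding M_def M'_def by (rule place_spider[OF spt(1) i(1) o1], rule place_spider[OF spt(2) i(2) o1])
  have svM: "sverts c (M 0) (M 1) (M 2) = sverts c (take t l0) (take t l1) (take t l2)"
     "sverts c' (M' 0) (M' 1) (M' 2) = sverts c' (take t l0') (take t l1') (take t l2')"
    unfolding M_def M'_def by (rule place_spider(2)[OF spt(1) i(1) o1], rule place_spider(2)[OF spt(2) i(2) o1])
  have V: "sverts c (M 0) (M 1) (M 2) \<subseteq> V" "sverts c' (M' 0) (M' 1) (M' 2) \<subseteq> V"
  proof -
    have "sverts c (take t l0) (take t l1) (take t l2) \<subseteq> V" using sp t by (intro spider_in_V[OF spt(1)]) auto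
    then show "sverts c (M 0) (M 1) (M 2) \<subseteq> V" unfolding svM .
    have "sverts c' (take t l0') (take t l1') (take t l2') \<subseteq> V" using sp' t by (intro spider_in_V[OF spt(2)]) auto
    then show "sverts c' (M' 0) (M' 1) (M' 2) \<subseteq> V" unfolding svM .
  qed
  have d: "sverts c (M 0) (M 1) (M 2) \<inter> sverts c' (M' 0) (M' 1) (M' 2) = {}"
    unfolding svM using disj sverts_take[of c t l0 t l1 t l2] sverts_take[of c' t l0' t l1' t l2'] by blast
  have len: "length (M m) = t" "length (M' m) = t" for m using sp sp' by (auto simp: M_def M'_def place_def)
  let ?C = "\<lambda>x. if x = j then c else c'" and ?L = "\<lambda>x. if x = j then M else M'"
  have "family t {j, j'} ?C ?L" unfolding family_def using spM V d len j(3) by auto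
  then obtain C L where "family t {..<t} C L" "C j = c" "L j = M" "C j' = c'" "L j' = M'"
    using extend_family[OF _ _ rich, of "{j, j'}" ?C ?L] j by auto
  then have "E ((c # M i) ! k) ((c' # M' i') ! k')" using all[of C L] by simp
  moreover have "M i = take t l0" "M' i' = take t l0'" by (simp_all add: M_def M'_def place_def)
  ultimately show "E ((c # l0) ! k) ((c' # l0') ! k')" using k by (simp add: nth_Cons_take)
qed

lemma not_si_arrow_bad:
  assumes G: "wf_graph G" "V = verts G" "E = adj G" and t: "1 \<le> t"
    and no: "\<not> si_arrow G (tS t)" and rich: "rich t (2 * t * (3 * t + 1))"
  shows "bad t"
proof -
  obtain u v where uv: "u \<in> verts (tS t)" "v \<in> verts (tS t)" "u \<noteq> v" "{u, v} \<notin> edges (tS t)"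
     and all: "\<And>C L. family t {..<t} C L \<Longrightarrow> E (family_map t C L u) (family_map t C L v)"
    using not_si_arrow_pair[OF assms] by blast
  obtain j i k where u: "j < t" "i < 3" "k \<le> t" "k = 0 \<longrightarrow> i = 0" "u = vtx t j i k"
    using vtx_decode[OF uv(1)] by blast
  obtain j' i' k' where v: "j' < t" "i' < 3" "k' \<le> t" "k' = 0 \<longrightarrow> i' = 0" "v = vtx t j' i' k'"
    using vtx_decode[OF uv(2)] by blast
  have all': "E ((C j # L j i) ! k) ((C j' # L j' i') ! k')" if "family t {..<t} C L" for C L
    using all[OF that] u v family_map_vtx by simp
  show ?thesis
  proof (cases "j = j'")
    case False
    have "two_spiders_bad t k k'" by (rule two_spiders_bad_of_family[OF all' u(1) v(1) False u(2) v(2) u(3) v(3) rich])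
    then show ?thesis using two_spiders_bad_sym[of t k k'] u(3) v(3) unfolding bad_def by (meson nat_le_linear)
  next
    case jj: True
    have single: "E ((c # place p p' l0 l1 l2 i) ! k) ((c # place p p' l0 l1 l2 i') ! k')"
      if "p < 3" "p' < 3" "p \<noteq> p'" "spider c l0 l1 l2" "t \<le> length l0" "t \<le> length l1" "t \<le> length l2"
      for p p' c l0 l1 l2
      by (rule single_spider_bad[OF _ u(1,2) v(2) u(3) v(3) rich that]) (use all' jj in simp)
    consider "i = i' \<or> k = 0 \<or> k' = 0" | "i \<noteq> i'" "1 \<le> k" "1 \<le> k'" by linarith
    then show ?thesis
    proof cases
      case 1
      \<comment> \<open>The centre lies on every leg, so a pair containing it is viewed on the leg
        of the other vertex.\<close>
      define q where "q = (if k = 0 then i' else i)"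
      have q: "q < 3" "vtx t j i k = vtx t j q k" "vtx t j i' k' = vtx t j q k'"
        using u v 1 by (auto simp: q_def vtx_def leg_pos_def)
      define q' where "q' = (if q = 0 then 1 else 0 :: nat)"
      have q': "q' < 3" "q \<noteq> q'" by (simp_all add: q'_def)
      have lb: "leg_bad t k k'" unfolding leg_bad_def
      proof (intro allI impI, elim conjE)
        fix c l0 l1 l2
        assume "spider c l0 l1 l2" "t \<le> length l0" "t \<le> length l1" "t \<le> length l2"
        then have "E ((c # place q q' l0 l1 l2 i) ! k) ((c # place q q' l0 l1 l2 i') ! k')"
          using single[OF q(1) q'] by blast
        moreover have "(c # place q q' l0 l1 l2 i) ! k = (c # l0) ! k"
          using 1 by (cases "k = 0") (simp_all add: q_def place_def)
        moreover have "(c # place q q' l0 l1 l2 i') ! k' = (c # l0) ! k'"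
          using 1 u(4) v(4) by (cases "k' = 0") (auto simp: q_def place_def)
        ultimately show "E ((c # l0) ! k) ((c # l0) ! k')" by simp
      qed
      have ee: "{vtx t j q a, vtx t j q (Suc a)} \<in> edges (tS t)" if "a < t" for a
        unfolding edges_tS[OF t] using u(1) q(1) that by blast
      \<comment> \<open>Equal levels on one leg would be one vertex and consecutive ones an edge, so
        the levels differ by at least 2.\<close>
      have ne: "k \<noteq> k'" "k' \<noteq> Suc k" "k \<noteq> Suc k'"
        using uv(3,4) u v jj q(2,3) ee[of k] ee[of k'] by (auto simp: insert_commute)
      then consider "k + 2 \<le> k'" | "k' + 2 \<le> k" by linarith
      then show ?thesis using lb leg_bad_sym[OF lb] u(3) v(3) unfolding bad_def by cases blast+
    next
      case 2
      have "two_legs_bad t k k'" unfolding two_legs_bad_def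
      proof (intro allI impI, elim conjE)
        fix c l0 l1 l2
        assume "spider c l0 l1 l2" "t \<le> length l0" "t \<le> length l1" "t \<le> length l2"
        then have "E ((c # place i i' l0 l1 l2 i) ! k) ((c # place i i' l0 l1 l2 i') ! k')"
          using single[OF u(2) v(2) 2(1)] by blast
        then show "E ((c # l0) ! k) ((c # l1) ! k')" using 2(1) by (simp add: place_def)
      qed
      then show ?thesis using two_legs_bad_sym[of t k k'] 2 u(3) v(3) unfolding bad_def by (meson nat_le_linear)
    qed
  qed
qed

end

theorem mainTheorem2:
  shows "\<forall>t::nat. \<exists>c::nat. \<forall>G :: 'a graph.
           G \<in> X t \<and> \<not> (\<exists>x y. false_twins G x y) \<and>
           \<not> (\<exists>U. clique_cutset G U \<and> card U \<le> 2)
           \<longrightarrow> complete_graph G \<or> treewidth G \<le> c"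
proof
  fix t :: nat
  obtain n where n: "\<forall>(W::'a set) (F::'a set set). finite W \<and> card W \<ge> n \<longrightarrow>
      (\<exists>R \<subseteq> W. card R = 6 * t + 6 \<and> clique R F \<or> card R = 6 * t + 6 \<and> indep R F)"
    using ramsey2[of "6 * t + 6" "6 * t + 6"] by blast
  define m1 where "m1 = 2 * (n + 2) * t"
  \<comment> \<open>\<open>M\<close> and \<open>N\<close> add up all demands on leg length and on
    reserve, so that each follows by \<open>rich_mono\<close>.\<close>
  define M where "M = (2 * n + 2 * t + 2) * t + m1 + (4 * n * t * t + t)"
  define N where "N = ((3 * m1 + 2 + n * 2 ^ (3 * m1 + 1)) + 2 * n * (3 * t + 1)) + 2 * t * (3 * t + 1)"
  show "\<exists>c. \<forall>G :: 'a graph. G \<in> X t \<and> \<not> (\<exists>x y. false_twins G x y) \<and>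
      \<not> (\<exists>U. clique_cutset G U \<and> card U \<le> 2) \<longrightarrow> complete_graph G \<or> treewidth G \<le> c"
  proof (intro exI[of _ "N + 7 * M"] allI impI, elim conjE)
    fix G :: "'a graph"
    assume GX: "G \<in> X t" and tw: "\<not> (\<exists>x y. false_twins G x y)"
      and cut: "\<not> (\<exists>U. clique_cutset G U \<and> card U \<le> 2)"
    have wf: "wf_graph G" and no: "\<not> si_arrow G (tS t)" using GX by (auto simp: X_def SiFree_def)
    \<comment> \<open>For \<open>t = 0\<close> the forest is the empty graph, which every
      \<open>G\<close> produces, so the class \<open>X 0\<close> is empty.\<close>
    have t: "1 \<le> t"
    proof (rule ccontr)
      assume "\<not> 1 \<le> t"
      then have "verts (tS t) = {}" "edges (tS t) = {}" by (auto simp: tS_def verts_def edges_def)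
      then have "si_arrow G (tS t)"
        by (intro si_arrowI[OF wf, of _ "{\<lambda>_. undefined}"]) (auto simp: wf_graph_def)
      then show False using no by simp
    qed
    have pair: "\<exists>u v. e = {u, v} \<and> u \<noteq> v \<and> u \<in> verts G \<and> v \<in> verts G" if "e \<in> edges G" for e
      using wf that by (simp add: wf_graph_def)
    interpret ugraph "verts G" "adj G"
    proof
      show "finite (verts G)" using wf by (simp add: wf_graph_def)
      show "adj G y x" if "adj G x y" for x y using that by (simp add: adj_def insert_commute)
      show "\<not> adj G x x" for x
      proof
        assume "adj G x x"
        then have "{x, x} \<in> edges G" by (simp add: adj_def)
        from pair[OF this] show False by auto
      qed
      show "x \<in> verts G" if "adj G x y" for x y
      proof -
        have "{x, y} \<in> edges G" using that by (simp add: adj_def)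
        from pair[OF this] show ?thesis by (auto simp: doubleton_eq_iff)
      qed
    qed
    show "complete_graph G \<or> treewidth G \<le> N + 7 * M"
    proof (rule ccontr)
      assume "\<not> (complete_graph G \<or> treewidth G \<le> N + 7 * M)"
      then have nc: "\<not> complete_graph G" and big: "\<not> treewidth G \<le> N + 7 * M" by auto
      have "\<not> has_td (verts G) (N + 7 * M)"
      proof
        assume "has_td (verts G) (N + 7 * M)"
        then obtain Bs where Bs: "covers Bs (verts G)" "\<forall>B\<in>set Bs. card B \<le> N + 7 * M"
          unfolding has_td_def by blast
        have "treewidth G \<le> N + 7 * M"
        proof (rule treewidth_le_rip[OF wf])
          show "rip Bs" "\<Union>(set Bs) = verts G" using Bs(1) by (auto simp: covers_def)
          show "card B \<le> Suc (N + 7 * M)" if "B \<in> set Bs" for B using Bs(2) that by auto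
          fix e assume e: "e \<in> edges G"
          then obtain u v where "e = {u, v}" "u \<in> verts G" "v \<in> verts G" using pair by blast
          moreover from this have "adj G u v" using e by (simp add: adj_def)
          ultimately show "\<exists>B\<in>set Bs. e \<subseteq> B" using Bs(1) unfolding covers_def by auto
        qed
        then show False using big by simp
      qed
      moreover have "t \<le> M" "1 \<le> M" using t by (simp_all add: M_def)
      ultimately have rich: "rich M N" by (intro not_td_rich)
      have "rich t (2 * t * (3 * t + 1))" by (rule rich_mono[OF rich]) (use \<open>t \<le> M\<close> in \<open>auto simp: N_def\<close>)
      then have "bad t" by (intro not_si_arrow_bad[OF wf refl refl t no])
      moreover have "\<not> bad t"
      proof (rule rich_not_bad[OF n _ _ _ m1_def])
        show "rich ((2 * n + 2 * t + 2) * t + m1 + (4 * n * t * t + t))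
           ((3 * m1 + 2 + n * 2 ^ (3 * m1 + 1)) + 2 * n * (3 * t + 1))"
          by (rule rich_mono[OF rich]) (simp_all add: M_def N_def)
        show "\<not> clique_on (verts G)" using nc by (auto simp: complete_graph_def is_clique_def clique_on_def)
        show "\<exists>w. adj G x w \<noteq> adj G y w" if "x \<in> verts G" "y \<in> verts G" "x \<noteq> y" "\<not> adj G x y" for x y
          using tw that unfolding false_twins_def nbhd_def by auto
        fix U x y assume U: "U \<subseteq> verts G" "clique_on U" "card U \<le> 2" and xy: "x \<in> verts G - U" "y \<in> verts G - U"
        have "is_clique G U" using U by (auto simp: is_clique_def clique_on_def)
        then have "connected_graph (del_verts G U)" using cut U(3) by (auto simp: clique_cutset_def)
        then have "(adj (del_verts G U))\<^sup>*\<^sup>* x y" using xy by (simp add: connected_graph_def del_verts_def verts_def)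
        then show "reach (verts G - U) x y"
        proof (induction rule: rtranclp_induct)
          case base
          show ?case by (rule reach_refl)
        next
          case (step y z)
          then have "adj G y z" "y \<notin> U" "z \<notin> U" by (auto simp: adj_def del_verts_def edges_def)
          then show ?case using step.IH E_V E_sym by (intro reach_step[OF step.IH]) blast+
        qed
      qed
      ultimately show False by simp
    qed
  qed
qed

end
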